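(* Let $q\ge1$ be an integer, $p>2q-1$ real, $k\in\{1,\ldots,q\}$ and $u\in U_q$. Then $$X_{k,u}:=\left\{\left(u\begin{pmatrix}\tilde r&0\\0&0\end{pmatrix}u^*,a\right):\tilde r\in\Pi_k,\ a\in\mathbb{R}\right\}$$ is a subhypergroup of $(\Pi_q\times\mathbb{R},*_{p,q})$, and the mapping $$(\tilde r,a)\mapsto\left(u\begin{pmatrix}\tilde r&0\\0&0\end{pmatrix}u^*,a\right)$$ is a hypergroup isomorphism between the Heisenberg hypergroup $(\Pi_k\times\mathbb{R},*_{p,k})$ and the subhypergroup $(X_{k,u},*_{p,q})$.
   Context: For an integer $k\ge1$, $\Pi_k$ is the cone of Hermitian positive semidefinite complex $k\times k$ matrices; $U_q$ is the unitary group. For real $p>2k-1$, $(\Pi_k\times\mathbb{R},*_{p,k})$ is the (Heisenberg) hypergroup with identity $(0,0)$, involution $\overline{(r,a)}=(r,-a)$ and convolution of point measures $$(\delta_{(r,a)}*_{p,k}\delta_{(s,b)})(f)=\kappa_{p,k}\int_{B_k} f\Bigl(\sqrt{r^2+s^2+rws+(rws)^*},\,a+b-\operatorname{Im}\operatorname{tr}(rws)\Bigr)\Delta(I_k-w^*w)^{p-2k}\,dw,$$ $f\in C_b(\Pi_k\times\mathbb{R})$, where $B_k$ is the set of complex $k\times k$ matrices $w$ with $I_k-w^*w$ positive definite, $\Delta$ is the determinant, $dw$ Lebesgue measure and $\kappa_{p,k}^{-1}=\int_{B_k}\Delta(I_k-w^*w)^{p-2k}dw$. A closed set $X\subset\Pi_q\times\mathbb{R}$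 is a subhypergroup if for all $x,y\in X$ one has $\bar x\in X$ and $\operatorname{supp}(\delta_x*_{p,q}\delta_y)\subset X$; it then carries the restricted convolution. A hypergroup isomorphism is a homeomorphism that respects the involutions and whose induced map on measures (image measure) maps $\delta_x*\delta_y$ to the convolution of the point measures at the images of $x$ and $y$. *)

theory Defs
  imports "HOL-Analysis.Analysis"
begin

section \<open>Complex matrices\<close>

text \<open>Square matrices of size \<open>k\<close> are elements of \<open>complex^'k^'k\<close> with \<open>CARD('k) = k\<close>.
  Products \<open>**\<close>, \<open>trace\<close>, \<open>det\<close>, the Euclidean topology and the Lebesgue measure \<open>lborel\<close> on
  this space are those of the library.\<close>

type_synonym 'n cmatrix = "complex^'n^'n"

definition conj_transpose :: "complex^'n^'m \<Rightarrow> complex^'m^'n" where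
  "conj_transpose A = (\<chi> i j. cnj (A $ j $ i))"

definition hermitian :: "('n::finite) cmatrix \<Rightarrow> bool" where
  "hermitian A \<longleftrightarrow> conj_transpose A = A"

definition unitary :: "('n::finite) cmatrix \<Rightarrow> bool" where
  "unitary u \<longleftrightarrow> conj_transpose u ** u = mat 1 \<and> u ** conj_transpose u = mat 1"

definition quad_form :: "('n::finite) cmatrix \<Rightarrow> complex^'n \<Rightarrow> complex" where
  "quad_form A x = (\<Sum>i\<in>UNIV. cnj (x $ i) * (A *v x) $ i)"

text \<open>For Hermitian \<open>A\<close> the number \<open>quad_form A x\<close> is real, so taking \<open>Re\<close> loses nothing.\<close>

definition psd_matrices :: "('n::finite) cmatrix set" where
  "psd_matrices = {A. hermitian A \<and> (\<forall>x. 0 \<le> Re (quad_form A x))}"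

definition pd_matrices :: "('n::finite) cmatrix set" where
  "pd_matrices = {A. hermitian A \<and> (\<forall>x. x \<noteq> 0 \<longrightarrow> 0 < Re (quad_form A x))}"

definition psd_sqrt :: "('n::finite) cmatrix \<Rightarrow> 'n cmatrix" where
  "psd_sqrt A = (THE B. B \<in> psd_matrices \<and> B ** B = A)"

text \<open>\<open>index_pos i\<close> is the position (counted from \<open>0\<close>) of the row or column index \<open>i\<close> in the
  order of the index type. \<open>pad_zero r\<close> is the block matrix with \<open>r\<close> in the upper left corner and
  zeros elsewhere; it is meaningful for \<open>CARD('k) \<le> CARD('q)\<close>.\<close>

definition index_pos :: "'n::{finite,linorder} \<Rightarrow> nat" where
  "index_pos i = card {..<i}"

definition index_at :: "nat \<Rightarrow> 'n::{finite,linorder}" where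
  "index_at = inv index_pos"

definition pad_zero ::
    "('k::{finite,linorder}) cmatrix \<Rightarrow> ('q::{finite,linorder}) cmatrix" where
  "pad_zero r = (\<chi> i j. if index_pos i < CARD('k) \<and> index_pos j < CARD('k)
                        then r $ index_at (index_pos i) $ index_at (index_pos j) else 0)"


section \<open>Hypergroups, subhypergroups, isomorphisms\<close>

text \<open>The data of a hypergroup realised on a subset of a topological space. The field \<open>hg_conv\<close> gives
  the convolution of the point measures at two points, as a Borel measure on \<open>hg_space\<close>.\<close>

record 'a hypergroup =
  hg_space :: "'a set"
  hg_conv :: "'a \<Rightarrow> 'a \<Rightarrow> 'a measure"
  hg_inv :: "'a \<Rightarrow> 'a"
  hg_one :: "'a"

definition measure_supp :: "'a::topological_space measure \<Rightarrow> 'a set" where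
  "measure_supp M =
     {x \<in> space M. \<forall>U. open U \<and> x \<in> U \<longrightarrow> 0 < emeasure M (U \<inter> space M)}"

definition subhypergroup :: "'a::topological_space hypergroup \<Rightarrow> 'a set \<Rightarrow> bool" where
  "subhypergroup H X \<longleftrightarrow>
     closedin (top_of_set (hg_space H)) X \<and>
     (\<forall>x\<in>X. \<forall>y\<in>X. hg_inv H x \<in> X \<and> measure_supp (hg_conv H x y) \<subseteq> X)"

definition restrict_hypergroup :: "'a hypergroup \<Rightarrow> 'a set \<Rightarrow> 'a hypergroup" where
  "restrict_hypergroup H X =
     H\<lparr>hg_space := X, hg_conv := (\<lambda>x y. restrict_space (hg_conv H x y) X)\<rparr>"

definition hypergroup_iso ::
    "'a::topological_space hypergroup \<Rightarrow> 'b::topological_space hypergroup \<Rightarrow> ('a \<Rightarrow> 'b) \<Rightarrow> bool"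
  where
  "hypergroup_iso H K \<phi> \<longleftrightarrow>
     homeomorphic_map (top_of_set (hg_space H)) (top_of_set (hg_space K)) \<phi> \<and>
     (\<forall>x\<in>hg_space H. \<phi> (hg_inv H x) = hg_inv K (\<phi> x)) \<and>
     (\<forall>x\<in>hg_space H. \<forall>y\<in>hg_space H.
        distr (hg_conv H x y) (restrict_space borel (hg_space K)) \<phi> = hg_conv K (\<phi> x) (\<phi> y))"


section \<open>The Heisenberg hypergroups\<close>

definition heis_ball :: "('k::finite) cmatrix set" where
  "heis_ball = {w. mat 1 - conj_transpose w ** w \<in> pd_matrices}"

text \<open>On \<open>heis_ball\<close> the determinant below is a positive real number.\<close>

definition heis_weight :: "real \<Rightarrow> ('k::finite) cmatrix \<Rightarrow> real" where
  "heis_weight p w = Re (det (mat 1 - conj_transpose w ** w)) powr (p - 2 * real CARD('k))"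

definition heis_kappa :: "('k::finite) itself \<Rightarrow> real \<Rightarrow> real" where
  "heis_kappa _ p =
     inverse (integral\<^sup>L (restrict_space lborel (heis_ball :: 'k cmatrix set)) (heis_weight p))"

definition heis_point ::
    "('k::finite) cmatrix \<times> real \<Rightarrow> 'k cmatrix \<times> real \<Rightarrow> 'k cmatrix \<Rightarrow> 'k cmatrix \<times> real" where
  "heis_point = (\<lambda>(r, a) (s, b) w.
     (psd_sqrt (r ** r + s ** s + r ** w ** s + conj_transpose (r ** w ** s)),
      a + b - Im (trace (r ** w ** s))))"

text \<open>The functional
  \<open>f \<mapsto> \<kappa> \<integral>\<^bsub>B\<^esub> f (heis_point x y w) \<Delta>(I - w\<^sup>* w)\<^bsup>p-2k\<^esup> dw\<close> is integration
  against the image, under \<open>heis_point x y\<close>, of the probability measure with density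
  \<open>\<kappa> \<Delta>(I - w\<^sup>* w)\<^bsup>p-2k\<^esup>\<close> on the ball \<open>B\<close>.\<close>

definition heis_conv ::
    "real \<Rightarrow> ('k::finite) cmatrix \<times> real \<Rightarrow> 'k cmatrix \<times> real \<Rightarrow> ('k cmatrix \<times> real) measure" where
  "heis_conv p x y =
     distr (density (restrict_space lborel heis_ball)
                    (\<lambda>w. ennreal (heis_kappa TYPE('k) p * heis_weight p w)))
           (restrict_space borel (psd_matrices \<times> UNIV))
           (heis_point x y)"

definition heisenberg :: "real \<Rightarrow> (('k::finite) cmatrix \<times> real) hypergroup" where
  "heisenberg p =
     \<lparr>hg_space = psd_matrices \<times> UNIV,
      hg_conv = heis_conv p,
      hg_inv = (\<lambda>(r, a). (r, - a)),
      hg_one = (0, 0)\<rparr>"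

definition heis_embed ::
    "('q::{finite,linorder}) cmatrix \<Rightarrow> ('k::{finite,linorder}) cmatrix \<times> real
       \<Rightarrow> 'q cmatrix \<times> real" where
  "heis_embed u = (\<lambda>(r, a). (u ** pad_zero r ** conj_transpose u, a))"

definition heis_sub :: "('k::{finite,linorder}) itself \<Rightarrow> ('q::{finite,linorder}) cmatrix
    \<Rightarrow> ('q cmatrix \<times> real) set" where
  "heis_sub _ u =
     {(u ** pad_zero r ** conj_transpose u, a) |(r :: 'k cmatrix) a. r \<in> psd_matrices}"

end

theory Submission
  imports Defs
begin

text \<open>
  The block embedding is \<open>r \<mapsto> V r V\<^sup>\<dagger>\<close> for an isometry \<open>V\<close> from the small coordinate space into the large
  one, \<open>V\<^sup>\<dagger> V = I\<close>: \<open>V\<close> is the inclusion of the first \<open>k\<close> coordinates followed by \<open>u\<close>. Everything in the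
  convolution formula is natural for isometries. Since \<open>(V r V\<^sup>\<dagger>) w (V s V\<^sup>\<dagger>) = V (r v s) V\<^sup>\<dagger>\<close> with
  \<open>v = V\<^sup>\<dagger> w V\<close>, and since square roots are unique and traces cyclic, the point produced by two embedded
  elements and a contraction \<open>w\<close> is the embedded point produced by the original elements and the
  compression \<open>v\<close> (\<open>heis_point_isometry\<close>). In particular supports stay in the image, which is closed.

  What remains is one fact about the random contraction: its compression must have the law that belongs
  to the same \<open>p\<close> in dimension \<open>k\<close> (\<open>heis_law_compress\<close>). The law is invariant under unitary
  conjugation, so it suffices to find the marginal of \<open>\<Delta>(I - w\<^sup>\<dagger> w)\<^sup>\<alpha> dw\<close>, \<open>\<alpha> = p - 2 q\<close>, on the upper left
  block. Fix the rows \<open>v\<close> of \<open>w\<close> in a set \<open>K\<close> and substitute \<open>x N\<close> for the other rows, where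
  \<open>N\<^sup>2 = I - v\<^sup>\<dagger> v\<close>. The determinant factors as \<open>\<Delta>(I - v\<^sup>\<dagger> v) \<Delta>(I - x\<^sup>\<dagger> x)\<close> (\<open>ball_weight_row_split\<close>), and the
  Jacobian \<open>(det N)\<^sup>2\<^sup>m = \<Delta>(I - v\<^sup>\<dagger> v)\<^sup>m\<close> for \<open>m\<close> such rows adds \<open>m\<close> to the exponent of the fixed part. Doing
  this for the columns and for the rows, with \<open>m = q - k\<close>, leaves the block with the exponent
  \<open>\<alpha> + 2 (q - k) = p - 2 k\<close> and a factor that depends on the other entries only
  (\<open>nn_integral_split_block\<close>, \<open>ball_weight_marginal\<close>).

  The normalising integral is finite for \<open>\<alpha> > - 1\<close> by the same device: splitting off one column and one
  row raises all exponents to \<open>\<alpha> + 1\<close> except that of a single entry, and the integral of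
  \<open>(1 - \<bar>z\<bar>\<^sup>2)\<^sup>\<alpha>\<close> over the unit disc converges.

  The block sizes are numbers, not types, so all substitutions are carried out in the full matrix space.
  They are based on two facts: linear isometries preserve Lebesgue measure, and an isometry of a product
  space can exchange a coordinate block of one factor with one of the other
  (\<open>nn_integral_separate\<close>, \<open>nn_integral_fibrewise_substitution\<close>). Square roots and Jacobians come from
  the spectral theorem for Hermitian matrices.
\<close>

section \<open>Adjoints and the spectral theorem\<close>

notation conj_transpose ("_\<^sup>\<dagger>" [1000] 999)

lemma conj_transpose_nth [simp]: "A\<^sup>\<dagger> $ i $ j = cnj (A $ j $ i)"
  by (simp add: conj_transpose_def)

lemma conj_transpose_conj_transpose [simp]: "(A\<^sup>\<dagger>)\<^sup>\<dagger> = A"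
  by (simp add: vec_eq_iff)

lemma conj_transpose_mult: "(A ** B)\<^sup>\<dagger> = B\<^sup>\<dagger> ** A\<^sup>\<dagger>"
  by (simp add: vec_eq_iff matrix_matrix_mult_def mult.commute)

lemma conj_transpose_add [simp]: "(A + B)\<^sup>\<dagger> = A\<^sup>\<dagger> + B\<^sup>\<dagger>"
  and conj_transpose_diff [simp]: "(A - B)\<^sup>\<dagger> = A\<^sup>\<dagger> - B\<^sup>\<dagger>"
  and conj_transpose_scaleR [simp]: "(c *\<^sub>R A)\<^sup>\<dagger> = c *\<^sub>R A\<^sup>\<dagger>"
  and conj_transpose_zero [simp]: "0\<^sup>\<dagger> = 0"
  by (simp_all add: vec_eq_iff)

lemma conj_transpose_mat_1 [simp]: "(mat 1 :: 'n::finite cmatrix)\<^sup>\<dagger> = mat 1"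
  by (auto simp: vec_eq_iff mat_def)

lemma complex_inner_mult: "x \<bullet> (a * y) = (cnj a * x) \<bullet> (y :: complex)"
  by (simp add: inner_complex_def algebra_simps)

lemma inner_matrix_vector_adjoint:
  fixes A :: "complex^'n^'m"
  shows "x \<bullet> (A *v y) = (A\<^sup>\<dagger> *v x) \<bullet> y"
proof -
  have "x \<bullet> (A *v y) = (\<Sum>i\<in>UNIV. \<Sum>j\<in>UNIV. x $ i \<bullet> (A $ i $ j * y $ j))"
    by (simp add: inner_vec_def matrix_vector_mult_def inner_sum_right)
  also have "\<dots> = (\<Sum>j\<in>UNIV. \<Sum>i\<in>UNIV. x $ i \<bullet> (A $ i $ j * y $ j))"
    by (rule sum.swap)
  also have "\<dots> = (A\<^sup>\<dagger> *v x) \<bullet> y"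
    by (simp add: inner_vec_def matrix_vector_mult_def inner_sum_left complex_inner_mult)
  finally show ?thesis .
qed

lemma inner_matrix_conj_transpose:
  fixes A B :: "complex^'n^'m"
  shows "A\<^sup>\<dagger> \<bullet> B\<^sup>\<dagger> = A \<bullet> B"
proof -
  have "A\<^sup>\<dagger> \<bullet> B\<^sup>\<dagger> = (\<Sum>i\<in>UNIV. \<Sum>j\<in>UNIV. A $ j $ i \<bullet> B $ j $ i)"
    by (simp add: inner_vec_def inner_complex_def)
  also have "\<dots> = A \<bullet> B"
    by (subst sum.swap) (simp add: inner_vec_def)
  finally show ?thesis .
qed

lemma inner_matrix_mult_left:
  fixes A B :: "complex^'n^'m" and U :: "complex^'m^'l"
  shows "(U ** A) \<bullet> C = A \<bullet> (U\<^sup>\<dagger> ** C)"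
proof -
  have "(U ** A) \<bullet> C = (\<Sum>i\<in>UNIV. \<Sum>j\<in>UNIV. \<Sum>k\<in>UNIV. (U $ i $ k * A $ k $ j) \<bullet> C $ i $ j)"
    by (simp add: inner_vec_def matrix_matrix_mult_def inner_sum_left)
  also have "\<dots> = (\<Sum>i\<in>UNIV. \<Sum>k\<in>UNIV. \<Sum>j\<in>UNIV. (U $ i $ k * A $ k $ j) \<bullet> C $ i $ j)"
    by (intro sum.cong refl sum.swap)
  also have "\<dots> = (\<Sum>k\<in>UNIV. \<Sum>i\<in>UNIV. \<Sum>j\<in>UNIV. (U $ i $ k * A $ k $ j) \<bullet> C $ i $ j)"
    by (rule sum.swap)
  also have "\<dots> = (\<Sum>k\<in>UNIV. \<Sum>j\<in>UNIV. \<Sum>i\<in>UNIV. (U $ i $ k * A $ k $ j) \<bullet> C $ i $ j)"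
    by (intro sum.cong refl sum.swap)
  also have "\<dots> = A \<bullet> (U\<^sup>\<dagger> ** C)"
    by (simp add: inner_vec_def matrix_matrix_mult_def inner_sum_right complex_inner_mult)
  finally show ?thesis .
qed

definition cinner :: "complex^'n \<Rightarrow> complex^'n \<Rightarrow> complex" where
  "cinner x y = (\<Sum>i\<in>UNIV. cnj (x $ i) * y $ i)"

lemma Re_cinner: "Re (cinner x y) = x \<bullet> y"
  by (simp add: cinner_def inner_vec_def inner_complex_def)

lemma cinner_commute: "cinner y x = cnj (cinner x y)"
  by (simp add: cinner_def mult.commute)

lemma cinner_add_left: "cinner (x + y) z = cinner x z + cinner y z"
  and cinner_add_right: "cinner z (x + y) = cinner z x + cinner z y"
  and cinner_diff_left: "cinner (x - y) z = cinner x z - cinner y z"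
  and cinner_diff_right: "cinner z (x - y) = cinner z x - cinner z y"
  and cinner_smult_left: "cinner (c *s x) z = cnj c * cinner x z"
  and cinner_smult_right: "cinner z (c *s x) = c * cinner z x"
  by (simp_all add: cinner_def algebra_simps sum.distrib sum_subtractf sum_distrib_left)

lemmas cinner_simps = cinner_add_left cinner_add_right cinner_diff_left cinner_diff_right
  cinner_smult_left cinner_smult_right

lemma cinner_adjoint: "cinner x (A *v y) = cinner (A\<^sup>\<dagger> *v x) y"
proof -
  have "cinner x (A *v y) = (\<Sum>i\<in>UNIV. \<Sum>j\<in>UNIV. cnj (x $ i) * (A $ i $ j * y $ j))"
    by (simp add: cinner_def matrix_vector_mult_def sum_distrib_left)
  also have "\<dots> = (\<Sum>j\<in>UNIV. \<Sum>i\<in>UNIV. cnj (x $ i) * (A $ i $ j * y $ j))"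
    by (rule sum.swap)
  also have "\<dots> = cinner (A\<^sup>\<dagger> *v x) y"
    by (simp add: cinner_def matrix_vector_mult_def sum_distrib_left mult_ac)
  finally show ?thesis .
qed

lemma Re_quad_form: "Re (quad_form A x) = x \<bullet> (A *v x)"
  by (simp add: quad_form_def flip: Re_cinner cinner_def)

lemma psd_matrices_iff: "A \<in> psd_matrices \<longleftrightarrow> A\<^sup>\<dagger> = A \<and> (\<forall>x. 0 \<le> x \<bullet> (A *v x))"
  by (simp add: psd_matrices_def hermitian_def Re_quad_form)

lemma pd_matrices_iff: "A \<in> pd_matrices \<longleftrightarrow> A\<^sup>\<dagger> = A \<and> (\<forall>x. x \<noteq> 0 \<longrightarrow> 0 < x \<bullet> (A *v x))"
  by (simp add: pd_matrices_def hermitian_def Re_quad_form)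

definition rdiag :: "('n::finite \<Rightarrow> real) \<Rightarrow> 'n cmatrix" where
  "rdiag d = (\<chi> i j. if i = j then complex_of_real (d i) else 0)"

lemma rdiag_mult_nth: "(rdiag d ** A) $ i $ j = complex_of_real (d i) * A $ i $ j"
  by (simp add: rdiag_def matrix_matrix_mult_def if_distrib[where f = "\<lambda>x. x * _"] cong: if_cong)

lemma mult_rdiag_nth: "(A ** rdiag d) $ i $ j = A $ i $ j * complex_of_real (d j)"
  by (simp add: rdiag_def matrix_matrix_mult_def if_distrib[where f = "\<lambda>x. _ * x"] cong: if_cong)

lemma rdiag_vector_nth: "(rdiag d *v x) $ i = d i *\<^sub>R x $ i"
  by (simp add: rdiag_def matrix_vector_mult_def if_distrib[where f = "\<lambda>x. x * _"] cong: if_cong)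
     (simp add: scaleR_conv_of_real)

lemma conj_transpose_rdiag [simp]: "(rdiag d)\<^sup>\<dagger> = rdiag d"
  by (auto simp: rdiag_def vec_eq_iff)

lemma rdiag_mult_rdiag: "rdiag d ** rdiag e = rdiag (\<lambda>i. d i * e i)"
  by (simp add: vec_eq_iff rdiag_mult_nth) (simp add: rdiag_def)

lemma det_rdiag: "det (rdiag d) = complex_of_real (\<Prod>i\<in>UNIV. d i)"
  by (subst det_diagonal) (auto simp: rdiag_def)

lemma rdiag_1: "rdiag (\<lambda>_. 1) = mat 1"
  by (simp add: rdiag_def mat_def cong: if_cong)

lemma continuous_on_cinner [continuous_intros]:
  assumes "continuous_on S f" "continuous_on S g"
  shows "continuous_on S (\<lambda>x. cinner (f x) (g x))"
  unfolding cinner_def by (intro continuous_intros assms)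

lemma unitary_iff: "unitary U \<longleftrightarrow> U\<^sup>\<dagger> ** U = mat 1"
  by (auto simp: unitary_def matrix_left_right_inverse)

text \<open>Maximising a weighted trace over all orthonormal frames diagonalises a Hermitian matrix: if two
  vectors of an optimal frame still interact, rotating them in their plane moves part of the smaller
  weighted diagonal entry to the larger one.\<close>

lemma orthonormal_frame_diagonalises:
  fixes A :: "('n::finite) cmatrix"
  assumes herm: "A\<^sup>\<dagger> = A"
  shows "\<exists>g :: 'n \<Rightarrow> complex^'n. \<forall>a b. cinner (g a) (g b) = of_bool (a = b) \<and>
                   (a \<noteq> b \<longrightarrow> cinner (g a) (A *v g b) = 0)"
proof -
  define F where "F = {g :: complex^'n^'n. \<forall>a b. cinner (g $ a) (g $ b) = of_bool (a = b)}"
  \<comment> \<open>Distinct weights make every rotation matter.\<close>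
  obtain lam :: "'n \<Rightarrow> real" where lam: "inj lam"
  proof -
    obtain h :: "'n \<Rightarrow> nat" where "inj h"
      using finite_imp_inj_to_nat_seg[of "UNIV :: 'n set"] by auto
    then have "inj (\<lambda>i. real (h i))"
      by (auto simp: inj_def)
    then show thesis by (rule that)
  qed
  define f where "f g = (\<Sum>b\<in>UNIV. lam b * (g $ b \<bullet> (A *v g $ b)))" for g :: "complex^'n^'n"
  have norm1: "norm (g $ b) = 1" if "g \<in> F" for g b
  proof -
    have "g $ b \<bullet> g $ b = 1"
      using that by (simp add: F_def flip: Re_cinner)
    then show ?thesis by (simp add: norm_eq_sqrt_inner)
  qed
  have "closed F"
    unfolding F_def by (intro closed_Collect_all closed_Collect_eq continuous_intros)
  moreover have "bounded F"
  proof (rule boundedI)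
    fix g assume "g \<in> F"
    then show "norm g \<le> real CARD('n)"
      using L2_set_le_sum[of UNIV "\<lambda>b. norm (g $ b)"] norm1[of g] by (simp add: norm_vec_def)
  qed
  ultimately have "compact F"
    by (simp add: compact_eq_bounded_closed)
  moreover have "F \<noteq> {}"
  proof -
    have "(\<chi> a b. of_bool (a = b)) \<in> F"
      by (auto simp: F_def cinner_def if_distrib cong: if_cong)
    then show ?thesis by blast
  qed
  moreover have "continuous_on F f"
    unfolding f_def matrix_vector_mult_def by (intro continuous_intros)
  ultimately obtain g where g: "g \<in> F" and gmax: "\<And>g'. g' \<in> F \<Longrightarrow> f g' \<le> f g"
    using continuous_attains_sup by metis
  have ortho: "cinner (g $ a) (g $ b) = of_bool (a = b)" for a b
    using g by (simp add: F_def)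
  have flip: "cinner (g $ b) (A *v g $ a) = cnj (cinner (g $ a) (A *v g $ b))" for a b
    by (metis cinner_adjoint cinner_commute herm)
  have step: False if lt: "lam j < lam i" and nz: "cinner (g $ i) (A *v g $ j) \<noteq> 0" for i j
  proof -
    define \<beta> where "\<beta> = cinner (g $ i) (A *v g $ j)"
    define qi where "qi = g $ i \<bullet> (A *v g $ i)"
    define qj where "qj = g $ j \<bullet> (A *v g $ j)"
    \<comment> \<open>The phase \<open>z\<close> makes the interaction \<open>z \<beta>\<close> positive, and \<open>t\<close>, the tangent of the angle of
      rotation, is so small that the linear gain \<open>2 t \<bar>\<beta>\<bar>\<close> exceeds the quadratic loss.\<close>
    define z where "z = cnj \<beta> / norm \<beta>"
    define t where "t = norm \<beta> / (1 + \<bar>qj - qi\<bar>)"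
    define n where "n = 1 / sqrt (1 + t\<^sup>2)"
    have ij: "i \<noteq> j" using lt by auto
    have b0: "norm \<beta> > 0" using nz by (simp add: \<beta>_def)
    have t0: "t > 0" using b0 by (simp add: t_def)
    have tp: "1 + t\<^sup>2 > 0" by (simp add: add_pos_nonneg)
    have n2: "n * n = 1 / (1 + t\<^sup>2)" using tp by (simp add: n_def flip: power2_eq_square) (simp add: power_divide)
    have bb: "\<beta> * cnj \<beta> = complex_of_real (norm \<beta>) * complex_of_real (norm \<beta>)"
      using complex_norm_square[of \<beta>] by (simp add: power2_eq_square)
    have zb: "z * \<beta> = norm \<beta>"
      using b0 bb by (simp add: z_def mult.commute field_simps)
    have zz: "cnj z * z = 1"
      using b0 bb by (simp add: z_def field_simps)
    define hi where "hi = g $ i + (of_real t * z) *s g $ j"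
    define hj where "hj = g $ j - (of_real t * cnj z) *s g $ i"
    have hh: "cinner hi hi = 1 + t\<^sup>2" "cinner hj hj = 1 + t\<^sup>2" "cinner hi hj = 0" "cinner hj hi = 0"
      using ij zz by (simp_all add: hi_def hj_def cinner_simps ortho power2_eq_square mult_ac)
    have ho: "cinner hi (g $ b) = 0" "cinner hj (g $ b) = 0" "cinner (g $ b) hi = 0" "cinner (g $ b) hj = 0"
      if "b \<noteq> i" "b \<noteq> j" for b
      using that by (auto simp: hi_def hj_def cinner_simps ortho)
    define g' where "g' = (\<chi> b. if b = i then of_real n *s hi else if b = j then of_real n *s hj else g $ b)"
    have g'_nth: "g' $ i = of_real n *s hi" "g' $ j = of_real n *s hj"
      "\<And>b. b \<noteq> i \<Longrightarrow> b \<noteq> j \<Longrightarrow> g' $ b = g $ b"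
      using ij by (auto simp: g'_def)
    have n3: "complex_of_real n * (complex_of_real n * (1 + (complex_of_real t)\<^sup>2)) = 1"
    proof -
      have "n * (n * (1 + t\<^sup>2)) = 1" using n2 tp by (simp flip: mult.assoc)
      then have "complex_of_real (n * (n * (1 + t\<^sup>2))) = complex_of_real 1" by (rule arg_cong)
      then show ?thesis by (simp only: of_real_1 of_real_add of_real_mult of_real_power)
    qed
    have "g' \<in> F"
      unfolding F_def using ij
      by (auto simp: g'_def cinner_simps hh ho ortho n3)
    then have le: "f g' \<le> f g" by (rule gmax)
    have qhi: "Re (cinner hi (A *v hi)) = qi + 2 * t * norm \<beta> + t\<^sup>2 * qj"
    proof -
      have "cinner hi (A *v hi) = cinner (g $ i) (A *v g $ i) + t * (z * \<beta>) + t * cnj (z * \<beta>)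
          + t\<^sup>2 * (cnj z * z) * cinner (g $ j) (A *v g $ j)"
        by (simp add: hi_def cinner_simps matrix_vector_right_distrib vector_scalar_commute
            flip[of j i] \<beta>_def algebra_simps power2_eq_square)
      then show ?thesis
        unfolding zb zz by (simp add: qi_def qj_def Re_cinner)
    qed
    have qhj: "Re (cinner hj (A *v hj)) = qj - 2 * t * norm \<beta> + t\<^sup>2 * qi"
    proof -
      have "cinner hj (A *v hj) = cinner (g $ j) (A *v g $ j) - t * (z * \<beta>) - t * cnj (z * \<beta>)
          + t\<^sup>2 * (cnj z * z) * cinner (g $ i) (A *v g $ i)"
        by (simp add: hj_def cinner_simps matrix_vector_mult_diff_distrib vector_scalar_commute
            flip[of j i] \<beta>_def algebra_simps power2_eq_square)
      then show ?thesis
        unfolding zb zz by (simp add: qi_def qj_def Re_cinner)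
    qed
    have sc: "(of_real n *s h) \<bullet> (A *v (of_real n *s h)) = Re (cinner h (A *v h)) / (1 + t\<^sup>2)" for h
    proof -
      have "cinner (of_real n *s h) (A *v (of_real n *s h)) = of_real (n * n) * cinner h (A *v h)"
        by (simp add: cinner_simps vector_scalar_commute)
      then show ?thesis by (simp add: n2 flip: Re_cinner)
    qed
    have "f g' - f g = (\<Sum>b\<in>UNIV. lam b * (g' $ b \<bullet> (A *v g' $ b)) - lam b * (g $ b \<bullet> (A *v g $ b)))"
      by (simp add: f_def sum_subtractf)
    also have "\<dots> = (\<Sum>b\<in>{i, j}. lam b * (g' $ b \<bullet> (A *v g' $ b)) - lam b * (g $ b \<bullet> (A *v g $ b)))"
      by (rule sum.mono_neutral_right) (auto simp: g'_nth(3))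
    also have "\<dots> = lam i * ((qi + 2 * t * norm \<beta> + t\<^sup>2 * qj) / (1 + t\<^sup>2) - qi)
       + lam j * ((qj - 2 * t * norm \<beta> + t\<^sup>2 * qi) / (1 + t\<^sup>2) - qj)"
      using ij by (simp add: g'_nth(1,2) sc qhi qhj algebra_simps flip: qi_def qj_def)
    also have "\<dots> = (lam i - lam j) * (t * (2 * norm \<beta> + t * (qj - qi)) / (1 + t\<^sup>2))"
    proof -
      have "(qi + 2 * t * norm \<beta> + t\<^sup>2 * qj) / (1 + t\<^sup>2) - qi
          = t * (2 * norm \<beta> + t * (qj - qi)) / (1 + t\<^sup>2)"
        using tp by (simp add: divide_simps) (simp add: algebra_simps power2_eq_square)
      moreover have "(qj - 2 * t * norm \<beta> + t\<^sup>2 * qi) / (1 + t\<^sup>2) - qj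
          = - (t * (2 * norm \<beta> + t * (qj - qi)) / (1 + t\<^sup>2))"
        using tp by (simp add: divide_simps) (simp add: algebra_simps power2_eq_square)
      ultimately show ?thesis
        by (simp only:) (simp add: left_diff_distrib diff_divide_distrib)
    qed
    finally have diff: "f g' - f g = (lam i - lam j) * (t * (2 * norm \<beta> + t * (qj - qi)) / (1 + t\<^sup>2))" .
    have "t * \<bar>qj - qi\<bar> \<le> t * (1 + \<bar>qj - qi\<bar>)" using t0 by simp
    also have "\<dots> = norm \<beta>" by (simp add: t_def)
    finally have "- (t * (qj - qi)) \<le> norm \<beta>"
      using mult_left_mono[of "- (qj - qi)" "\<bar>qj - qi\<bar>" t] t0 by linarith
    then have "0 < 2 * norm \<beta> + t * (qj - qi)" using b0 by linarith
    then have "0 < f g' - f g"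
      unfolding diff using lt t0 tp by simp
    with le show False by simp
  qed
  have "cinner (g $ a) (A *v g $ b) = 0" if "a \<noteq> b" for a b
  proof (rule ccontr)
    assume nz: "cinner (g $ a) (A *v g $ b) \<noteq> 0"
    then have "cinner (g $ b) (A *v g $ a) \<noteq> 0"
      by (simp add: flip[of b a])
    moreover have "lam a \<noteq> lam b" using lam that by (auto dest: injD)
    ultimately show False using step nz by (metis linorder_neqE)
  qed
  note eig = this
  show ?thesis
    by (rule exI[of _ "\<lambda>a. g $ a"]) (intro allI conjI impI ortho eig)
qed

theorem hermitian_spectral_decomposition:
  fixes A :: "('n::finite) cmatrix"
  assumes "A\<^sup>\<dagger> = A"
  obtains U :: "'n cmatrix" and d where "unitary U" "A = U ** rdiag d ** U\<^sup>\<dagger>"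
proof -
  obtain g :: "'n \<Rightarrow> complex^'n" where g: "\<And>a b. cinner (g a) (g b) = of_bool (a = b)"
      and gA: "\<And>a b. a \<noteq> b \<Longrightarrow> cinner (g a) (A *v g b) = 0"
    using orthonormal_frame_diagonalises[OF assms] by metis
  define U :: "'n cmatrix" where "U = (\<chi> i b. g b $ i)"
  define d where "d b = Re (cinner (g b) (A *v g b))" for b
  have "(U\<^sup>\<dagger> ** U) $ a $ b = cinner (g a) (g b)" for a b
    by (simp add: U_def matrix_matrix_mult_def cinner_def)
  then have "U\<^sup>\<dagger> ** U = mat 1"
    by (simp add: vec_eq_iff g mat_def)
  then have U: "unitary U" by (simp add: unitary_iff)
  have real: "cinner (g b) (A *v g b) = d b" for b
    using cinner_commute[of "g b" "A *v g b"] assms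
    by (simp add: d_def complex_eq_iff cinner_adjoint[of "g b" A])
  have "(U\<^sup>\<dagger> ** (A ** U)) $ a $ b = cinner (g a) (A *v g b)" for a b
    by (simp add: U_def matrix_matrix_mult_def matrix_vector_mult_def cinner_def)
  then have "U\<^sup>\<dagger> ** (A ** U) = rdiag d"
    by (auto simp: vec_eq_iff rdiag_def real gA)
  then have "U ** rdiag d ** U\<^sup>\<dagger> = (U ** U\<^sup>\<dagger>) ** A ** (U ** U\<^sup>\<dagger>)"
    by (metis matrix_mul_assoc)
  also have "\<dots> = A"
    using U by (simp add: unitary_def)
  finally show thesis using that U by metis
qed

section \<open>Positive semidefinite square roots\<close>

lemma unitary_conj_transpose: "unitary U \<Longrightarrow> unitary (U\<^sup>\<dagger>)"
  by (simp add: unitary_def)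

lemma unitary_cancel [simp]:
  assumes "unitary U"
  shows "U\<^sup>\<dagger> ** U = mat 1" "U ** U\<^sup>\<dagger> = mat 1" "U\<^sup>\<dagger> ** (U ** A) = A" "U ** (U\<^sup>\<dagger> ** A) = A"
    "U *v (U\<^sup>\<dagger> *v x) = x" "U\<^sup>\<dagger> *v (U *v x) = x"
  using assms by (simp_all add: unitary_def matrix_mul_assoc matrix_vector_mul_assoc)

lemma norm_unitary_mult_left: "unitary U \<Longrightarrow> norm (U ** A) = norm A"
  by (simp add: norm_eq_sqrt_inner inner_matrix_mult_left)

lemma norm_conj_transpose: "norm (A\<^sup>\<dagger>) = norm (A :: complex^'n^'m)"
  by (simp add: norm_eq_sqrt_inner inner_matrix_conj_transpose)

lemma norm_unitary_mult_right:
  assumes "unitary U"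
  shows "norm (A ** U) = norm A"
proof -
  have "norm (A ** U) = norm (U\<^sup>\<dagger> ** A\<^sup>\<dagger>)"
    by (metis norm_conj_transpose conj_transpose_mult)
  then show ?thesis
    using assms by (simp add: norm_unitary_mult_left unitary_conj_transpose norm_conj_transpose)
qed

lemma norm_unitary_mult_vector: "unitary U \<Longrightarrow> norm (U *v x) = norm x"
  by (simp add: norm_eq_sqrt_inner inner_matrix_vector_adjoint)

lemma norm_matrix_vector_le:
  fixes A :: "complex^'n^'m"
  shows "norm (A *v x) \<le> norm A * norm x"
proof -
  have "norm ((A *v x) $ i) \<le> norm (A $ i) * norm x" for i
  proof -
    have "norm ((A *v x) $ i) \<le> (\<Sum>j\<in>UNIV. \<bar>norm (A $ i $ j)\<bar> * \<bar>norm (x $ j)\<bar>)"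
      by (simp add: matrix_vector_mult_def order_trans[OF norm_sum] norm_mult)
    also have "\<dots> \<le> norm (A $ i) * norm x"
      unfolding norm_vec_def by (rule L2_set_mult_ineq)
    finally show ?thesis .
  qed
  then have "norm (A *v x) \<le> L2_set (\<lambda>i. norm (A $ i) * norm x) UNIV"
    unfolding norm_vec_def[of "A *v x"] by (intro L2_set_mono) auto
  also have "\<dots> = norm A * norm x"
    by (simp add: norm_vec_def[of A] L2_set_left_distrib)
  finally show ?thesis .
qed

lemma norm_rdiag: "(norm (rdiag e))\<^sup>2 = (\<Sum>i\<in>UNIV. (e i)\<^sup>2)"
proof -
  have "rdiag e \<bullet> rdiag e = (\<Sum>i\<in>UNIV. \<Sum>j\<in>UNIV. if i = j then e i * e i else 0)"
    unfolding inner_vec_def by (intro sum.cong refl) (simp add: rdiag_def inner_complex_def)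
  then show ?thesis
    by (simp add: power2_norm_eq_inner) (simp add: power2_eq_square)
qed

lemma matrix_vector_mult_axis_nth: "(A *v axis j 1) $ i = A $ i $ (j::'n::finite)"
  for A :: "complex^'n^'m"
  by (simp add: matrix_vector_mult_def axis_def if_distrib cong: if_cong)

lemma rdiag_eigenvector: "rdiag d *v axis i 1 = d i *\<^sub>R axis i 1"
  by (simp add: vec_eq_iff rdiag_vector_nth axis_def)

lemma matrix_vector_mult_scaleR: "A *v (c *\<^sub>R x) = c *\<^sub>R (A *v x)" for A :: "complex^'n^'m"
  by (simp add: vec_eq_iff matrix_vector_mult_def scaleR_sum_right)

lemma unitary_rdiag_eigenvector:
  assumes "unitary U"
  shows "(U ** rdiag d ** U\<^sup>\<dagger>) *v (U *v axis i 1) = d i *\<^sub>R (U *v axis i 1)"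
proof -
  have "(U ** rdiag d ** U\<^sup>\<dagger>) *v (U *v axis i 1) = U *v (rdiag d *v (U\<^sup>\<dagger> *v (U *v axis i 1)))"
    by (simp add: matrix_vector_mul_assoc matrix_mul_assoc)
  then show ?thesis
    using assms by (simp add: rdiag_eigenvector matrix_vector_mult_scaleR)
qed

lemma unitary_eigenvector_inner:
  assumes "unitary U"
  shows "(U *v axis i 1) \<bullet> ((U ** rdiag d ** U\<^sup>\<dagger>) *v (U *v axis i 1)) = d i"
  using norm_unitary_mult_vector[OF assms, of "axis i 1"]
  unfolding unitary_rdiag_eigenvector[OF assms] by (simp add: norm_eq_sqrt_inner)

lemma psd_matrices_conj: "A \<in> psd_matrices \<Longrightarrow> B ** A ** B\<^sup>\<dagger> \<in> psd_matrices"
  by (auto simp: psd_matrices_iff conj_transpose_mult matrix_mul_assoc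
      inner_matrix_vector_adjoint[of _ B] simp flip: matrix_vector_mul_assoc)

lemma psd_rdiag: "(\<And>i. 0 \<le> d i) \<Longrightarrow> rdiag d \<in> psd_matrices"
  by (simp add: psd_matrices_iff inner_vec_def rdiag_vector_nth sum_nonneg)

text \<open>At a unit eigenvector \<open>x\<close> of \<open>B - C\<close> with eigenvalue \<open>e\<close>, the form of \<open>B\<^sup>2 - C\<^sup>2\<close> is \<open>e (x \<bullet> B x + x \<bullet> C x)\<close>,
  while \<open>\<bar>e\<bar> = \<bar>x \<bullet> B x - x \<bullet> C x\<bar> \<le> x \<bullet> B x + x \<bullet> C x\<close>. This estimate gives both the uniqueness and
  the continuity of the square root.\<close>

lemma psd_root_dist_le:
  fixes B C :: "('n::finite) cmatrix"
  assumes B: "B \<in> psd_matrices" and C: "C \<in> psd_matrices"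
  shows "(norm (B - C))\<^sup>2 \<le> real CARD('n) * norm (B ** B - C ** C)"
proof -
  have "(B - C)\<^sup>\<dagger> = B - C"
    using B C by (simp add: psd_matrices_iff)
  then obtain U :: "'n cmatrix" and e where U: "unitary U" and dec: "B - C = U ** rdiag e ** U\<^sup>\<dagger>"
    by (rule hermitian_spectral_decomposition)
  have "(e i)\<^sup>2 \<le> norm (B ** B - C ** C)" for i
  proof -
    define x where "x = U *v axis i 1"
    have nx: "norm x = 1"
      using norm_unitary_mult_vector[OF U, of "axis i 1"] by (simp add: x_def)
    have X: "(B - C) *v x = e i *\<^sub>R x"
      using unitary_rdiag_eigenvector[OF U] by (simp add: dec x_def)
    have Bx: "B *v x = C *v x + e i *\<^sub>R x"
      using X by (simp add: matrix_vector_mult_diff_rdistrib algebra_simps)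
    have nn: "0 \<le> x \<bullet> (B *v x)" "0 \<le> x \<bullet> (C *v x)"
      using B C by (auto simp: psd_matrices_iff)
    have diff: "x \<bullet> (B *v x) - x \<bullet> (C *v x) = e i"
      using nx by (simp add: Bx inner_right_distrib norm_eq_1)
    have BB: "x \<bullet> (B *v (B *v x)) = (B *v x) \<bullet> (B *v x)"
      using B by (simp add: psd_matrices_iff inner_matrix_vector_adjoint)
    have CC: "x \<bullet> (C *v (C *v x)) = (C *v x) \<bullet> (C *v x)"
      using C by (simp add: psd_matrices_iff inner_matrix_vector_adjoint)
    have form: "x \<bullet> ((B ** B - C ** C) *v x) = e i * (x \<bullet> (B *v x) + x \<bullet> (C *v x))"
    proof -
      have "x \<bullet> ((B ** B - C ** C) *v x) = (B *v x) \<bullet> (B *v x) - (C *v x) \<bullet> (C *v x)"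
        by (simp add: matrix_vector_mult_diff_rdistrib inner_diff_right BB CC flip: matrix_vector_mul_assoc)
      then show ?thesis
        by (simp add: Bx inner_add_left inner_add_right inner_commute algebra_simps)
    qed
    have "(e i)\<^sup>2 \<le> \<bar>e i\<bar> * (x \<bullet> (B *v x) + x \<bullet> (C *v x))"
    proof -
      have "\<bar>e i\<bar> \<le> x \<bullet> (B *v x) + x \<bullet> (C *v x)"
        using nn diff by linarith
      then have "\<bar>e i\<bar> * \<bar>e i\<bar> \<le> \<bar>e i\<bar> * (x \<bullet> (B *v x) + x \<bullet> (C *v x))"
        by (rule mult_left_mono) simp
      then show ?thesis by (simp add: power2_eq_square)
    qed
    also have "\<dots> = \<bar>x \<bullet> ((B ** B - C ** C) *v x)\<bar>"
      using nn by (simp add: form abs_mult)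
    also have "\<dots> \<le> norm x * norm ((B ** B - C ** C) *v x)"
      by (rule Cauchy_Schwarz_ineq2)
    also have "\<dots> \<le> norm (B ** B - C ** C)"
      using norm_matrix_vector_le[of "B ** B - C ** C" x] by (simp add: nx)
    finally show ?thesis .
  qed
  then have "(\<Sum>i\<in>UNIV. (e i)\<^sup>2) \<le> real CARD('n) * norm (B ** B - C ** C)"
    using sum_mono[of UNIV "\<lambda>i. (e i)\<^sup>2" "\<lambda>_. norm (B ** B - C ** C)"] by simp
  then show ?thesis
    using U by (simp add: dec norm_unitary_mult_left norm_unitary_mult_right unitary_conj_transpose
        flip: norm_rdiag matrix_mul_assoc)
qed

lemma psd_root_unique:
  assumes "B \<in> psd_matrices" "C \<in> psd_matrices" "B ** B = C ** C"
  shows "B = C"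
  using psd_root_dist_le[OF assms(1,2)] assms(3) by simp

lemma psd_sqrt_eqI: "B \<in> psd_matrices \<Longrightarrow> B ** B = A \<Longrightarrow> psd_sqrt A = B"
  unfolding psd_sqrt_def by (rule the_equality) (auto intro: psd_root_unique)

lemma psd_eigenvalues_nonneg:
  assumes "unitary U" "U ** rdiag d ** U\<^sup>\<dagger> \<in> psd_matrices"
  shows "0 \<le> d i"
  using assms unitary_eigenvector_inner[OF assms(1), of i d] by (metis psd_matrices_iff)

lemma psd_sqrt:
  assumes "A \<in> psd_matrices"
  shows psd_sqrt_psd: "psd_sqrt A \<in> psd_matrices" and psd_sqrt_square: "psd_sqrt A ** psd_sqrt A = A"
proof -
  obtain U d where U: "unitary U" and dec: "A = U ** rdiag d ** U\<^sup>\<dagger>"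
    using assms hermitian_spectral_decomposition by (metis psd_matrices_iff)
  have d: "0 \<le> d i" for i
    using assms psd_eigenvalues_nonneg[OF U] by (simp add: dec)
  define B where "B = U ** rdiag (\<lambda>i. sqrt (d i)) ** U\<^sup>\<dagger>"
  have psd: "B \<in> psd_matrices"
    unfolding B_def by (intro psd_matrices_conj psd_rdiag) (simp add: d)
  have "B ** B = U ** (rdiag (\<lambda>i. sqrt (d i)) ** rdiag (\<lambda>i. sqrt (d i))) ** U\<^sup>\<dagger>"
    using U by (simp add: B_def flip: matrix_mul_assoc)
  then have sq: "B ** B = A"
    by (simp add: rdiag_mult_rdiag dec d)
  from psd sq psd_sqrt_eqI[OF psd sq]
  show "psd_sqrt A \<in> psd_matrices" "psd_sqrt A ** psd_sqrt A = A" by simp_all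
qed

lemma continuous_on_psd_sqrt: "continuous_on psd_matrices (psd_sqrt :: 'n::finite cmatrix \<Rightarrow> _)"
proof (rule continuous_onI)
  fix A :: "'n cmatrix" and \<epsilon> :: real
  assume A: "A \<in> psd_matrices" and \<epsilon>: "0 < \<epsilon>"
  show "\<exists>\<delta>>0. \<forall>A'\<in>psd_matrices. dist A' A < \<delta> \<longrightarrow> dist (psd_sqrt A') (psd_sqrt A) \<le> \<epsilon>"
  proof (intro exI conjI ballI impI)
    show "0 < \<epsilon>\<^sup>2 / real CARD('n)" using \<epsilon> by simp
    fix A' :: "'n cmatrix" assume A': "A' \<in> psd_matrices" and lt: "dist A' A < \<epsilon>\<^sup>2 / real CARD('n)"
    have "(norm (psd_sqrt A' - psd_sqrt A))\<^sup>2 \<le> real CARD('n) * norm (A' - A)"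
      using psd_root_dist_le[OF psd_sqrt_psd[OF A'] psd_sqrt_psd[OF A]]
      by (simp add: psd_sqrt_square A A')
    also have "\<dots> \<le> \<epsilon>\<^sup>2"
      using lt by (simp add: dist_norm field_simps)
    finally show "dist (psd_sqrt A') (psd_sqrt A) \<le> \<epsilon>"
      using \<epsilon> by (simp add: dist_norm power2_le_iff_abs_le)
  qed
qed

lemma pd_imp_psd: "A \<in> pd_matrices \<Longrightarrow> A \<in> psd_matrices"
  by (auto simp: pd_matrices_iff psd_matrices_iff) (metis inner_zero_left less_imp_le order_refl)

lemma pd_eigenvalues_pos:
  assumes "unitary U" "U ** rdiag d ** U\<^sup>\<dagger> \<in> pd_matrices"
  shows "0 < d i"
proof -
  have "U *v axis i 1 \<noteq> 0"
    using norm_unitary_mult_vector[OF assms(1), of "axis i 1"] by auto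
  then show ?thesis
    using assms unitary_eigenvector_inner[OF assms(1), of i d] by (metis pd_matrices_iff)
qed

lemma det_unitary_conj:
  assumes "unitary U"
  shows "det (U ** A ** U\<^sup>\<dagger>) = det A"
proof -
  have "det (U ** A ** U\<^sup>\<dagger>) = det (U ** U\<^sup>\<dagger>) * det A"
    by (simp add: det_mul)
  then show ?thesis using assms by simp
qed

lemma det_pd_pos:
  assumes "A \<in> pd_matrices"
  shows "0 < Re (det A)" "Im (det A) = 0"
proof -
  obtain U d where U: "unitary U" and dec: "A = U ** rdiag d ** U\<^sup>\<dagger>"
    using assms hermitian_spectral_decomposition by (metis pd_matrices_iff)
  have "0 < d i" for i
    using assms pd_eigenvalues_pos[OF U] by (simp add: dec)
  then show "0 < Re (det A)" "Im (det A) = 0"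
    by (simp_all add: dec det_unitary_conj[OF U] det_rdiag prod_pos del: of_real_prod)
qed

lemma psd_sqrt_pd:
  assumes "A \<in> pd_matrices"
  shows "psd_sqrt A \<in> pd_matrices"
  unfolding pd_matrices_iff
proof (intro conjI allI impI)
  define M where "M = psd_sqrt A"
  have psd: "M \<in> psd_matrices" and sq: "M ** M = A"
    using pd_imp_psd[OF assms] psd_sqrt by (auto simp: M_def)
  obtain U d where U: "unitary U" and dec: "M = U ** rdiag d ** U\<^sup>\<dagger>"
    using psd hermitian_spectral_decomposition by (metis psd_matrices_iff)
  have "M ** M = U ** rdiag (\<lambda>i. d i * d i) ** U\<^sup>\<dagger>"
    using U by (simp add: dec flip: matrix_mul_assoc rdiag_mult_rdiag)
  then have "0 < d i * d i" for i
    using pd_eigenvalues_pos[OF U, of "\<lambda>i. d i * d i"] assms sq by simp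
  then have d: "0 < d i" for i
    using psd_eigenvalues_nonneg[OF U, of d i] psd dec by (metis less_eq_real_def mult_zero_left less_irrefl)
  show "(psd_sqrt A)\<^sup>\<dagger> = psd_sqrt A"
    using psd by (simp add: M_def psd_matrices_iff)
  fix x :: "complex^'a" assume "x \<noteq> 0"
  define y where "y = U\<^sup>\<dagger> *v x"
  have "norm y = norm x"
    using norm_unitary_mult_vector[OF unitary_conj_transpose[OF U]] by (simp add: y_def)
  with \<open>x \<noteq> 0\<close> obtain i where i: "y $ i \<noteq> 0"
    by (metis norm_eq_zero vec_eq_iff zero_index)
  have "x \<bullet> (M *v x) = y \<bullet> (rdiag d *v y)"
    by (simp add: dec y_def inner_matrix_vector_adjoint flip: matrix_vector_mul_assoc)
  also have "\<dots> = (\<Sum>i\<in>UNIV. d i * (y $ i \<bullet> y $ i))"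
    by (simp add: inner_vec_def rdiag_vector_nth)
  also have "\<dots> > 0"
    using i d by (intro sum_pos2[of _ i]) (simp_all add: less_imp_le)
  finally show "0 < x \<bullet> (psd_sqrt A *v x)" by (simp add: M_def)
qed

lemma pd_matrix_surj:
  assumes "M \<in> pd_matrices"
  shows "surj ((*v) M)" "inj ((*v) M)"
proof -
  show inj: "inj ((*v) M)"
  proof (rule injI)
    fix x y assume "M *v x = M *v y"
    then have "(x - y) \<bullet> (M *v (x - y)) = 0"
      by (simp add: matrix_vector_mult_diff_distrib)
    with assms show "x = y"
      by (metis pd_matrices_iff less_irrefl eq_iff_diff_eq_0)
  qed
  show "surj ((*v) M)"
    using inj by (intro linear_injective_imp_surjective) (auto intro!: linearI simp: matrix_vector_right_distrib matrix_vector_mult_scaleR)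
qed

lemma pd_matrices_conj_iff:
  assumes M: "M \<in> pd_matrices" and A: "A\<^sup>\<dagger> = A"
  shows "M ** A ** M \<in> pd_matrices \<longleftrightarrow> A \<in> pd_matrices"
proof -
  have Mh: "M\<^sup>\<dagger> = M" using M by (simp add: pd_matrices_iff)
  have form: "x \<bullet> ((M ** A ** M) *v x) = (M *v x) \<bullet> (A *v (M *v x))" for x
    by (simp add: inner_matrix_vector_adjoint[of x M] Mh flip: matrix_vector_mul_assoc)
  have M0: "M *v x = 0 \<longleftrightarrow> x = 0" for x
    using pd_matrix_surj(2)[OF M] by (metis injD matrix_vector_mult_0_right)
  have "(\<forall>x. x \<noteq> 0 \<longrightarrow> 0 < (M *v x) \<bullet> (A *v (M *v x))) \<longleftrightarrow> (\<forall>y. y \<noteq> 0 \<longrightarrow> 0 < y \<bullet> (A *v y))"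
    using pd_matrix_surj(1)[OF M] M0 by (metis surjD)
  then show ?thesis
    by (simp add: pd_matrices_iff form conj_transpose_mult Mh A matrix_mul_assoc)
qed

section \<open>The matrix ball and its defect determinant\<close>

lemma matrix_add_rdistrib: "(A + B) ** C = A ** C + B ** C"
  and matrix_diff_ldistrib: "D ** (A - B) = D ** A - D ** B"
  and matrix_diff_rdistrib: "(A - B) ** C = A ** C - B ** C"
  for A B :: "complex^'m^'n" and C :: "complex^'l^'m" and D :: "complex^'n^'l"
  by (simp_all add: vec_eq_iff matrix_matrix_mult_def algebra_simps sum.distrib sum_subtractf)

lemma continuous_on_det [continuous_intros]:
  fixes f :: "'a::topological_space \<Rightarrow> ('n::finite) cmatrix"
  assumes "continuous_on S f"
  shows "continuous_on S (\<lambda>x. det (f x))"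
  unfolding det_def by (intro continuous_intros assms)

lemma continuous_on_matrix_mult [continuous_intros]:
  fixes f :: "'a::topological_space \<Rightarrow> complex^'m^'n" and g :: "'a \<Rightarrow> complex^'l^'m"
  assumes "continuous_on S f" "continuous_on S g"
  shows "continuous_on S (\<lambda>x. f x ** g x)"
  unfolding matrix_matrix_mult_def by (intro continuous_intros assms)

lemma continuous_on_conj_transpose [continuous_intros]:
  fixes f :: "'a::topological_space \<Rightarrow> complex^'m^'n"
  assumes "continuous_on S f"
  shows "continuous_on S (\<lambda>x. (f x)\<^sup>\<dagger>)"
  unfolding conj_transpose_def by (intro continuous_intros assms)

lemma continuous_on_matrix_vector [continuous_intros]:
  fixes f :: "'a::topological_space \<Rightarrow> complex^'m^'n"
  assumes "continuous_on S f" "continuous_on S g"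
  shows "continuous_on S (\<lambda>x. f x *v g x)"
  unfolding matrix_vector_mult_def by (intro continuous_intros assms)

lemma hermitian_defect: "(mat 1 - w\<^sup>\<dagger> ** w)\<^sup>\<dagger> = mat 1 - w\<^sup>\<dagger> ** w" for w :: "('n::finite) cmatrix"
  by (simp add: conj_transpose_mult)

lemma defect_form: "x \<bullet> ((mat 1 - w\<^sup>\<dagger> ** w) *v x) = (norm x)\<^sup>2 - (norm (w *v x))\<^sup>2"
  by (simp add: matrix_vector_mult_diff_rdistrib inner_diff_right power2_norm_eq_inner
      inner_matrix_vector_adjoint[of x "w\<^sup>\<dagger>"] flip: matrix_vector_mul_assoc)

lemma heis_ball_iff: "w \<in> heis_ball \<longleftrightarrow> (\<forall>x. x \<noteq> 0 \<longrightarrow> norm (w *v x) < norm x)"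
  by (simp add: heis_ball_def pd_matrices_iff conj_transpose_mult defect_form)
     (meson norm_ge_zero power2_less_imp_less power_strict_mono zero_less_numeral)

text \<open>For \<open>z = w\<^sup>\<dagger> y\<close> one has \<open>\<bar>z\<bar>\<^sup>2 = y \<bullet> w z \<le> \<bar>y\<bar> \<bar>w z\<bar>\<close>, so strict contractivity of \<open>w\<close> at \<open>z\<close> gives that of
  \<open>w\<^sup>\<dagger>\<close> at \<open>y\<close>.\<close>

lemma heis_ball_conj_transpose_imp:
  assumes "w \<in> heis_ball"
  shows "w\<^sup>\<dagger> \<in> heis_ball"
  unfolding heis_ball_iff
proof (intro allI impI)
  fix y :: "complex^'a" assume y: "y \<noteq> 0"
  define z where "z = w\<^sup>\<dagger> *v y"
  show "norm (w\<^sup>\<dagger> *v y) < norm y"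
  proof (cases "z = 0")
    case False
    have "norm z * norm z = y \<bullet> (w *v z)"
      by (simp add: inner_matrix_vector_adjoint z_def flip: power2_eq_square power2_norm_eq_inner)
    also have "\<dots> \<le> norm y * norm (w *v z)" by (rule norm_cauchy_schwarz)
    also have "\<dots> < norm y * norm z"
      using False assms y by (simp add: heis_ball_iff)
    finally have "norm z * norm z < norm y * norm z" .
    then show ?thesis
      unfolding z_def by (rule mult_right_less_imp_less) simp
  qed (use y in \<open>simp add: z_def\<close>)
qed

lemma heis_ball_conj_transpose [simp]: "w\<^sup>\<dagger> \<in> heis_ball \<longleftrightarrow> w \<in> heis_ball"
  using heis_ball_conj_transpose_imp[of w] heis_ball_conj_transpose_imp[of "w\<^sup>\<dagger>"] by auto

text \<open>The complement of the ball is the projection of a closed set along the compact unit sphere.\<close>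

lemma open_heis_ball: "open (heis_ball :: 'n::finite cmatrix set)"
proof -
  define T where "T = {z :: (complex^'n) \<times> 'n cmatrix. fst z \<in> sphere 0 1 \<and> 1 \<le> norm (snd z *v fst z)}"
  have "closed T"
    unfolding T_def mem_sphere_0 by (intro closed_Collect_conj closed_Collect_le closed_Collect_eq continuous_intros)
  then have "closed {w. \<exists>x. x \<in> sphere 0 1 \<and> (x, w) \<in> T}"
    by (intro closed_compact_projection) auto
  also have "{w. \<exists>x. x \<in> sphere 0 1 \<and> (x, w) \<in> T} = - heis_ball"
  proof (intro set_eqI iffI)
    fix w assume "w \<in> {w. \<exists>x. x \<in> sphere 0 1 \<and> (x, w) \<in> T}"
    then obtain x where "norm x = 1" "1 \<le> norm (w *v x)"
      by (auto simp: T_def)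
    then show "w \<in> - heis_ball"
      unfolding heis_ball_iff Compl_iff by (metis norm_zero not_less zero_neq_one)
  next
    fix w :: "'n cmatrix" assume "w \<in> - heis_ball"
    then obtain x where x: "x \<noteq> 0" "norm x \<le> norm (w *v x)"
      by (auto simp: heis_ball_iff not_less)
    define y where "y = (1 / norm x) *\<^sub>R x"
    have "norm y = 1" "1 \<le> norm (w *v y)"
      using x by (simp_all add: y_def matrix_vector_mult_scaleR field_simps)
    then show "w \<in> {w. \<exists>x. x \<in> sphere 0 1 \<and> (x, w) \<in> T}"
      by (auto simp: T_def)
  qed
  finally show ?thesis by (simp add: closed_def)
qed

lemma heis_ball_entry_less:
  assumes "w \<in> heis_ball"
  shows "norm (w $ i $ j) < 1"
proof -
  have "norm (w $ i $ j) = norm ((w *v axis j 1) $ i)"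
    by (simp add: matrix_vector_mult_axis_nth)
  also have "\<dots> \<le> norm (w *v axis j 1)" by (rule Finite_Cartesian_Product.norm_nth_le)
  also have "\<dots> < norm (axis j (1::complex))"
    using assms unfolding heis_ball_iff by (metis axis_eq_0_iff zero_neq_one)
  finally show ?thesis by simp
qed

text \<open>The determinant of \<open>B + t I\<close> is a polynomial in \<open>t\<close>. It is not the zero polynomial, since
  \<open>B + t I\<close> is injective for \<open>t > \<bar>B\<bar>\<close>.\<close>

lemma finite_shift_eigenvalues:
  fixes B :: "('n::finite) cmatrix"
  shows "finite {t. det (B + mat t) = 0}"
proof -
  define e where "e i j = [:B $ i $ j, if i = j then 1 else 0:]" for i j
  define q where "q = det (\<chi> i j. e i j)"
  have e: "poly (e i j) t = (B + mat t) $ i $ j" for i j t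
    by (simp add: e_def mat_def)
  have q: "poly q t = det (B + mat t)" for t
    unfolding q_def det_def poly_sum poly_mult poly_prod of_int_poly by (simp add: e)
  have "q \<noteq> 0"
  proof
    assume "q = 0"
    define s where "s = norm B + 1"
    have "det (B + mat (complex_of_real s)) = 0"
      using q[of "complex_of_real s"] \<open>q = 0\<close> by simp
    then have "\<not> invertible (B + mat (complex_of_real s))"
      by (simp add: invertible_det_nz)
    then obtain x where x: "x \<noteq> 0" "(B + mat (complex_of_real s)) *v x = 0"
      unfolding invertible_left_inverse matrix_left_invertible_ker by blast
    have "(mat (complex_of_real s) :: 'n cmatrix) *v x = s *\<^sub>R x"
      by (simp add: vec_eq_iff matrix_vector_mult_def mat_def if_distrib[where f = "\<lambda>x. x * _"] cong: if_cong)
         (simp add: scaleR_conv_of_real)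
    then have "B *v x = - (s *\<^sub>R x)"
      using x(2) by (simp add: matrix_vector_mult_add_rdistrib add_eq_0_iff2)
    then have "s * norm x \<le> norm B * norm x"
      using norm_matrix_vector_le[of B x] by (simp add: s_def)
    then show False
      using x(1) by (simp add: s_def)
  qed
  then have "finite {t. poly q t = 0}" by (rule poly_roots_finite)
  then show ?thesis by (simp add: q)
qed

text \<open>Sylvester's determinant identity: conjugating with \<open>B\<close> proves it for invertible \<open>B\<close>, and
  \<open>B + t I\<close> is invertible for all small \<open>t \<noteq> 0\<close>.\<close>

lemma det_one_minus_commute:
  fixes A B :: "('n::finite) cmatrix"
  shows "det (mat 1 - A ** B) = det (mat 1 - B ** A)"
proof -
  have inv: "det (mat 1 - A ** C) = det (mat 1 - C ** A)" if "det C \<noteq> 0" for C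
  proof -
    have "C ** (mat 1 - A ** C) = (mat 1 - C ** A) ** C"
      by (simp add: matrix_diff_ldistrib matrix_diff_rdistrib matrix_mul_assoc)
    then have "det (C ** (mat 1 - A ** C)) = det ((mat 1 - C ** A) ** C)"
      by (rule arg_cong)
    then show ?thesis using that by (simp add: det_mul)
  qed
  define F where "F t = det (mat 1 - A ** (B + mat t)) - det (mat 1 - (B + mat t) ** A)" for t
  have "finite ({t. det (B + mat t) = 0} - {0})"
    using finite_shift_eigenvalues by blast
  then have "eventually (\<lambda>t. t \<notin> {t. det (B + mat t) = 0} - {0}) (at 0)"
    unfolding eventually_at_topological
    by (intro exI[of _ "- ({t. det (B + mat t) = 0} - {0})"])
      (auto simp del: Compl_Diff_eq intro!: open_Compl finite_imp_closed)
  then have "eventually (\<lambda>t. F t = 0) (at 0)"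
    unfolding eventually_at_filter by eventually_elim (auto simp: F_def inv)
  then have "(F \<longlongrightarrow> 0) (at 0)"
    by (rule tendsto_eventually)
  moreover have "continuous_on UNIV F"
  proof -
    have "continuous_on UNIV (\<lambda>t. if i = j then t else (0::complex))" for i j :: 'n
      by (cases "i = j") simp_all
    then have [continuous_intros]: "continuous_on UNIV (\<lambda>t. mat t :: 'n cmatrix)"
      unfolding mat_def by (intro continuous_on_vec_lambda)
    show ?thesis
      unfolding F_def by (intro continuous_intros)
  qed
  then have "(F \<longlongrightarrow> F 0) (at 0)"
    by (simp add: continuous_on_def)
  ultimately have "F 0 = 0"
    using tendsto_unique[OF at_neq_bot] by blast
  then show ?thesis
    by (simp add: F_def mat_0)
qed

definition defect_det :: "('n::finite) cmatrix \<Rightarrow> real" where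
  "defect_det w = Re (det (mat 1 - w\<^sup>\<dagger> ** w))"

lemma defect_det_conj_transpose [simp]: "defect_det (w\<^sup>\<dagger>) = defect_det w"
  by (simp add: defect_det_def det_one_minus_commute[of w])

lemma defect_det_pos: "w \<in> heis_ball \<Longrightarrow> 0 < defect_det w"
  by (simp add: defect_det_def heis_ball_def det_pd_pos)

lemma continuous_on_defect_det: "continuous_on S defect_det"
  unfolding defect_det_def by (intro continuous_intros)

text \<open>The weight \<open>\<Delta>(I - w\<^sup>\<dagger> w)\<^sup>\<alpha>\<close>, cut off outside the ball so that it can be integrated over the
  whole matrix space.\<close>

definition ball_weight :: "real \<Rightarrow> ('n::finite) cmatrix \<Rightarrow> ennreal" where
  "ball_weight \<alpha> w = (if w \<in> heis_ball then ennreal (defect_det w powr \<alpha>) else 0)"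

lemma ball_weight_measurable [measurable]: "ball_weight \<alpha> \<in> borel_measurable borel"
proof -
  have [measurable]: "defect_det \<in> borel_measurable borel"
    by (intro borel_measurable_continuous_onI continuous_on_defect_det)
  have [measurable]: "heis_ball \<in> sets borel"
    by (rule borel_open[OF open_heis_ball])
  show ?thesis
    unfolding ball_weight_def by measurable
qed

lemma ball_weight_conj_transpose [simp]: "ball_weight \<alpha> (w\<^sup>\<dagger>) = ball_weight \<alpha> w"
  by (simp add: ball_weight_def)

lemma ball_weight_unitary_conj:
  assumes u: "unitary u"
  shows "ball_weight \<alpha> (u\<^sup>\<dagger> ** w ** u) = ball_weight \<alpha> w"
proof -
  have eq: "mat 1 - (u\<^sup>\<dagger> ** w ** u)\<^sup>\<dagger> ** (u\<^sup>\<dagger> ** w ** u) = u\<^sup>\<dagger> ** (mat 1 - w\<^sup>\<dagger> ** w) ** u"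
    using u by (simp add: conj_transpose_mult matrix_diff_ldistrib matrix_diff_rdistrib flip: matrix_mul_assoc)
  have "defect_det (u\<^sup>\<dagger> ** w ** u) = defect_det w"
    using det_unitary_conj[OF unitary_conj_transpose[OF u], of "mat 1 - w\<^sup>\<dagger> ** w"]
    by (simp add: defect_det_def eq)
  moreover have "u\<^sup>\<dagger> ** w ** u \<in> heis_ball \<longleftrightarrow> w \<in> heis_ball"
  proof -
    have nz: "u *v x = 0 \<longleftrightarrow> x = 0" for x
      using norm_unitary_mult_vector[OF u, of x] by (metis norm_eq_zero)
    have "u\<^sup>\<dagger> ** w ** u \<in> heis_ball \<longleftrightarrow> (\<forall>x. u *v x \<noteq> 0 \<longrightarrow> norm (w *v (u *v x)) < norm (u *v x))"
      using u unitary_conj_transpose[OF u]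
      by (simp add: heis_ball_iff nz norm_unitary_mult_vector flip: matrix_vector_mul_assoc)
    also have "\<dots> \<longleftrightarrow> w \<in> heis_ball"
      unfolding heis_ball_iff using u by (metis unitary_cancel(5))
    finally show ?thesis .
  qed
  ultimately show ?thesis by (simp add: ball_weight_def)
qed

text \<open>The square root by which the complementary rows of a contraction have to be rescaled once a
  block \<open>v\<close> of its rows is fixed. The value outside the ball keeps the substitution invertible there.\<close>

definition defect_root :: "('n::finite) cmatrix \<Rightarrow> 'n cmatrix" where
  "defect_root v = (if v \<in> heis_ball then psd_sqrt (mat 1 - v\<^sup>\<dagger> ** v) else mat 1)"

lemma mat_1_pd: "mat 1 \<in> pd_matrices"
  by (simp add: pd_matrices_iff)

lemma defect_root_pd: "defect_root v \<in> pd_matrices"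
  by (simp add: defect_root_def heis_ball_def psd_sqrt_pd mat_1_pd)

lemma defect_root_square: "v \<in> heis_ball \<Longrightarrow> defect_root v ** defect_root v = mat 1 - v\<^sup>\<dagger> ** v"
  by (simp add: defect_root_def psd_sqrt_square pd_imp_psd heis_ball_def)

lemma det_defect_root:
  assumes "v \<in> heis_ball"
  shows "(Re (det (defect_root v)))\<^sup>2 = defect_det v"
proof -
  have "det (defect_root v) * det (defect_root v) = det (mat 1 - v\<^sup>\<dagger> ** v)"
    by (simp add: assms defect_root_square flip: det_mul)
  then have "Re (det (defect_root v) * det (defect_root v)) = defect_det v"
    by (simp add: defect_det_def)
  then show ?thesis
    using det_pd_pos(2)[OF defect_root_pd[of v]] by (simp add: power2_eq_square)
qed

text \<open>With \<open>N\<^sup>2 = I - v\<^sup>\<dagger> v\<close> the block product rule is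
  \<open>I - (v + w N)\<^sup>\<dagger> (v + w N) = N (I - w\<^sup>\<dagger> w) N\<close> as soon as \<open>v\<^sup>\<dagger> w = 0\<close>, for example when \<open>v\<close> and \<open>w\<close>
  occupy different rows. If \<open>v\<close> lies outside the ball, so does \<open>v + w\<close>, and both sides vanish.\<close>

lemma ball_weight_row_split:
  assumes orth: "v\<^sup>\<dagger> ** w = 0"
  shows "ball_weight \<alpha> (v + w ** defect_root v) = ball_weight \<alpha> v * ball_weight \<alpha> w"
proof -
  define N where "N = defect_root v"
  have Npd: "N \<in> pd_matrices" and Nh: "N\<^sup>\<dagger> = N"
    using defect_root_pd by (auto simp: N_def pd_matrices_iff)
  have orth': "w\<^sup>\<dagger> ** v = 0"
    using arg_cong[OF orth, of conj_transpose] by (simp add: conj_transpose_mult)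
  have sq: "(v + w ** N)\<^sup>\<dagger> ** (v + w ** N) = v\<^sup>\<dagger> ** v + N ** (w\<^sup>\<dagger> ** w) ** N"
  proof -
    have "v\<^sup>\<dagger> ** (w ** N) = 0" "N ** w\<^sup>\<dagger> ** v = 0"
      by (simp_all add: matrix_mul_assoc orth) (simp add: orth' flip: matrix_mul_assoc)
    then show ?thesis
      by (simp add: conj_transpose_mult Nh matrix_add_ldistrib matrix_add_rdistrib) (simp add: matrix_mul_assoc)
  qed
  show ?thesis
  proof (cases "v \<in> heis_ball")
    case True
    have eq: "mat 1 - (v + w ** N)\<^sup>\<dagger> ** (v + w ** N) = N ** (mat 1 - w\<^sup>\<dagger> ** w) ** N"
      unfolding sq using defect_root_square[OF True]
      by (simp add: matrix_diff_ldistrib matrix_diff_rdistrib flip: N_def)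
    have ball: "v + w ** N \<in> heis_ball \<longleftrightarrow> w \<in> heis_ball"
      unfolding heis_ball_def mem_Collect_eq eq by (rule pd_matrices_conj_iff[OF Npd hermitian_defect])
    have "det (N ** (mat 1 - w\<^sup>\<dagger> ** w) ** N) = of_real ((Re (det N))\<^sup>2) * det (mat 1 - w\<^sup>\<dagger> ** w)"
      using det_pd_pos(2)[OF Npd] by (simp add: det_mul power2_eq_square complex_eq_iff)
    then have "defect_det (v + w ** N) = defect_det v * defect_det w"
      unfolding defect_det_def[of "v + w ** N"] eq
      by (simp add: defect_det_def[of w] N_def det_defect_root[OF True] del: of_real_power)
    then show ?thesis
      using True ball by (auto simp: ball_weight_def N_def powr_mult ennreal_mult' defect_det_pos less_imp_le)
  next
    case False
    have "v + w \<notin> heis_ball"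
    proof
      assume "v + w \<in> heis_ball"
      then have lt: "norm ((v + w) *v x) < norm x" if "x \<noteq> 0" for x
        using that unfolding heis_ball_iff by blast
      have "norm (v *v x) < norm x" if "x \<noteq> 0" for x
      proof -
        have "(v *v x) \<bullet> (w *v x) = 0"
          by (simp add: inner_matrix_vector_adjoint[of _ w] matrix_vector_mul_assoc orth')
        then have "(norm ((v + w) *v x))\<^sup>2 = (norm (v *v x))\<^sup>2 + (norm (w *v x))\<^sup>2"
          by (simp add: power2_norm_eq_inner matrix_vector_mult_add_rdistrib inner_add_left inner_add_right inner_commute)
        then have "(norm (v *v x))\<^sup>2 \<le> (norm ((v + w) *v x))\<^sup>2" by simp
        then have "norm (v *v x) \<le> norm ((v + w) *v x)" by (rule power2_le_imp_le) simp
        with lt[OF that] show ?thesis by simp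
      qed
      then have "v \<in> heis_ball" unfolding heis_ball_iff by blast
      with False show False by simp
    qed
    then show ?thesis
      using False by (simp add: ball_weight_def defect_root_def)
  qed
qed

text \<open>On the range of \<open>A\<close> the square of the root \<open>N\<close> is the identity; as \<open>N\<close> is positive, it has no eigenvalue
  \<open>- 1\<close>, so it is the identity there itself.\<close>

lemma defect_root_fixes:
  assumes "v ** A = 0"
  shows "defect_root v ** A = A"
proof (cases "v \<in> heis_ball")
  case True
  define N where "N = defect_root v"
  have "N ** (N ** A) = (mat 1 - v\<^sup>\<dagger> ** v) ** A"
    using defect_root_square[OF True] by (simp add: N_def matrix_mul_assoc)
  also have "\<dots> = A"
    by (simp add: matrix_diff_rdistrib assms flip: matrix_mul_assoc)
  finally have NNA: "N ** (N ** A) = A" .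
  have "N *v (A *v x) = A *v x" for x
  proof (rule ccontr)
    assume ne: "N *v (A *v x) \<noteq> A *v x"
    define z where "z = N *v (A *v x) - A *v x"
    have "N *v (N *v (A *v x)) = A *v x"
      using arg_cong[OF NNA, of "\<lambda>M. M *v x"] by (simp add: matrix_vector_mul_assoc)
    then have "N *v z = - z"
      by (simp add: z_def matrix_vector_mult_diff_distrib)
    moreover have "0 < z \<bullet> (N *v z)"
      using defect_root_pd[of v] ne by (simp add: N_def z_def pd_matrices_iff)
    ultimately show False using inner_ge_zero[of z] by (simp del: inner_ge_zero)
  qed
  then have "(N ** A) *v x = A *v x" for x
    by (simp flip: matrix_vector_mul_assoc)
  then show ?thesis
    unfolding N_def by (metis matrix_eq)
qed (simp add: defect_root_def)

section \<open>Linear substitutions in Lebesgue integrals on Euclidean spaces\<close>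

lemma nn_integral_lborel_translate:
  fixes f :: "'a::euclidean_space \<Rightarrow> ennreal"
  assumes [measurable]: "f \<in> borel_measurable borel"
  shows "(\<integral>\<^sup>+x. f (x + a) \<partial>lborel) = (\<integral>\<^sup>+x. f x \<partial>lborel)"
proof -
  have "(\<integral>\<^sup>+x. f x \<partial>lborel) = (\<integral>\<^sup>+x. f x \<partial>distr lborel borel ((+) a))"
    by (simp add: lborel_distr_plus)
  also have "\<dots> = (\<integral>\<^sup>+x. f (x + a) \<partial>lborel)"
    by (simp add: nn_integral_distr add.commute)
  finally show ?thesis by simp
qed

lemma nn_integral_lborel_uminus:
  fixes f :: "'a::euclidean_space \<Rightarrow> ennreal"
  assumes [measurable]: "f \<in> borel_measurable borel"
  shows "(\<integral>\<^sup>+x. f (- x) \<partial>lborel) = (\<integral>\<^sup>+x. f x \<partial>lborel)"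
proof -
  have "lborel = distr lborel borel (uminus :: 'a \<Rightarrow> 'a)"
    by (rule trans[OF lborel_affine[of "-1" "0::'a"]]) (simp_all add: density_1)
  then have "(\<integral>\<^sup>+x. f x \<partial>lborel) = (\<integral>\<^sup>+x. f x \<partial>distr lborel borel (uminus :: 'a \<Rightarrow> 'a))"
    by (rule arg_cong)
  also have "\<dots> = (\<integral>\<^sup>+x. f (- x) \<partial>lborel)"
    by (simp add: nn_integral_distr)
  finally show ?thesis by simp
qed

lemma borel_measurable_linear:
  fixes T :: "'a::euclidean_space \<Rightarrow> 'b::euclidean_space"
  shows "linear T \<Longrightarrow> T \<in> borel_measurable borel"
  by (intro borel_measurable_continuous_onI linear_continuous_on) (simp add: linear_conv_bounded_linear)

text \<open>Uniqueness of Haar measure, in the form in which it is needed: the image of Lebesgue measure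
  under a surjective linear map is translation invariant, so it is proportional to Lebesgue measure.
  The double integral of \<open>f (T x + y) g y\<close> is evaluated in both orders.\<close>

lemma nn_integral_linear_proportional:
  fixes T :: "'a::euclidean_space \<Rightarrow> 'b::euclidean_space" and f g :: "'b \<Rightarrow> ennreal"
  assumes T: "linear T" "surj T"
    and [measurable]: "f \<in> borel_measurable borel" "g \<in> borel_measurable borel"
  shows "(\<integral>\<^sup>+x. f (T x) \<partial>lborel) * (\<integral>\<^sup>+y. g y \<partial>lborel) =
         (\<integral>\<^sup>+y. f y \<partial>lborel) * (\<integral>\<^sup>+x. g (T x) \<partial>lborel)"
proof -
  have [measurable]: "T \<in> borel_measurable borel"
    by (rule borel_measurable_linear[OF T(1)])
  obtain S where S: "T (S y) = y" for y
    using T(2) by (metis surj_f_inv_f)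
  have "(\<integral>\<^sup>+x. f (T x) \<partial>lborel) * (\<integral>\<^sup>+y. g y \<partial>lborel) = (\<integral>\<^sup>+y. \<integral>\<^sup>+x. f (T x) * g y \<partial>lborel \<partial>lborel)"
    by (simp add: nn_integral_multc nn_integral_cmult)
  also have "\<dots> = (\<integral>\<^sup>+y. \<integral>\<^sup>+x. f (T x + y) * g y \<partial>lborel \<partial>lborel)"
  proof (rule nn_integral_cong)
    fix y
    show "(\<integral>\<^sup>+x. f (T x) * g y \<partial>lborel) = (\<integral>\<^sup>+x. f (T x + y) * g y \<partial>lborel)"
      using nn_integral_lborel_translate[of "\<lambda>x. f (T x) * g y" "S y"] by (simp add: linear_add[OF T(1)] S)
  qed
  also have "\<dots> = (\<integral>\<^sup>+x. \<integral>\<^sup>+y. f (T x + y) * g y \<partial>lborel \<partial>lborel)"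
    by (rule lborel_pair.Fubini') measurable
  also have "\<dots> = (\<integral>\<^sup>+x. \<integral>\<^sup>+y. f y * g (y - T x) \<partial>lborel \<partial>lborel)"
  proof (rule nn_integral_cong)
    fix x
    show "(\<integral>\<^sup>+y. f (T x + y) * g y \<partial>lborel) = (\<integral>\<^sup>+y. f y * g (y - T x) \<partial>lborel)"
      using nn_integral_lborel_translate[of "\<lambda>y. f y * g (y - T x)" "T x"] by (simp add: add.commute)
  qed
  also have "\<dots> = (\<integral>\<^sup>+y. \<integral>\<^sup>+x. f y * g (y - T x) \<partial>lborel \<partial>lborel)"
    by (rule lborel_pair.Fubini') measurable
  also have "\<dots> = (\<integral>\<^sup>+y. f y * (\<integral>\<^sup>+x. g (T x) \<partial>lborel) \<partial>lborel)"
  proof (rule nn_integral_cong)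
    fix y
    have "(\<integral>\<^sup>+x. g (y - T x) \<partial>lborel) = (\<integral>\<^sup>+x. g (- T x) \<partial>lborel)"
      using nn_integral_lborel_translate[of "\<lambda>x. g (y - T x)" "S y"] by (simp add: linear_add[OF T(1)] S)
    also have "\<dots> = (\<integral>\<^sup>+x. g (T x) \<partial>lborel)"
      using nn_integral_lborel_uminus[of "\<lambda>x. g (T x)"] by (simp add: linear_neg[OF T(1)])
    finally show "(\<integral>\<^sup>+x. f y * g (y - T x) \<partial>lborel) = f y * (\<integral>\<^sup>+x. g (T x) \<partial>lborel)"
      by (simp add: nn_integral_cmult)
  qed
  finally show ?thesis by (simp add: nn_integral_multc)
qed

text \<open>\<open>jacobian T c\<close> says that \<open>c\<close> is the absolute determinant of an invertible linear map \<open>T\<close>; no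
  choice of coordinates is involved.\<close>

definition jacobian :: "('a::euclidean_space \<Rightarrow> 'a) \<Rightarrow> ennreal \<Rightarrow> bool" where
  "jacobian T c \<longleftrightarrow> T \<in> borel_measurable borel \<and>
     (\<forall>f\<in>borel_measurable borel. (\<integral>\<^sup>+x. f x \<partial>lborel) = c * (\<integral>\<^sup>+x. f (T x) \<partial>lborel))"

lemma jacobianD:
  "jacobian T c \<Longrightarrow> f \<in> borel_measurable borel \<Longrightarrow> (\<integral>\<^sup>+x. f x \<partial>lborel) = c * (\<integral>\<^sup>+x. f (T x) \<partial>lborel)"
  by (simp add: jacobian_def)

lemma jacobian_compose:
  assumes "jacobian T c" "jacobian S d"
  shows "jacobian (\<lambda>x. T (S x)) (c * d)"
  unfolding jacobian_def
proof (intro conjI ballI)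
  have [measurable]: "T \<in> borel_measurable borel" "S \<in> borel_measurable borel"
    using assms by (auto simp: jacobian_def)
  show "(\<lambda>x. T (S x)) \<in> borel_measurable borel" by measurable
  fix f :: "'a \<Rightarrow> ennreal" assume [measurable]: "f \<in> borel_measurable borel"
  show "(\<integral>\<^sup>+x. f x \<partial>lborel) = c * d * (\<integral>\<^sup>+x. f (T (S x)) \<partial>lborel)"
    using jacobianD[OF assms(1), of f] jacobianD[OF assms(2), of "\<lambda>x. f (T x)"] by (simp add: mult.assoc)
qed

text \<open>A linear isometry preserves the unit ball, which fixes the proportionality constant.\<close>

lemma jacobian_isometry:
  assumes T: "linear T" and iso: "\<And>x. norm (T x) = norm x"
  shows "jacobian T 1"
  unfolding jacobian_def
proof (intro conjI ballI)
  show "T \<in> borel_measurable borel" by (rule borel_measurable_linear[OF T])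
  fix f :: "'a \<Rightarrow> ennreal" assume [measurable]: "f \<in> borel_measurable borel"
  have "inj T"
    using iso by (metis T linear_injective_0 norm_eq_zero)
  then have "surj T" by (intro linear_injective_imp_surjective T) simp_all
  define v where "v = emeasure lborel (ball (0::'a) 1)"
  have "v \<noteq> \<infinity>"
    unfolding v_def using emeasure_lborel_ball_finite[of "0::'a" 1] by simp
  moreover have "v \<noteq> 0"
    using content_ball_pos[of 1 "0::'a"] by (auto simp: v_def measure_def)
  moreover have "(\<integral>\<^sup>+x. f (T x) \<partial>lborel) * v = (\<integral>\<^sup>+x. f x \<partial>lborel) * v"
    using nn_integral_linear_proportional[OF T \<open>surj T\<close>, of f "indicator (ball 0 1)"] iso
    by (simp add: v_def indicator_def[abs_def] flip: nn_integral_indicator)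
  ultimately show "(\<integral>\<^sup>+x. f x \<partial>lborel) = 1 * (\<integral>\<^sup>+x. f (T x) \<partial>lborel)"
    by (metis ennreal_mult_divide_eq infinity_ennreal_def mult_1)
qed

lemma jacobian_diagonal:
  fixes T :: "'a::euclidean_space \<Rightarrow> 'a"
  assumes T: "\<And>x b. b \<in> Basis \<Longrightarrow> T x \<bullet> b = c b * (x \<bullet> b)" and c: "\<And>b. b \<in> Basis \<Longrightarrow> 0 < c b"
  shows "jacobian T (ennreal (\<Prod>b\<in>Basis. c b))"
  unfolding jacobian_def
proof (intro conjI ballI)
  have T': "T = (\<lambda>x. 0 + (\<Sum>b\<in>Basis. (c b * (x \<bullet> b)) *\<^sub>R b))"
  proof (rule ext)
    fix x
    have "T x = (\<Sum>b\<in>Basis. (T x \<bullet> b) *\<^sub>R b)" by (simp only: euclidean_representation)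
    also have "\<dots> = (\<Sum>b\<in>Basis. (c b * (x \<bullet> b)) *\<^sub>R b)"
      by (rule sum.cong) (simp_all only: T)
    finally show "T x = 0 + (\<Sum>b\<in>Basis. (c b * (x \<bullet> b)) *\<^sub>R b)" by simp
  qed
  show m [measurable]: "T \<in> borel_measurable borel"
    unfolding T' by measurable
  fix f :: "'a \<Rightarrow> ennreal" assume [measurable]: "f \<in> borel_measurable borel"
  have "(\<Prod>b\<in>Basis. \<bar>c b\<bar>) = (\<Prod>b\<in>Basis. c b)"
    by (rule prod.cong) (simp_all add: c less_imp_le)
  moreover have "lborel = density (distr lborel borel T) (\<lambda>_. (\<Prod>b\<in>Basis. \<bar>c b\<bar>))"
    unfolding T' by (rule lborel_affine_euclidean) (use c in fastforce)
  ultimately have eq: "lborel = density (distr lborel borel T) (\<lambda>_. (\<Prod>b\<in>Basis. c b))"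
    by simp
  show "(\<integral>\<^sup>+x. f x \<partial>lborel) = ennreal (\<Prod>b\<in>Basis. c b) * (\<integral>\<^sup>+x. f (T x) \<partial>lborel)"
  proof -
    have "(\<integral>\<^sup>+x. f x \<partial>lborel) = (\<integral>\<^sup>+x. f x \<partial>density (distr lborel borel T) (\<lambda>_. (\<Prod>b\<in>Basis. c b)))"
      using eq by (rule arg_cong)
    then show ?thesis
      by (simp add: nn_integral_density nn_integral_distr nn_integral_cmult)
  qed
qed

text \<open>An auxiliary density of bounded support and total mass one, integrated over spare variables.\<close>

definition unit_bump :: "'a::euclidean_space \<Rightarrow> ennreal" where
  "unit_bump = indicator (cbox 0 One)"

lemma unit_bump_measurable [measurable]: "unit_bump \<in> borel_measurable borel"
  by (simp add: unit_bump_def)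

lemma nn_integral_unit_bump: "(\<integral>\<^sup>+x. unit_bump x \<partial>lborel) = 1"
  by (simp add: unit_bump_def emeasure_lborel_cbox_eq)

lemma nn_integral_lborel_pair:
  fixes f :: "'a::euclidean_space \<Rightarrow> 'b::euclidean_space \<Rightarrow> ennreal"
  assumes "case_prod f \<in> borel_measurable borel"
  shows "(\<integral>\<^sup>+x. \<integral>\<^sup>+y. f x y \<partial>lborel \<partial>lborel) = (\<integral>\<^sup>+z. f (fst z) (snd z) \<partial>lborel)"
proof -
  have "case_prod f \<in> borel_measurable (lborel \<Otimes>\<^sub>M lborel)"
    using assms by (simp add: lborel_prod)
  from lborel.nn_integral_fst[OF this] show ?thesis
    by (simp add: lborel_prod case_prod_beta')
qed

text \<open>Here \<open>\<iota>\<close> is an isometric embedding with adjoint \<open>\<pi>\<close>. The isometry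
  \<open>(v, w) \<mapsto> (\<pi> w, \<iota> v + w - \<iota> (\<pi> w))\<close> of the product space exchanges \<open>v\<close> with the \<open>\<iota>\<close>-component of \<open>w\<close>.
  This separates the variables without choosing a coordinate type for the complement of \<open>range \<iota>\<close>.\<close>

lemma nn_integral_separate:
  fixes \<iota> :: "'v::euclidean_space \<Rightarrow> 'w::euclidean_space" and \<pi> :: "'w \<Rightarrow> 'v"
  assumes lin: "linear \<iota>" "linear \<pi>" and adj: "\<And>v w. \<iota> v \<bullet> w = v \<bullet> \<pi> w"
    and ret: "\<And>v. \<pi> (\<iota> v) = v"
    and [measurable]: "g \<in> borel_measurable borel" "G \<in> borel_measurable borel"
  shows "(\<integral>\<^sup>+w. g (\<pi> w) * G (w - \<iota> (\<pi> w)) \<partial>lborel) =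
         (\<integral>\<^sup>+w. unit_bump (\<pi> w) * G (w - \<iota> (\<pi> w)) \<partial>lborel) * (\<integral>\<^sup>+v. g v \<partial>lborel)"
proof -
  have [measurable]: "\<iota> \<in> borel_measurable borel" "\<pi> \<in> borel_measurable borel"
    using lin borel_measurable_linear by auto
  have adj': "w \<bullet> \<iota> v = \<pi> w \<bullet> v" for v w
    using adj[of v w] by (simp add: inner_commute)
  define T where "T z = (\<pi> (snd z), \<iota> (fst z) + snd z - \<iota> (\<pi> (snd z)))" for z :: "'v \<times> 'w"
  have "linear T"
    by (rule linearI) (simp_all add: T_def linear_add[OF lin(1)] linear_add[OF lin(2)]
        linear_cmul[OF lin(1)] linear_cmul[OF lin(2)] algebra_simps)
  moreover have "norm (T z) = norm z" for z
  proof -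
    have "T z \<bullet> T z = z \<bullet> z"
      by (simp add: T_def inner_prod_def inner_diff_left inner_diff_right inner_add_left
          inner_add_right adj adj' ret linear_add[OF lin(2)] linear_diff[OF lin(2)] inner_commute)
    then show ?thesis by (simp add: norm_eq_sqrt_inner)
  qed
  ultimately have jac: "jacobian T 1" by (rule jacobian_isometry)
  define F where "F = (\<lambda>z :: 'v \<times> 'w. unit_bump (fst z) * (g (\<pi> (snd z)) * G (snd z - \<iota> (\<pi> (snd z)))))"
  have [measurable]: "F \<in> borel_measurable borel"
    unfolding F_def borel_prod[symmetric] by measurable
  have FT: "F (T z) = unit_bump (\<pi> (snd z)) * (g (fst z) * G (snd z - \<iota> (\<pi> (snd z))))" for z
    by (simp add: F_def T_def linear_add[OF lin(2)] linear_diff[OF lin(2)] ret linear_0[OF lin(1)] algebra_simps)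
  have "(\<integral>\<^sup>+w. g (\<pi> w) * G (w - \<iota> (\<pi> w)) \<partial>lborel)
      = (\<integral>\<^sup>+v. \<integral>\<^sup>+w. F (v, w) \<partial>lborel \<partial>lborel)"
    by (simp add: F_def nn_integral_cmult nn_integral_multc nn_integral_unit_bump)
  also have "\<dots> = (\<integral>\<^sup>+z. F z \<partial>lborel)"
    by (subst nn_integral_lborel_pair) simp_all
  also have "\<dots> = (\<integral>\<^sup>+z. F (T z) \<partial>lborel)"
    using jacobianD[OF jac, of F] by simp
  also have "\<dots> = (\<integral>\<^sup>+v. \<integral>\<^sup>+w. unit_bump (\<pi> w) * (g v * G (w - \<iota> (\<pi> w))) \<partial>lborel \<partial>lborel)"
    unfolding FT by (subst nn_integral_lborel_pair) (simp_all add: borel_prod[symmetric])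
  also have "\<dots> = (\<integral>\<^sup>+v. g v * (\<integral>\<^sup>+w. unit_bump (\<pi> w) * G (w - \<iota> (\<pi> w)) \<partial>lborel) \<partial>lborel)"
    by (simp add: mult.left_commute nn_integral_cmult)
  also have "\<dots> = (\<integral>\<^sup>+w. unit_bump (\<pi> w) * G (w - \<iota> (\<pi> w)) \<partial>lborel) * (\<integral>\<^sup>+v. g v \<partial>lborel)"
    by (simp add: nn_integral_multc mult.commute)
  finally show ?thesis .
qed

text \<open>A linear substitution in the fibres of an orthogonal projection \<open>E\<close>, depending on the base
  point. Doubling the variable frees the base point: the isometry \<open>(x, y) \<mapsto> (E x + y - E y, E y + x - E x)\<close>
  moves the fibre coordinates to \<open>y\<close>, where \<open>L x\<close> acts on the whole space.\<close>

lemma nn_integral_fibrewise_substitution: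
  fixes E :: "'w::euclidean_space \<Rightarrow> 'w" and L :: "'w \<Rightarrow> 'w \<Rightarrow> 'w"
  assumes E: "linear E" "\<And>x. E (E x) = E x" "\<And>x y. E x \<bullet> y = x \<bullet> E y"
    and L: "\<And>x. jacobian (L x) (c x)" "\<And>x y. E (L x y) = E y"
    and fg: "\<And>x y. c x * f (E x + (L x y - E y)) = g (E x + (y - E y))"
    and [measurable]: "f \<in> borel_measurable borel" "g \<in> borel_measurable borel"
  shows "(\<integral>\<^sup>+w. f w \<partial>lborel) = (\<integral>\<^sup>+w. g w \<partial>lborel)"
proof -
  have [measurable]: "E \<in> borel_measurable borel"
    by (rule borel_measurable_linear[OF E(1)])
  have [measurable]: "L x \<in> borel_measurable borel" for x
    using L(1) by (simp add: jacobian_def)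
  define T where "T z = (E (fst z) + (snd z - E (snd z)), E (snd z) + (fst z - E (fst z)))" for z :: "'w \<times> 'w"
  have EE: "x \<bullet> E y = E x \<bullet> y" "E (E x) \<bullet> y = E x \<bullet> y" for x y
    by (simp_all add: E(2,3))
  have "linear T"
    by (rule linearI) (simp_all add: T_def linear_add[OF E(1)] linear_cmul[OF E(1)] algebra_simps)
  moreover have "norm (T z) = norm z" for z
  proof -
    have "T z \<bullet> T z = z \<bullet> z"
      by (simp add: T_def inner_prod_def inner_diff_left inner_diff_right inner_add_left
          inner_add_right EE linear_add[OF E(1)] linear_diff[OF E(1)])
    then show ?thesis by (simp add: norm_eq_sqrt_inner)
  qed
  ultimately have jac: "jacobian T 1" by (rule jacobian_isometry)
  have double: "(\<integral>\<^sup>+w. h w \<partial>lborel) = (\<integral>\<^sup>+x. \<integral>\<^sup>+y. h (E x + (y - E y)) * unit_bump (E y + (x - E x)) \<partial>lborel \<partial>lborel)"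
    if [measurable]: "h \<in> borel_measurable borel" for h :: "'w \<Rightarrow> ennreal"
  proof -
    have "(\<integral>\<^sup>+w. h w \<partial>lborel) = (\<integral>\<^sup>+x. \<integral>\<^sup>+y. h x * unit_bump (y::'w) \<partial>lborel \<partial>lborel)"
      by (simp add: nn_integral_cmult nn_integral_unit_bump)
    also have "\<dots> = (\<integral>\<^sup>+z. h (fst z) * unit_bump (snd z :: 'w) \<partial>lborel)"
      by (subst nn_integral_lborel_pair) (simp_all add: borel_prod[symmetric])
    also have "\<dots> = (\<integral>\<^sup>+z. h (fst (T z)) * unit_bump (snd (T z)) \<partial>lborel)"
      by (subst jacobianD[OF jac]) (simp_all add: borel_prod[symmetric])
    also have "\<dots> = (\<integral>\<^sup>+x. \<integral>\<^sup>+y. h (E x + (y - E y)) * unit_bump (E y + (x - E x)) \<partial>lborel \<partial>lborel)"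
      by (subst nn_integral_lborel_pair) (simp_all add: borel_prod[symmetric] T_def)
    finally show ?thesis .
  qed
  have inner: "(\<integral>\<^sup>+y. f (E x + (y - E y)) * unit_bump (E y + (x - E x)) \<partial>lborel) =
     (\<integral>\<^sup>+y. g (E x + (y - E y)) * unit_bump (E y + (x - E x)) \<partial>lborel)" for x
  proof -
    have "(\<integral>\<^sup>+y. f (E x + (y - E y)) * unit_bump (E y + (x - E x)) \<partial>lborel) =
        c x * (\<integral>\<^sup>+y. f (E x + (L x y - E y)) * unit_bump (E y + (x - E x)) \<partial>lborel)"
      by (subst jacobianD[OF L(1)[of x]]) (simp_all add: L(2))
    also have "\<dots> = (\<integral>\<^sup>+y. g (E x + (y - E y)) * unit_bump (E y + (x - E x)) \<partial>lborel)"
      by (simp add: mult.assoc flip: nn_integral_cmult fg)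
    finally show ?thesis .
  qed
  show ?thesis
    by (simp add: double[of f] double[of g] inner)
qed

section \<open>Integrating out blocks of the matrix ball\<close>

definition coord_proj :: "'n set \<Rightarrow> ('n::finite) cmatrix" where
  "coord_proj K = rdiag (\<lambda>i. of_bool (i \<in> K))"

lemma coord_proj_mult_nth: "(coord_proj K ** w) $ i $ j = (if i \<in> K then w $ i $ j else 0)"
  by (simp add: coord_proj_def rdiag_mult_nth)

lemma mult_coord_proj_nth: "(w ** coord_proj K) $ i $ j = (if j \<in> K then w $ i $ j else 0)"
  by (simp add: coord_proj_def mult_rdiag_nth)

lemma conj_transpose_coord_proj [simp]: "(coord_proj K)\<^sup>\<dagger> = coord_proj K"
  by (simp add: coord_proj_def)

lemma coord_proj_idem [simp]: "coord_proj K ** coord_proj K = coord_proj K"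
  and coord_proj_compl [simp]: "coord_proj K ** coord_proj (- K) = 0" "coord_proj (- K) ** coord_proj K = 0"
  by (auto simp: vec_eq_iff coord_proj_mult_nth) (auto simp: coord_proj_def rdiag_def)

lemma coord_proj_sandwich [simp]:
  "coord_proj K ** (coord_proj K ** A) = coord_proj K ** A"
  "coord_proj K ** (coord_proj (- K) ** A) = 0" "coord_proj (- K) ** (coord_proj K ** A) = 0"
  by (simp_all add: matrix_mul_assoc)

lemma coord_proj_UNIV [simp]: "coord_proj UNIV = mat 1"
  by (simp add: coord_proj_def rdiag_1)

lemma coord_proj_add_compl: "coord_proj K ** A + coord_proj (- K) ** A = A"
  and coord_proj_add_compl_right: "A ** coord_proj K + A ** coord_proj (- K) = A"
  by (simp_all add: vec_eq_iff coord_proj_mult_nth mult_coord_proj_nth)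

lemma inner_matrix_mult_right: "(A ** U) \<bullet> C = A \<bullet> (C ** U\<^sup>\<dagger>)"
  for A :: "complex^'n^'m" and U :: "complex^'l^'n"
proof -
  have "(A ** U) \<bullet> C = (U\<^sup>\<dagger> ** A\<^sup>\<dagger>) \<bullet> C\<^sup>\<dagger>"
    by (metis conj_transpose_mult inner_matrix_conj_transpose)
  also have "\<dots> = A\<^sup>\<dagger> \<bullet> (C ** U\<^sup>\<dagger>)\<^sup>\<dagger>"
    by (simp add: inner_matrix_mult_left conj_transpose_mult)
  finally show ?thesis by (simp add: inner_matrix_conj_transpose)
qed

lemma
  fixes A :: "complex^'n^'m" and B :: "complex^'k^'l"
  shows linear_matrix_mult_left: "linear (\<lambda>w. A ** w)"
    and linear_matrix_mult_right: "linear (\<lambda>w. w ** B)"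
  by (auto intro!: linearI simp: vec_eq_iff matrix_matrix_mult_def algebra_simps sum.distrib scaleR_sum_right)

lemma linear_conj_transpose: "linear conj_transpose"
  by (auto intro!: linearI)

lemma borel_measurable_matrix_mult [measurable]:
  fixes A :: "('n::finite) cmatrix"
  shows "(\<lambda>w. A ** w) \<in> borel_measurable borel" "(\<lambda>w. w ** A) \<in> borel_measurable borel"
  by (rule borel_measurable_linear linear_matrix_mult_left linear_matrix_mult_right)+

lemma borel_measurable_conj_transpose [measurable]:
  "conj_transpose \<in> borel_measurable (borel :: ('n::finite) cmatrix measure)"
  by (rule borel_measurable_linear linear_conj_transpose)+

lemma prod_Basis_vec:
  fixes f :: "'a::euclidean_space^'n \<Rightarrow> 'b::comm_monoid_mult"
  shows "prod f Basis = (\<Prod>i\<in>UNIV. \<Prod>u\<in>Basis. f (axis i u))"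
proof -
  have "inj_on (\<lambda>(i, u). axis i u) (UNIV \<times> (Basis :: 'a set) :: ('n \<times> 'a) set)"
    by (auto simp: inj_on_def axis_eq_axis)
  note inj = this
  have img: "(Basis :: ('a^'n) set) = (\<lambda>(i, u). axis i u) ` (UNIV \<times> Basis)"
    by (auto simp: Basis_vec_def)
  show ?thesis
    unfolding img prod.reindex[OF inj] by (simp add: prod.cartesian_product split_def)
qed

lemma jacobian_entrywise_scaling:
  fixes s :: "'m::finite \<Rightarrow> 'n::finite \<Rightarrow> real"
  assumes "\<And>i j. 0 < s i j"
  shows "jacobian (\<lambda>w :: complex^'n^'m. \<chi> i j. s i j *\<^sub>R w $ i $ j) (ennreal (\<Prod>i\<in>UNIV. \<Prod>j\<in>UNIV. (s i j)\<^sup>2))"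
proof -
  define T where "T = (\<lambda>w :: complex^'n^'m. \<chi> i j. s i j *\<^sub>R w $ i $ j)"
  define c where "c b = b \<bullet> T b" for b
  have T_axis: "T w \<bullet> axis i (axis j u) = s i j * (w \<bullet> axis i (axis j u))" for w i j u
    by (simp add: T_def inner_axis)
  have c_axis: "c (axis i (axis j u)) = s i j" if "u \<in> Basis" for i j u
    using that by (simp add: c_def inner_commute[of _ "T _"] T_axis)
  have basis: "\<exists>i j u. u \<in> Basis \<and> b = axis i (axis j u)" if "b \<in> Basis" for b :: "complex^'n^'m"
    using that by (auto simp: Basis_vec_def)
  have "jacobian T (ennreal (\<Prod>b\<in>Basis. c b))"
  proof (rule jacobian_diagonal)
    fix w b :: "complex^'n^'m" assume "b \<in> Basis"
    with basis obtain i j u where "u \<in> Basis" "b = axis i (axis j u)" by blast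
    then show "T w \<bullet> b = c b * (w \<bullet> b)" by (simp add: T_axis c_axis)
  next
    fix b :: "complex^'n^'m" assume "b \<in> Basis"
    with basis obtain i j u where "u \<in> Basis" "b = axis i (axis j u)" by blast
    then show "0 < c b" by (simp add: c_axis assms)
  qed
  moreover have "(\<Prod>b\<in>Basis. c b) = (\<Prod>i\<in>UNIV. \<Prod>j\<in>UNIV. (s i j)\<^sup>2)"
    unfolding prod_Basis_vec by (intro prod.cong refl) (simp add: c_axis Basis_complex_def power2_eq_square)
  ultimately show ?thesis by (simp add: T_def)
qed

text \<open>In an eigenbasis of \<open>M\<close> the map \<open>y \<mapsto> y M\<close> on the rows outside \<open>K\<close> scales entries; complex
  coordinates count twice.\<close>

lemma jacobian_row_scaling:
  fixes M :: "('n::finite) cmatrix"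
  assumes M: "M \<in> pd_matrices"
  shows "jacobian (\<lambda>y. coord_proj K ** y + coord_proj (- K) ** y ** M)
           (ennreal ((Re (det M))\<^sup>2 ^ card (- K)))"
proof -
  obtain U :: "'n cmatrix" and d where U: "unitary U" and dec: "M = U ** rdiag d ** U\<^sup>\<dagger>"
    using M hermitian_spectral_decomposition by (metis pd_matrices_iff)
  have d: "0 < d i" for i
    using M pd_eigenvalues_pos[OF U] by (simp add: dec)
  have detM: "Re (det M) = (\<Prod>i\<in>UNIV. d i)"
    by (simp add: dec det_unitary_conj[OF U] det_rdiag del: of_real_prod)
  define s where "s i j = (if i \<in> K then 1 else d j)" for i j
  have right: "jacobian (\<lambda>y. y ** V) 1" if "unitary V" for V :: "'n cmatrix"
    using that by (intro jacobian_isometry linear_matrix_mult_right norm_unitary_mult_right)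
  have "jacobian (\<lambda>y. (\<chi> i j. s i j *\<^sub>R (y ** U) $ i $ j) ** U\<^sup>\<dagger>)
      (1 * (ennreal (\<Prod>i\<in>UNIV. \<Prod>j\<in>UNIV. (s i j)\<^sup>2) * 1))"
    by (intro jacobian_compose[of "\<lambda>y. y ** U\<^sup>\<dagger>" _ "\<lambda>y. (\<chi> i j. s i j *\<^sub>R (y ** U) $ i $ j)"]
        jacobian_compose[of "\<lambda>y. (\<chi> i j. s i j *\<^sub>R y $ i $ j)" _ "\<lambda>y. y ** U"]
        right jacobian_entrywise_scaling U unitary_conj_transpose) (simp add: s_def d)
  moreover have "(\<chi> i j. s i j *\<^sub>R (y ** U) $ i $ j) ** U\<^sup>\<dagger> = coord_proj K ** y + coord_proj (- K) ** y ** M" for y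
  proof -
    have "(\<chi> i j. s i j *\<^sub>R (y ** U) $ i $ j) = coord_proj K ** (y ** U) + coord_proj (- K) ** (y ** U ** rdiag d)"
      by (simp add: vec_eq_iff coord_proj_mult_nth mult_rdiag_nth s_def scaleR_conv_of_real mult.commute)
    then show ?thesis
      using U by (simp add: dec matrix_add_rdistrib flip: matrix_mul_assoc)
  qed
  moreover have "(\<Prod>i\<in>UNIV. \<Prod>j\<in>UNIV. (s i j)\<^sup>2) = (Re (det M))\<^sup>2 ^ card (- K)"
  proof -
    have "(\<Prod>i\<in>UNIV. \<Prod>j\<in>UNIV. (s i j)\<^sup>2) = (\<Prod>i\<in>UNIV. if i \<in> - K then (Re (det M))\<^sup>2 else 1)"
      by (intro prod.cong refl) (auto simp: s_def detM prod_power_distrib)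
    also have "\<dots> = (Re (det M))\<^sup>2 ^ card (- K)"
      by (subst prod.If_cases) (simp_all add: Compl_eq)
    finally show ?thesis .
  qed
  ultimately show ?thesis by simp
qed

text \<open>Fix the rows in \<open>K\<close> of the column block \<open>J\<close> and rescale its other rows by the defect root of the
  fixed part. The weight splits, and the Jacobian raises the exponent of the fixed part by the number
  of rows that were split off. The columns outside \<open>J\<close> are left alone, because the defect root of a
  matrix supported in the columns \<open>J\<close> is the identity on the other coordinates.\<close>

lemma nn_integral_split_rows:
  fixes F G :: "('n::finite) cmatrix \<Rightarrow> ennreal"
  assumes [measurable]: "F \<in> borel_measurable borel" "G \<in> borel_measurable borel"
  shows "(\<integral>\<^sup>+w. F (coord_proj K ** w ** coord_proj J) * ball_weight \<beta> (w ** coord_proj J)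
             * G (w ** coord_proj (- J)) \<partial>lborel) =
         (\<integral>\<^sup>+w. F (coord_proj K ** w ** coord_proj J)
             * ball_weight (\<beta> + card (- K)) (coord_proj K ** w ** coord_proj J)
             * ball_weight \<beta> (coord_proj (- K) ** w ** coord_proj J) * G (w ** coord_proj (- J)) \<partial>lborel)"
proof -
  define P where "P = coord_proj K"
  define Q where "Q = coord_proj (- K)"
  define R where "R = coord_proj J"
  define R' where "R' = coord_proj (- J)"
  note defs = P_def Q_def R_def R'_def
  define E where "E w = w - Q ** w ** R" for w
  define N where "N x = defect_root (P ** x ** R)" for x
  define L where "L x y = P ** y + Q ** y ** N x" for x y
  have alg: "P ** P = P" "Q ** Q = Q" "P ** Q = 0" "Q ** P = 0" "R ** R = R" "R ** R' = 0" "R' ** R = 0"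
    "P ** (P ** A) = P ** A" "Q ** (Q ** A) = Q ** A" "P ** (Q ** A) = 0" "Q ** (P ** A) = 0"
    "R ** (R ** A) = R ** A" "R ** (R' ** A) = 0" "R' ** (R ** A) = 0" for A :: "'n cmatrix"
    unfolding defs using coord_proj_compl[of "- K"] coord_proj_compl[of "- J"] by (simp_all add: matrix_mul_assoc)
  have splitP: "P ** A + Q ** A = A" and splitR: "A ** R + A ** R' = A" for A :: "'n cmatrix"
    by (simp_all add: defs coord_proj_add_compl coord_proj_add_compl_right)
  have NR': "N x ** R' = R'" for x
    unfolding N_def by (rule defect_root_fixes) (simp add: alg flip: matrix_mul_assoc)
  have R'N: "R' ** N x = R'" for x
  proof -
    have "R' ** N x = (N x ** R')\<^sup>\<dagger>"
      using defect_root_pd[of "P ** x ** R"] by (simp add: conj_transpose_mult N_def R'_def pd_matrices_iff)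
    then show ?thesis by (simp add: NR' R'_def[symmetric]) (simp add: R'_def)
  qed
  have NR: "N x ** R = R ** N x" for x
  proof -
    have "N x ** R + N x ** R' = R ** N x + R' ** N x"
      using splitR[of "N x"] splitR[of "mat 1"] by (simp flip: matrix_add_rdistrib)
    then show ?thesis by (simp add: NR' R'N)
  qed
  have EL: "E (L x y) = E y" for x y
  proof -
    have "E (L x y) = P ** y + (Q ** y ** N x - Q ** y ** N x ** R)"
      by (simp add: E_def L_def matrix_add_ldistrib matrix_add_rdistrib alg matrix_mul_assoc[symmetric])
    also have "Q ** y ** N x - Q ** y ** N x ** R = Q ** y ** R'"
      using splitR[of "Q ** y ** N x"] by (metis NR' add_diff_cancel_left' matrix_mul_assoc)
    also have "\<dots> = Q ** y - Q ** y ** R"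
      using splitR[of "Q ** y"] by (metis add_diff_cancel_left')
    also have "P ** y + (Q ** y - Q ** y ** R) = E y"
      using splitP[of y] by (simp add: E_def)
    finally show ?thesis .
  qed
  have L_fibre: "L x y - E y = Q ** y ** R ** N x" for x y
  proof -
    have "L x y - E y = L x y - E (L x y)" by (simp add: EL)
    also have "\<dots> = Q ** (L x y) ** R" by (simp add: E_def)
    also have "\<dots> = Q ** y ** R ** N x"
      by (simp add: L_def matrix_add_ldistrib alg NR flip: matrix_mul_assoc)
    finally show ?thesis .
  qed
  define f where "f w = F (P ** w ** R) * ball_weight \<beta> (w ** R) * G (w ** R')" for w
  define g where "g w = F (P ** w ** R) * ball_weight (\<beta> + card (- K)) (P ** w ** R)
      * ball_weight \<beta> (Q ** w ** R) * G (w ** R')" for w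
  have fm [measurable]: "f \<in> borel_measurable borel" and gm [measurable]: "g \<in> borel_measurable borel"
    unfolding f_def g_def by measurable
  have "(\<integral>\<^sup>+w. f w \<partial>lborel) = (\<integral>\<^sup>+w. g w \<partial>lborel)"
  proof (rule nn_integral_fibrewise_substitution[where E = E and L = L and
        c = "\<lambda>x. ennreal ((Re (det (N x)))\<^sup>2 ^ card (- K))"])
    show "linear E"
      unfolding E_def
      by (intro linear_compose_sub linear_ident linear_compose[OF linear_matrix_mult_left linear_matrix_mult_right, unfolded o_def])
    show "E (E x) = E x" for x
      by (simp add: E_def matrix_diff_ldistrib matrix_diff_rdistrib alg matrix_mul_assoc[symmetric])
    show "E x \<bullet> y = x \<bullet> E y" for x y
    proof -
      have "(Q ** x ** R) \<bullet> y = x \<bullet> (Q ** y ** R)"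
        by (subst inner_matrix_mult_right, subst inner_matrix_mult_left) (simp add: defs matrix_mul_assoc)
      then show ?thesis by (simp add: E_def inner_diff_left inner_diff_right)
    qed
    show "jacobian (L x) (ennreal ((Re (det (N x)))\<^sup>2 ^ card (- K)))" for x
      unfolding L_def P_def Q_def by (rule jacobian_row_scaling) (simp add: N_def defect_root_pd)
    show "E (L x y) = E y" for x y by (rule EL)
    show "ennreal ((Re (det (N x)))\<^sup>2 ^ card (- K)) * f (E x + (L x y - E y)) = g (E x + (y - E y))" for x y
    proof -
      define v where "v = P ** x ** R"
      define w where "w = Q ** y ** R"
      have w_conv: "v\<^sup>\<dagger> ** w = 0"
        by (simp add: v_def w_def conj_transpose_mult defs flip: matrix_mul_assoc)
      have Ex: "P ** E x ** R = v" "Q ** E x ** R = 0" "E x ** R = v" "E x ** R' = x ** R'"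
      proof -
        show 1: "P ** E x ** R = v" "Q ** E x ** R = 0" "E x ** R' = x ** R'"
          by (simp_all add: E_def v_def matrix_diff_ldistrib matrix_diff_rdistrib alg matrix_mul_assoc[symmetric])
        show "E x ** R = v"
          using splitP[of "E x ** R"] 1 by (simp add: matrix_mul_assoc)
      qed
      have w: "P ** w = 0" "Q ** w = w" "w ** R = w" "w ** R' = 0" "w ** N x ** R = w ** N x" "w ** N x ** R' = 0"
        "P ** (w ** N x) = 0"
        by (simp_all add: w_def alg NR NR' flip: matrix_mul_assoc)
      have lhs: "f (E x + (L x y - E y)) = F v * ball_weight \<beta> (v + w ** N x) * G (x ** R')"
        unfolding L_fibre w_def[symmetric] f_def
        by (simp add: matrix_add_ldistrib matrix_add_rdistrib Ex w)
      have rhs: "g (E x + (y - E y)) = F v * ball_weight (\<beta> + card (- K)) v * ball_weight \<beta> w * G (x ** R')"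
      proof -
        have "y - E y = w" by (simp add: E_def w_def)
        then show ?thesis
          by (simp add: g_def matrix_add_ldistrib matrix_add_rdistrib Ex w)
      qed
      have split: "ball_weight \<beta> (v + w ** N x) = ball_weight \<beta> v * ball_weight \<beta> w"
        unfolding N_def v_def[symmetric] by (rule ball_weight_row_split[OF w_conv])
      have "ennreal ((Re (det (N x)))\<^sup>2 ^ card (- K)) * ball_weight \<beta> v = ball_weight (\<beta> + card (- K)) v"
      proof (cases "v \<in> heis_ball")
        case True
        then have "(Re (det (N x)))\<^sup>2 ^ card (- K) = defect_det v powr card (- K)"
          by (simp add: N_def flip: v_def) (simp add: det_defect_root defect_det_pos powr_realpow)
        then show ?thesis
          using True by (simp add: ball_weight_def powr_add mult.commute flip: ennreal_mult)
      qed (simp add: ball_weight_def)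
      then show ?thesis
        unfolding lhs rhs split by (metis mult.assoc mult.commute)
    qed
  qed (fact fm gm)+
  then show ?thesis by (simp add: f_def g_def defs)
qed

text \<open>Taking adjoints is an isometry that preserves the weight and turns columns into rows.\<close>

lemma nn_integral_split_columns:
  fixes F :: "('n::finite) cmatrix \<Rightarrow> ennreal"
  assumes [measurable]: "F \<in> borel_measurable borel"
  shows "(\<integral>\<^sup>+w. F (w ** coord_proj K) * ball_weight \<alpha> w \<partial>lborel) =
         (\<integral>\<^sup>+w. F (w ** coord_proj K) * ball_weight (\<alpha> + card (- K)) (w ** coord_proj K)
             * ball_weight \<alpha> (w ** coord_proj (- K)) \<partial>lborel)"
proof -
  have flip: "(\<integral>\<^sup>+w. f w \<partial>lborel) = (\<integral>\<^sup>+w. f (w\<^sup>\<dagger>) \<partial>lborel)"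
    if "f \<in> borel_measurable borel" for f :: "'n cmatrix \<Rightarrow> ennreal"
    using jacobianD[OF jacobian_isometry[OF linear_conj_transpose norm_conj_transpose] that] by simp
  have "(\<integral>\<^sup>+w. F (w ** coord_proj K) * ball_weight \<alpha> w \<partial>lborel) =
        (\<integral>\<^sup>+w. F ((coord_proj K ** w ** coord_proj UNIV)\<^sup>\<dagger>) * ball_weight \<alpha> (w ** coord_proj UNIV) * 1 \<partial>lborel)"
    by (subst flip) (simp_all add: conj_transpose_mult)
  also have "\<dots> = (\<integral>\<^sup>+w. F ((coord_proj K ** w ** coord_proj UNIV)\<^sup>\<dagger>)
             * ball_weight (\<alpha> + card (- K)) (coord_proj K ** w ** coord_proj UNIV)
             * ball_weight \<alpha> (coord_proj (- K) ** w ** coord_proj UNIV) * 1 \<partial>lborel)"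
    by (rule nn_integral_split_rows[where G = "\<lambda>_. 1" and F = "\<lambda>w. F (w\<^sup>\<dagger>)"]) measurable
  also have "\<dots> = (\<integral>\<^sup>+w. F (w ** coord_proj K) * ball_weight (\<alpha> + card (- K)) (w ** coord_proj K)
             * ball_weight \<alpha> (w ** coord_proj (- K)) \<partial>lborel)"
  proof (subst flip)
    have "ball_weight \<beta> (coord_proj K' ** w\<^sup>\<dagger>) = ball_weight \<beta> (w ** coord_proj K')" for w :: "'n cmatrix" and K' \<beta>
      using ball_weight_conj_transpose[of \<beta> "w ** coord_proj K'"] by (simp add: conj_transpose_mult)
    then show "(\<integral>\<^sup>+w. F ((coord_proj K ** w\<^sup>\<dagger> ** coord_proj UNIV)\<^sup>\<dagger>)
             * ball_weight (\<alpha> + card (- K)) (coord_proj K ** w\<^sup>\<dagger> ** coord_proj UNIV)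
             * ball_weight \<alpha> (coord_proj (- K) ** w\<^sup>\<dagger> ** coord_proj UNIV) * 1 \<partial>lborel) =
         (\<integral>\<^sup>+w. F (w ** coord_proj K) * ball_weight (\<alpha> + card (- K)) (w ** coord_proj K)
             * ball_weight \<alpha> (w ** coord_proj (- K)) \<partial>lborel)"
      by (simp add: conj_transpose_mult)
  qed measurable
  finally show ?thesis .
qed

text \<open>Splitting off columns and then rows raises the exponent twice. All factors but the first two
  depend on the entries outside the block only.\<close>

lemma nn_integral_split_block:
  fixes F :: "('n::finite) cmatrix \<Rightarrow> ennreal"
  assumes [measurable]: "F \<in> borel_measurable borel"
  shows "(\<integral>\<^sup>+w. F (coord_proj K ** w ** coord_proj K) * ball_weight \<alpha> w \<partial>lborel) =
         (\<integral>\<^sup>+w. F (coord_proj K ** w ** coord_proj K)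
             * ball_weight (\<alpha> + 2 * card (- K)) (coord_proj K ** w ** coord_proj K)
             * ball_weight (\<alpha> + card (- K)) (coord_proj (- K) ** w ** coord_proj K)
             * ball_weight \<alpha> (w ** coord_proj (- K)) \<partial>lborel)"
proof -
  have "(\<integral>\<^sup>+w. F (coord_proj K ** w ** coord_proj K) * ball_weight \<alpha> w \<partial>lborel) =
      (\<integral>\<^sup>+w. F (coord_proj K ** (w ** coord_proj K)) * ball_weight \<alpha> w \<partial>lborel)"
    by (simp add: matrix_mul_assoc)
  also have "\<dots> = (\<integral>\<^sup>+w. F (coord_proj K ** w ** coord_proj K) * ball_weight (\<alpha> + card (- K)) (w ** coord_proj K)
             * ball_weight \<alpha> (w ** coord_proj (- K)) \<partial>lborel)"
    by (subst nn_integral_split_columns[where F = "\<lambda>w. F (coord_proj K ** w)"]) (simp_all add: matrix_mul_assoc)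
  also have "\<dots> = (\<integral>\<^sup>+w. F (coord_proj K ** w ** coord_proj K)
             * ball_weight (\<alpha> + card (- K) + card (- K)) (coord_proj K ** w ** coord_proj K)
             * ball_weight (\<alpha> + card (- K)) (coord_proj (- K) ** w ** coord_proj K)
             * ball_weight \<alpha> (w ** coord_proj (- K)) \<partial>lborel)"
    by (rule nn_integral_split_rows) measurable
  finally show ?thesis by (simp add: add.assoc)
qed

section \<open>The weight has finite positive mass\<close>

text \<open>For negative exponents the layer where \<open>1 - \<bar>z\<bar>\<^sup>2 \<le> 2\<^sup>-\<^sup>n\<close> has area \<open>\<pi> 2\<^sup>-\<^sup>n\<close>, and up to the next layer the
  weight is at most \<open>2\<^sup>-\<^sup>\<alpha>\<^sup>(\<^sup>n\<^sup>+\<^sup>1\<^sup>)\<close>: a geometric series of ratio \<open>2\<^sup>-\<^sup>(\<^sup>1\<^sup>+\<^sup>\<alpha>\<^sup>)\<close>.\<close>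

lemma nn_integral_disc_weight_finite:
  assumes "- 1 < \<alpha>"
  shows "(\<integral>\<^sup>+z. indicator (ball 0 1) z * ennreal ((1 - (norm (z::complex))\<^sup>2) powr \<alpha>) \<partial>lborel) < \<infinity>"
    (is "integral\<^sup>N _ ?f < _")
proof (cases "0 \<le> \<alpha>")
  case True
  have "?f z \<le> indicator (ball 0 1) z" for z :: complex
    using True by (auto simp: indicator_def power_le_one abs_square_less_1 intro!: powr_le1)
  then have "(\<integral>\<^sup>+z. ?f z \<partial>lborel) \<le> (\<integral>\<^sup>+z. indicator (ball 0 1) (z::complex) \<partial>lborel)"
    by (intro nn_integral_mono)
  also have "\<dots> < \<infinity>"
    using emeasure_lborel_ball_finite[of "0::complex" 1] by simp
  finally show ?thesis .
next
  case False
  define r where "r n = sqrt (1 - (1/2)^n)" for n :: nat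
  have r: "0 \<le> r n" "(r n)\<^sup>2 = 1 - (1/2)^n" for n
    by (simp_all add: r_def power_le_one)
  define A where "A n = ball 0 1 - ball (0::complex) (r n)" for n
  define c where "c n = ((1/2)^Suc n) powr \<alpha>" for n :: nat
  have A: "emeasure lborel (A n) = ennreal (pi * (1/2)^n)" for n
  proof -
    have "r n \<le> 1" by (simp add: r_def)
    then have "emeasure lborel (A n) = emeasure lborel (ball (0::complex) 1) - emeasure lborel (ball (0::complex) (r n))"
      unfolding A_def using emeasure_lborel_ball_finite[of "0::complex" "r n"]
      by (intro emeasure_Diff) (auto simp: less_top)
    also have "\<dots> = ennreal (pi * 1) - ennreal (pi * (1 - (1/2)^n))"
      using r[of n] by (simp add: emeasure_ball unit_ball_vol_2)
    also have "\<dots> = ennreal (pi * (1/2)^n)"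
      by (subst ennreal_minus) (simp_all add: power_le_one algebra_simps)
    finally show ?thesis .
  qed
  have bound: "?f z \<le> (\<Sum>n. ennreal (c n) * indicator (A n) z)" for z :: complex
  proof (cases "z \<in> ball 0 1")
    case True
    define t where "t = 1 - (norm z)\<^sup>2"
    have t: "0 < t" "t \<le> 1"
      using True by (simp_all add: t_def abs_square_less_1)
    \<comment> \<open>the last layer that contains \<open>z\<close>\<close>
    define n where "n = (LEAST n. (1/2::real)^Suc n < t)"
    have "\<exists>n. (1/2::real)^Suc n < t"
    proof -
      obtain k where "(1/2::real)^k < t"
        using real_arch_pow_inv[OF t(1), of "1/2"] by auto
      then have "(1/2::real)^Suc k < t"
        by (rule le_less_trans[rotated]) simp
      then show ?thesis ..
    qed
    then have n1: "(1/2::real)^Suc n < t"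
      unfolding n_def by (rule LeastI_ex)
    have n2: "t \<le> (1/2)^n"
    proof (cases n)
      case (Suc k)
      then have "\<not> (1/2::real)^Suc k < t"
        unfolding n_def by (intro not_less_Least) simp
      then show ?thesis by (simp add: Suc)
    qed (simp add: t)
    have "z \<in> A n"
    proof -
      have "(r n)\<^sup>2 \<le> (norm z)\<^sup>2"
        using n2 by (simp add: r t_def)
      then have "r n \<le> norm z" by (rule power2_le_imp_le) simp
      then show ?thesis using True by (simp add: A_def)
    qed
    have "t powr \<alpha> \<le> c n"
      unfolding c_def using n1 False by (intro powr_mono2') auto
    then have "?f z \<le> ennreal (c n) * indicator (A n) z"
      using True \<open>z \<in> A n\<close> by (simp add: t_def ennreal_leI)
    also have "\<dots> \<le> (\<Sum>n. ennreal (c n) * indicator (A n) z)"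
    proof -
      define h where "h m = ennreal (c m) * indicator (A m) z" for m
      have "h n \<le> (\<Sum>m. h m)"
        using sum_le_suminf[OF summableI, of "{n}" h] by simp
      then show ?thesis by (simp only: h_def)
    qed
    finally show ?thesis .
  qed simp
  have "(\<integral>\<^sup>+z. ?f z \<partial>lborel) \<le> (\<integral>\<^sup>+z. (\<Sum>n. ennreal (c n) * indicator (A n) z) \<partial>lborel)"
    by (intro nn_integral_mono bound)
  also have "\<dots> = (\<Sum>n. ennreal (c n) * emeasure lborel (A n))"
  proof -
    have [measurable]: "A n \<in> sets borel" for n
      unfolding A_def by (intro sets.Diff borel_open open_ball)
    show ?thesis
      by (subst nn_integral_suminf) (simp_all add: nn_integral_cmult_indicator)
  qed
  also have "\<dots> = (\<Sum>n. ennreal (c n * (pi * (1/2)^n)))"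
    by (simp add: A c_def flip: ennreal_mult)
  also have "\<dots> < \<infinity>"
  proof -
    have "c n * (pi * (1/2)^n) = (pi * (1/2) powr \<alpha>) * ((1/2) powr (1 + \<alpha>)) ^ n" for n
    proof -
      have "c n = (1/2) powr \<alpha> * ((1/2) powr \<alpha>) ^ n"
      proof -
        have "(x ^ m) powr \<alpha> = (x powr \<alpha>) ^ m" if "0 < x" for x :: real and m
          using that by (induction m) (simp_all add: powr_mult)
        from this[of "1/2" "Suc n"] show ?thesis
          unfolding c_def by simp
      qed
      then show ?thesis by (simp add: powr_add power_mult_distrib power_divide mult_ac)
    qed
    moreover have "summable (\<lambda>n. (pi * (1/2) powr \<alpha>) * ((1/2) powr (1 + \<alpha>)) ^ n)"
      using assms by (intro summable_mult summable_geometric) (simp add: powr01_less_one)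
    ultimately have "summable (\<lambda>n. c n * (pi * (1/2)^n))" by (simp only:)
    then have "(\<Sum>n. ennreal (c n * (pi * (1/2)^n))) \<noteq> top"
      by (rule ennreal_suminf_neq_top) (simp add: c_def)
    then show ?thesis by (simp add: less_top)
  qed
  finally show ?thesis .
qed

definition unit_entries :: "('n::finite) cmatrix set" where
  "unit_entries = {w. \<forall>i j. norm (w $ i $ j) \<le> 1}"

lemma bounded_matrix_entries:
  assumes "\<And>w i j. w \<in> S \<Longrightarrow> norm (w $ i $ j) \<le> b"
  shows "bounded (S :: ('n::finite) cmatrix set)"
proof (rule boundedI)
  fix w :: "'n cmatrix" assume w: "w \<in> S"
  have "norm w \<le> (\<Sum>i\<in>UNIV. norm (w $ i))"
    by (simp add: norm_vec_def L2_set_le_sum)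
  also have "\<dots> \<le> (\<Sum>i\<in>UNIV. \<Sum>j\<in>UNIV. norm (w $ i $ j))"
    by (intro sum_mono) (simp add: norm_vec_def L2_set_le_sum)
  also have "\<dots> \<le> (\<Sum>i\<in>(UNIV::'n set). \<Sum>j\<in>(UNIV::'n set). b)"
    by (intro sum_mono assms w)
  finally show "norm w \<le> (\<Sum>i\<in>(UNIV::'n set). \<Sum>j\<in>(UNIV::'n set). b)" .
qed

lemma compact_unit_entries: "compact (unit_entries :: ('n::finite) cmatrix set)"
proof -
  have "closed (unit_entries :: 'n cmatrix set)"
    unfolding unit_entries_def by (intro closed_Collect_all closed_Collect_le continuous_intros)
  moreover have "bounded (unit_entries :: 'n cmatrix set)"
    by (rule bounded_matrix_entries[of _ 1]) (simp add: unit_entries_def)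
  ultimately show ?thesis by (simp add: compact_eq_bounded_closed)
qed

lemma ball_weight_bounded:
  assumes "0 \<le> \<beta>"
  obtains C where "\<And>w :: ('n::finite) cmatrix. ball_weight \<beta> w \<le> ennreal C * indicator unit_entries w"
proof -
  have "(0::'n cmatrix) \<in> unit_entries"
    by (simp add: unit_entries_def)
  then have "(unit_entries :: 'n cmatrix set) \<noteq> {}" by blast
  from continuous_attains_sup[OF compact_unit_entries this continuous_on_defect_det]
  obtain v :: "'n cmatrix" where v: "\<And>w :: 'n cmatrix. w \<in> unit_entries \<Longrightarrow> defect_det w \<le> defect_det v" by blast
  have "ball_weight \<beta> w \<le> ennreal (defect_det v powr \<beta>) * indicator unit_entries w" for w :: "'n cmatrix"
  proof (cases "w \<in> heis_ball")
    case True
    then have "w \<in> unit_entries"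
      by (simp add: unit_entries_def heis_ball_entry_less less_imp_le)
    with True show ?thesis
      using assms v[of w] defect_det_pos[OF True]
      by (auto simp: ball_weight_def intro!: ennreal_leI powr_mono2)
  qed (simp add: ball_weight_def)
  then show thesis by (rule that)
qed

text \<open>Only one matrix entry carries the singular exponent: after one column and then one row have been
  split off, the other exponents are \<open>\<alpha> + 1 > 0\<close>, so those factors are
  bounded, and the last factor lives on the unit disc.\<close>

theorem nn_integral_ball_weight_finite:
  assumes \<alpha>: "- 1 < \<alpha>"
  shows "(\<integral>\<^sup>+w. ball_weight \<alpha> (w :: ('n::finite) cmatrix) \<partial>lborel) < \<infinity>"
proof -
  obtain C where C: "\<And>w :: 'n cmatrix. ball_weight (\<alpha> + 1) w \<le> ennreal C * indicator unit_entries w"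
    using ball_weight_bounded[of "\<alpha> + 1"] \<alpha> by auto
  obtain j :: 'n where True by simp
  define P where "P = coord_proj (- {j})"
  define Q where "Q = coord_proj {j}"
  define \<iota> :: "complex \<Rightarrow> 'n cmatrix" where "\<iota> z = axis j (axis j z)" for z
  define \<pi> :: "'n cmatrix \<Rightarrow> complex" where "\<pi> w = w $ j $ j" for w
  define f where "f z = indicator (ball 0 1) z * ennreal ((1 - (norm z)\<^sup>2) powr \<alpha>)" for z :: complex
  define G :: "'n cmatrix \<Rightarrow> ennreal" where "G w = ennreal C * ennreal C * indicator unit_entries w" for w
  have [measurable]: "unit_entries \<in> sets (borel :: 'n cmatrix measure)"
    using compact_unit_entries by (intro borel_closed compact_imp_closed)
  have fm: "f \<in> borel_measurable borel"
    unfolding f_def by (intro borel_measurable_times_ennreal borel_measurable_indicator) auto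
  have Gm: "G \<in> borel_measurable borel"
    unfolding G_def by (intro borel_measurable_times_ennreal borel_measurable_indicator) auto
  have lin: "linear \<iota>" "linear \<pi>"
    by (auto intro!: linearI simp: \<iota>_def \<pi>_def vec_eq_iff axis_def)
  have "(\<integral>\<^sup>+w. ball_weight \<alpha> (w :: 'n cmatrix) \<partial>lborel) =
      (\<integral>\<^sup>+w. ball_weight (\<alpha> + 1) (w ** P) * ball_weight \<alpha> (w ** Q) \<partial>lborel)"
    using nn_integral_split_columns[of "\<lambda>_. 1" "- {j}" \<alpha>] by (simp add: P_def Q_def)
  also have "\<dots> = (\<integral>\<^sup>+w. ball_weight (\<alpha> + 1) (P ** w ** Q) * ball_weight \<alpha> (Q ** w ** Q) * ball_weight (\<alpha> + 1) (w ** P) \<partial>lborel)"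
    using nn_integral_split_rows[of "\<lambda>_. 1" "ball_weight (\<alpha> + 1)" "- {j}" "{j}" \<alpha>]
    by (simp add: P_def Q_def mult.commute)
  also have "\<dots> \<le> (\<integral>\<^sup>+w. f (\<pi> w) * G (w - \<iota> (\<pi> w)) \<partial>lborel)"
  proof (rule nn_integral_mono)
    fix w :: "'n cmatrix"
    have QwQ: "Q ** w ** Q = \<iota> (\<pi> w)"
      by (auto simp: vec_eq_iff Q_def mult_coord_proj_nth coord_proj_mult_nth \<iota>_def \<pi>_def axis_def)
    have "ball_weight \<alpha> (\<iota> z) \<le> f z" for z
    proof (cases "\<iota> z \<in> heis_ball")
      case True
      then have "norm z < 1"
        using heis_ball_entry_less[OF True, of j j] by (simp add: \<iota>_def)
      have "mat 1 - (\<iota> z)\<^sup>\<dagger> ** \<iota> z = rdiag (\<lambda>i. if i = j then 1 - (norm z)\<^sup>2 else 1)"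
      proof -
        have "((\<iota> z)\<^sup>\<dagger> ** \<iota> z) $ a $ b = (if a = j \<and> b = j then complex_of_real ((norm z)\<^sup>2) else 0)" for a b
        proof -
          have "((\<iota> z)\<^sup>\<dagger> ** \<iota> z) $ a $ b = (\<Sum>k\<in>UNIV. cnj (\<iota> z $ k $ a) * \<iota> z $ k $ b)"
            by (simp add: matrix_matrix_mult_def)
          also have "\<dots> = (\<Sum>k\<in>UNIV. if k = j then (if a = j \<and> b = j then cnj z * z else 0) else 0)"
            by (rule sum.cong) (auto simp: \<iota>_def axis_def)
          also have "\<dots> = (if a = j \<and> b = j then complex_of_real ((norm z)\<^sup>2) else 0)"
            by (simp only: sum.delta finite complex_norm_square) (simp add: mult.commute)
          finally show ?thesis .
        qed
        then show ?thesis
          by (simp add: vec_eq_iff mat_def rdiag_def)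
      qed
      then have "defect_det (\<iota> z) = 1 - (norm z)\<^sup>2"
        by (simp add: defect_det_def det_rdiag del: of_real_prod)
      then show ?thesis
        using True \<open>norm z < 1\<close> by (simp add: ball_weight_def f_def)
    qed (simp add: ball_weight_def)
    moreover have "ball_weight (\<alpha> + 1) (P ** w ** Q) * ball_weight (\<alpha> + 1) (w ** P) \<le> G (w - \<iota> (\<pi> w))"
    proof -
      have "ball_weight (\<alpha> + 1) (P ** w ** Q) * ball_weight (\<alpha> + 1) (w ** P)
          \<le> (ennreal C * indicator unit_entries (P ** w ** Q)) * (ennreal C * indicator unit_entries (w ** P))"
        by (intro mult_mono C) simp_all
      also have "\<dots> \<le> G (w - \<iota> (\<pi> w))"
      proof (cases "P ** w ** Q \<in> unit_entries \<and> w ** P \<in> unit_entries")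
        case True
        have "norm ((w - \<iota> (\<pi> w)) $ a $ b) \<le> 1" for a b
        proof (cases "b = j")
          case bj: True
          have "norm ((P ** w ** Q) $ a $ b) \<le> 1" using True by (simp add: unit_entries_def)
          then show ?thesis
            using bj by (auto simp: P_def Q_def mult_coord_proj_nth coord_proj_mult_nth \<iota>_def \<pi>_def axis_def split: if_splits)
        next
          case False
          have "norm ((w ** P) $ a $ b) \<le> 1" using True by (simp add: unit_entries_def)
          then show ?thesis
            using False by (auto simp: P_def mult_coord_proj_nth \<iota>_def axis_def)
        qed
        then show ?thesis
          using True by (simp add: G_def unit_entries_def)
      qed auto
      finally show ?thesis .
    qed
    ultimately have "ball_weight \<alpha> (\<iota> (\<pi> w)) * (ball_weight (\<alpha> + 1) (P ** w ** Q) * ball_weight (\<alpha> + 1) (w ** P))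
        \<le> f (\<pi> w) * G (w - \<iota> (\<pi> w))"
      by (intro mult_mono) simp_all
    then show "ball_weight (\<alpha> + 1) (P ** w ** Q) * ball_weight \<alpha> (Q ** w ** Q) * ball_weight (\<alpha> + 1) (w ** P)
        \<le> f (\<pi> w) * G (w - \<iota> (\<pi> w))"
      by (simp add: QwQ mult_ac)
  qed
  also have "\<dots> = (\<integral>\<^sup>+w. unit_bump (\<pi> w) * G (w - \<iota> (\<pi> w)) \<partial>lborel) * (\<integral>\<^sup>+z. f z \<partial>lborel)"
  proof (rule nn_integral_separate[OF lin _ _ fm Gm])
    show "\<iota> v \<bullet> w = v \<bullet> \<pi> w" for v w
      by (simp add: \<iota>_def \<pi>_def inner_axis')
    show "\<pi> (\<iota> v) = v" for v
      by (simp add: \<iota>_def \<pi>_def)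
  qed
  also have "\<dots> < \<infinity>"
  proof -
    obtain b where b: "\<And>z. z \<in> cbox 0 (One::complex) \<Longrightarrow> norm z \<le> b"
      using bounded_cbox[of 0 "One::complex"] unfolding bounded_iff by blast
    define S where "S = {w :: 'n cmatrix. \<forall>i k. norm (w $ i $ k) \<le> 1 + b}"
    have b0: "0 \<le> b" using b[of 0] by (simp add: box_eq_empty[symmetric] cbox_def)
    have "unit_bump (\<pi> w) * G (w - \<iota> (\<pi> w)) \<le> ennreal C * ennreal C * indicator S w" for w
    proof (cases "\<pi> w \<in> cbox 0 One \<and> w - \<iota> (\<pi> w) \<in> unit_entries")
      case True
      have "norm (w $ i $ k) \<le> 1 + b" for i k
      proof -
        have "norm (w $ i $ k) \<le> norm ((w - \<iota> (\<pi> w)) $ i $ k) + norm (\<iota> (\<pi> w) $ i $ k)"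
          using norm_triangle_ineq[of "(w - \<iota> (\<pi> w)) $ i $ k" "\<iota> (\<pi> w) $ i $ k"] by simp
        moreover have "norm ((w - \<iota> (\<pi> w)) $ i $ k) \<le> 1"
          using True unfolding unit_entries_def by blast
        moreover have "norm (\<iota> (\<pi> w) $ i $ k) \<le> b"
          using True b b0 by (auto simp: \<iota>_def axis_def)
        ultimately show ?thesis by linarith
      qed
      then show ?thesis
        by (auto simp: S_def unit_bump_def G_def indicator_def)
    qed (auto simp: unit_bump_def G_def)
    then have "(\<integral>\<^sup>+w. unit_bump (\<pi> w) * G (w - \<iota> (\<pi> w)) \<partial>lborel) \<le> (\<integral>\<^sup>+w. ennreal C * ennreal C * indicator S w \<partial>lborel)"
      by (intro nn_integral_mono)
    also have "\<dots> = ennreal C * ennreal C * emeasure lborel S"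
    proof (intro nn_integral_cmult_indicator)
      have "closed S"
        unfolding S_def by (intro closed_Collect_all closed_Collect_le continuous_intros)
      then show "S \<in> sets lborel" by simp
    qed
    also have "\<dots> < \<infinity>"
      using emeasure_bounded_finite[OF bounded_matrix_entries[of S "1 + b"]]
      by (auto simp: S_def ennreal_mult_less_top)
    finally have "(\<integral>\<^sup>+w. unit_bump (\<pi> w) * G (w - \<iota> (\<pi> w)) \<partial>lborel) < \<infinity>" .
    moreover have "(\<integral>\<^sup>+z. f z \<partial>lborel) < \<infinity>"
      unfolding f_def by (rule nn_integral_disc_weight_finite[OF \<alpha>])
    ultimately show ?thesis by (simp add: ennreal_mult_less_top)
  qed
  finally show ?thesis .
qed

lemma nn_integral_ball_weight_pos:
  "0 < (\<integral>\<^sup>+w. ball_weight \<alpha> (w :: ('n::finite) cmatrix) \<partial>lborel)"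
proof (rule ccontr)
  assume "\<not> ?thesis"
  then have "emeasure lborel {w :: 'n cmatrix. ball_weight \<alpha> w \<noteq> 0} = 0"
    using nn_integral_0_iff[of "ball_weight \<alpha> :: 'n cmatrix \<Rightarrow> _" lborel] by simp
  also have "{w :: 'n cmatrix. ball_weight \<alpha> w \<noteq> 0} = heis_ball"
    by (auto simp: ball_weight_def split: if_splits dest: defect_det_pos)
  finally have null: "emeasure lborel (heis_ball :: 'n cmatrix set) = 0" .
  have "(0 :: 'n cmatrix) \<in> heis_ball"
    by (simp add: heis_ball_iff)
  then obtain e where e: "0 < e" "ball (0 :: 'n cmatrix) e \<subseteq> heis_ball"
    using open_heis_ball by (metis open_contains_ball)
  then have "emeasure lborel (ball (0 :: 'n cmatrix) e) = 0"
    using null emeasure_mono[OF e(2), of lborel] borel_open[OF open_heis_ball] by simp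
  then show False
    using content_ball_pos[OF e(1), of "0 :: 'n cmatrix"] by (simp add: measure_def)
qed

section \<open>The upper left block as an isometric embedding\<close>

lemma index_pos_less_card: "index_pos (i :: 'n::{finite,linorder}) < CARD('n)"
  unfolding index_pos_def by (rule psubset_card_mono) auto

lemma inj_index_pos: "inj (index_pos :: 'n::{finite,linorder} \<Rightarrow> nat)"
proof (rule injI, rule ccontr)
  have less: "index_pos i < index_pos j" if "i < j" for i j :: 'n
    unfolding index_pos_def using that by (intro psubset_card_mono) auto
  fix i j :: 'n assume "index_pos i = index_pos j" "i \<noteq> j"
  then show False using less[of i j] less[of j i] by (cases rule: linorder_cases[of i j]) auto
qed

lemma index_at_index_pos: "index_at (index_pos i) = (i :: 'n::{finite,linorder})"
  unfolding index_at_def using inj_index_pos by (rule inv_f_f)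

lemma index_pos_index_at:
  assumes "n < CARD('n)"
  shows "index_pos (index_at n :: 'n::{finite,linorder}) = n"
proof -
  have "index_pos ` (UNIV :: 'n set) = {..<CARD('n)}"
    by (rule card_subset_eq) (auto simp: index_pos_less_card card_image inj_index_pos)
  with assms have "n \<in> range (index_pos :: 'n \<Rightarrow> nat)" by simp
  then show ?thesis
    unfolding index_at_def by (rule f_inv_into_f)
qed

lemma index_pos_eq_iff:
  "m = index_pos (i :: 'n::{finite,linorder}) \<longleftrightarrow> m < CARD('n) \<and> i = index_at m"
  using index_pos_less_card index_at_index_pos index_pos_index_at by metis

lemma sum_index_pos:
  fixes f :: "'n::{finite,linorder} \<Rightarrow> 'a::comm_monoid_add"
  shows "(\<Sum>i\<in>UNIV. if m = index_pos i then f i else 0) = (if m < CARD('n) then f (index_at m) else 0)"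
  by (simp add: index_pos_eq_iff)

type_synonym ('k, 'q) rect = "complex^'k^'q"

text \<open>The isometry that maps the unit vectors of the small space, in order, to the first unit vectors of
  the large one. Padding with zeros is conjugation by it, which makes it multiplicative.\<close>

definition corner :: "('k::{finite,linorder}, 'q::{finite,linorder}) rect" where
  "corner = (\<chi> a i. if index_pos a = index_pos i then 1 else 0)"

lemma corner_mult_nth:
  "((corner :: ('k::{finite,linorder}, 'q::{finite,linorder}) rect) ** A) $ a $ j
     = (if index_pos a < CARD('k) then A $ index_at (index_pos a) $ j else 0)"
proof -
  have "(corner ** A) $ a $ j = (\<Sum>i\<in>UNIV. if index_pos a = index_pos i then A $ (i::'k) $ j else 0)"
    unfolding matrix_matrix_mult_def by (simp add: corner_def) (rule sum.cong, auto)
  then show ?thesis by (simp add: sum_index_pos)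
qed

lemma mult_corner_adjoint_nth:
  "(A ** (corner :: ('k::{finite,linorder}, 'q::{finite,linorder}) rect)\<^sup>\<dagger>) $ j $ a
     = (if index_pos a < CARD('k) then A $ j $ index_at (index_pos a) else 0)"
proof -
  have "(A ** corner\<^sup>\<dagger>) $ j $ a = cnj ((corner ** A\<^sup>\<dagger>) $ a $ j)"
    by (metis conj_transpose_conj_transpose conj_transpose_mult conj_transpose_nth)
  then show ?thesis by (simp add: corner_mult_nth)
qed

lemma pad_zero_eq: "pad_zero r = corner ** r ** corner\<^sup>\<dagger>"
  by (simp add: vec_eq_iff pad_zero_def corner_mult_nth mult_corner_adjoint_nth)

lemma corner_mult_adjoint:
  "(corner :: ('k::{finite,linorder}, 'q::{finite,linorder}) rect) ** corner\<^sup>\<dagger>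
     = coord_proj {a. index_pos a < CARD('k)}"
  by (simp add: vec_eq_iff mult_corner_adjoint_nth)
     (auto simp: corner_def coord_proj_def rdiag_def index_pos_index_at
      dest: injD[OF inj_index_pos])

lemma corner_adjoint_mult:
  assumes "CARD('k::{finite,linorder}) \<le> CARD('q::{finite,linorder})"
  shows "(corner :: ('k, 'q) rect)\<^sup>\<dagger> ** corner = mat 1"
proof -
  have "((corner :: ('k, 'q) rect)\<^sup>\<dagger> ** corner) $ i $ j = (mat 1 :: 'k cmatrix) $ i $ j" for i j
  proof -
    have "((corner :: ('k, 'q) rect)\<^sup>\<dagger> ** corner) $ i $ j
        = (\<Sum>a\<in>(UNIV::'q set). cnj (corner $ a $ i) * corner $ a $ j)"
      by (simp add: matrix_matrix_mult_def)
    also have "\<dots> = (\<Sum>a\<in>(UNIV::'q set). if index_pos i = index_pos a then (if i = j then 1 else 0) else 0)"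
      by (rule sum.cong) (auto simp: corner_def dest: injD[OF inj_index_pos])
    also have "\<dots> = (mat 1 :: 'k cmatrix) $ i $ j"
      using index_pos_less_card[of i] assms by (subst sum_index_pos) (simp add: mat_def)
    finally show ?thesis .
  qed
  then show ?thesis by (simp add: vec_eq_iff)
qed

lemma card_outside_corner:
  assumes "CARD('k::{finite,linorder}) \<le> CARD('q::{finite,linorder})"
  shows "card (- {a::'q. index_pos a < CARD('k)}) = CARD('q) - CARD('k)"
proof -
  have "index_pos ` (- {a::'q. index_pos a < CARD('k)}) = {..<CARD('q)} - {..<CARD('k)}"
  proof (intro equalityI subsetI)
    fix n assume "n \<in> {..<CARD('q)} - {..<CARD('k)}"
    then show "n \<in> index_pos ` (- {a::'q. index_pos a < CARD('k)})"
      by (intro image_eqI[of _ _ "index_at n"]) (simp_all add: index_pos_index_at)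
  qed (auto simp: index_pos_less_card)
  then have "card (- {a::'q. index_pos a < CARD('k)}) = card ({..<CARD('q)} - {..<CARD('k)})"
    using card_image[OF inj_on_subset[OF inj_index_pos subset_UNIV], of "- {a::'q. index_pos a < CARD('k)}"] by simp
  then show ?thesis using assms by (simp add: card_Diff_subset)
qed

text \<open>An eigenbasis of \<open>A\<close> together with the remaining coordinate vectors diagonalises the padded matrix
  and contributes only further eigenvalues \<open>0\<close>.\<close>

lemma det_one_minus_corner:
  fixes A :: "('k::{finite,linorder}) cmatrix"
  assumes le: "CARD('k) \<le> CARD('q::{finite,linorder})" and herm: "A\<^sup>\<dagger> = A"
  shows "det (mat 1 - (corner :: ('k, 'q) rect) ** A ** corner\<^sup>\<dagger>) = det (mat 1 - A)"
proof -
  define J where "J = (corner :: ('k, 'q) rect)"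
  define K where "K = {a::'q. index_pos a < CARD('k)}"
  have JJ: "J\<^sup>\<dagger> ** J = mat 1" and JP: "J ** J\<^sup>\<dagger> = coord_proj K"
    using corner_adjoint_mult[OF le] corner_mult_adjoint[where 'k = 'k and 'q = 'q] by (auto simp: J_def K_def)
  have JJ': "J\<^sup>\<dagger> ** (J ** B) = B" for B :: "('b::finite, 'k) rect"
    by (simp add: matrix_mul_assoc JJ)
  have JQ: "J\<^sup>\<dagger> ** coord_proj (- K) = 0"
  proof -
    have "J\<^sup>\<dagger> ** coord_proj (- K) = J\<^sup>\<dagger> ** (J ** J\<^sup>\<dagger>) ** coord_proj (- K)"
      by (simp add: JJ')
    also have "\<dots> = 0" by (simp add: JP flip: matrix_mul_assoc)
    finally show ?thesis .
  qed
  have QJ: "coord_proj (- K) ** J = 0"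
    using arg_cong[OF JQ, of conj_transpose] by (simp add: conj_transpose_mult)
  have QJ': "coord_proj (- K) ** (J ** B) = 0" for B :: "('b::finite, 'k) rect"
    by (simp add: matrix_mul_assoc QJ)
  obtain S :: "'k cmatrix" and d where S: "unitary S" and dec: "A = S ** rdiag d ** S\<^sup>\<dagger>"
    using herm by (rule hermitian_spectral_decomposition)
  define U where "U = J ** S ** J\<^sup>\<dagger> + coord_proj (- K)"
  have U: "unitary U"
    unfolding unitary_iff
  proof -
    have "U\<^sup>\<dagger> ** U = J ** J\<^sup>\<dagger> + coord_proj (- K)"
      using S by (simp add: U_def conj_transpose_mult matrix_add_ldistrib matrix_add_rdistrib JJ' JQ QJ' flip: matrix_mul_assoc)
    then show "U\<^sup>\<dagger> ** U = mat 1"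
      using coord_proj_add_compl[of K "mat 1"] by (simp add: JP)
  qed
  define d' where "d' a = (if index_pos a < CARD('k) then d (index_at (index_pos a)) else 0)" for a :: 'q
  have diag: "J ** rdiag d ** J\<^sup>\<dagger> = rdiag d'"
  proof -
    have "index_at (index_pos a) = (index_at (index_pos b) :: 'k) \<longleftrightarrow> a = b"
      if "index_pos a < CARD('k)" "index_pos b < CARD('k)" for a b :: 'q
      using that by (metis index_pos_index_at inj_index_pos injD)
    then show ?thesis
      by (auto simp: vec_eq_iff J_def mult_corner_adjoint_nth corner_mult_nth) (auto simp: rdiag_def d'_def)
  qed
  have "J ** A ** J\<^sup>\<dagger> = U ** rdiag d' ** U\<^sup>\<dagger>"
    using S by (simp add: U_def dec conj_transpose_mult matrix_add_ldistrib matrix_add_rdistrib JJ' JQ QJ'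
        flip: diag matrix_mul_assoc)
  then have "mat 1 - J ** A ** J\<^sup>\<dagger> = U ** (mat 1 - rdiag d') ** U\<^sup>\<dagger>"
    using U by (simp add: matrix_diff_ldistrib matrix_diff_rdistrib)
  moreover have "mat 1 - rdiag d' = rdiag (\<lambda>a. 1 - d' a)"
    by (simp add: vec_eq_iff mat_def rdiag_def)
  ultimately have "det (mat 1 - J ** A ** J\<^sup>\<dagger>) = of_real (\<Prod>a\<in>UNIV. 1 - d' a)"
    by (simp add: det_unitary_conj[OF U] det_rdiag del: of_real_prod)
  also have "(\<Prod>a\<in>UNIV. 1 - d' a) = (\<Prod>a\<in>K. 1 - d (index_at (index_pos a)))"
    by (rule prod.mono_neutral_cong_right) (auto simp: K_def d'_def)
  also have "\<dots> = (\<Prod>i\<in>UNIV. 1 - d i)"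
  proof (rule prod.reindex_bij_witness[of _ "\<lambda>i. index_at (index_pos i)" "\<lambda>a. index_at (index_pos a)"])
    fix i :: 'k
    have "index_pos i < CARD('q)"
      using index_pos_less_card[of i] le by linarith
    then have pos: "index_pos (index_at (index_pos i) :: 'q) = index_pos i"
      by (rule index_pos_index_at)
    show "index_at (index_pos (index_at (index_pos i) :: 'q)) = i" "index_at (index_pos i) \<in> K"
      by (simp_all add: K_def pos index_at_index_pos index_pos_less_card)
  next
    fix a assume "a \<in> K"
    then show "index_at (index_pos (index_at (index_pos a) :: 'k)) = a"
      by (simp add: K_def index_pos_index_at index_at_index_pos)
  qed auto
  also have "complex_of_real \<dots> = det (mat 1 - A)"
  proof -
    have "mat 1 - A = S ** (mat 1 - rdiag d) ** S\<^sup>\<dagger>"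
      using S by (simp add: dec matrix_diff_ldistrib matrix_diff_rdistrib)
    moreover have "mat 1 - rdiag d = rdiag (\<lambda>a. 1 - d a)"
      by (simp add: vec_eq_iff mat_def rdiag_def)
    ultimately show ?thesis
      by (simp add: det_unitary_conj[OF S] det_rdiag del: of_real_prod)
  qed
  finally show ?thesis by (simp add: J_def)
qed

lemma norm_isometry_vector:
  fixes V :: "complex^'k^'q"
  assumes "V\<^sup>\<dagger> ** V = mat 1"
  shows "norm (V *v x) = norm x" "norm (V\<^sup>\<dagger> *v y) \<le> norm y"
proof -
  show iso: "norm (V *v x) = norm x" for x
    using assms by (simp add: norm_eq_sqrt_inner inner_matrix_vector_adjoint matrix_vector_mul_assoc)
  have "norm (V\<^sup>\<dagger> *v y) * norm (V\<^sup>\<dagger> *v y) = y \<bullet> (V *v (V\<^sup>\<dagger> *v y))"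
    by (simp add: inner_matrix_vector_adjoint flip: power2_eq_square power2_norm_eq_inner)
  also have "\<dots> \<le> norm y * norm (V\<^sup>\<dagger> *v y)"
    using norm_cauchy_schwarz[of y "V *v (V\<^sup>\<dagger> *v y)"] by (simp add: iso)
  finally show "norm (V\<^sup>\<dagger> *v y) \<le> norm y"
    by (cases "norm (V\<^sup>\<dagger> *v y) = 0") simp_all
qed

lemma heis_ball_isometry:
  fixes V :: "complex^'k^'q"
  assumes V: "V\<^sup>\<dagger> ** V = mat 1"
  shows heis_ball_compress: "w \<in> heis_ball \<Longrightarrow> V\<^sup>\<dagger> ** w ** V \<in> heis_ball"
    and heis_ball_embed_iff: "V ** v ** V\<^sup>\<dagger> \<in> heis_ball \<longleftrightarrow> v \<in> heis_ball"
proof -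
  show compress: "V\<^sup>\<dagger> ** w ** V \<in> heis_ball" if "w \<in> heis_ball" for w
    unfolding heis_ball_iff
  proof (intro allI impI)
    fix x :: "complex^'k" assume x: "x \<noteq> 0"
    then have nz: "V *v x \<noteq> 0"
      using norm_isometry_vector(1)[OF V, of x] by auto
    have "norm ((V\<^sup>\<dagger> ** w ** V) *v x) \<le> norm (w *v (V *v x))"
      using norm_isometry_vector(2)[OF V, of "w *v (V *v x)"] by (simp add: matrix_vector_mul_assoc matrix_mul_assoc)
    also have "\<dots> < norm (V *v x)"
      using that nz by (simp add: heis_ball_iff)
    finally show "norm ((V\<^sup>\<dagger> ** w ** V) *v x) < norm x"
      by (simp add: norm_isometry_vector(1)[OF V])
  qed
  show "V ** v ** V\<^sup>\<dagger> \<in> heis_ball \<longleftrightarrow> v \<in> heis_ball"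
  proof
    assume "V ** v ** V\<^sup>\<dagger> \<in> heis_ball"
    then have "V\<^sup>\<dagger> ** (V ** v ** V\<^sup>\<dagger>) ** V \<in> heis_ball" by (rule compress)
    also have "V\<^sup>\<dagger> ** (V ** v ** V\<^sup>\<dagger>) ** V = (V\<^sup>\<dagger> ** V) ** v ** (V\<^sup>\<dagger> ** V)"
      by (simp only: matrix_mul_assoc)
    finally show "v \<in> heis_ball" by (simp add: V)
  next
    assume v: "v \<in> heis_ball"
    show "V ** v ** V\<^sup>\<dagger> \<in> heis_ball"
      unfolding heis_ball_iff
    proof (intro allI impI)
      fix x :: "complex^'q" assume x: "x \<noteq> 0"
      have "norm ((V ** v ** V\<^sup>\<dagger>) *v x) = norm (v *v (V\<^sup>\<dagger> *v x))"
        using norm_isometry_vector(1)[OF V, of "v *v (V\<^sup>\<dagger> *v x)"] by (simp add: matrix_vector_mul_assoc matrix_mul_assoc)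
      also have "\<dots> < norm x"
      proof (cases "V\<^sup>\<dagger> *v x = 0")
        case False
        then have "norm (v *v (V\<^sup>\<dagger> *v x)) < norm (V\<^sup>\<dagger> *v x)"
          using v by (simp add: heis_ball_iff)
        with norm_isometry_vector(2)[OF V, of x] show ?thesis by simp
      qed (use x in simp)
      finally show "norm ((V ** v ** V\<^sup>\<dagger>) *v x) < norm x" .
    qed
  qed
qed

lemma ball_weight_corner:
  fixes v :: "('k::{finite,linorder}) cmatrix"
  assumes le: "CARD('k) \<le> CARD('q::{finite,linorder})"
  shows "ball_weight \<beta> ((corner :: ('k, 'q) rect) ** v ** corner\<^sup>\<dagger>) = ball_weight \<beta> v"
proof -
  define J where "J = (corner :: ('k, 'q) rect)"
  have JJ: "J\<^sup>\<dagger> ** J = mat 1"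
    using corner_adjoint_mult[OF le] by (simp add: J_def)
  have "(J ** v ** J\<^sup>\<dagger>)\<^sup>\<dagger> ** (J ** v ** J\<^sup>\<dagger>) = J ** v\<^sup>\<dagger> ** (J\<^sup>\<dagger> ** J) ** v ** J\<^sup>\<dagger>"
    by (simp only: conj_transpose_mult conj_transpose_conj_transpose matrix_mul_assoc)
  also have "\<dots> = J ** (v\<^sup>\<dagger> ** v) ** J\<^sup>\<dagger>"
    by (simp add: JJ flip: matrix_mul_assoc)
  finally have "defect_det (J ** v ** J\<^sup>\<dagger>) = defect_det v"
    using det_one_minus_corner[OF le, of "v\<^sup>\<dagger> ** v"]
    by (simp add: defect_det_def J_def conj_transpose_mult)
  then show ?thesis
    using heis_ball_embed_iff[OF JJ] by (simp add: ball_weight_def J_def)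
qed

text \<open>After the block has been split off, the remaining factors do not involve it and integrate to the
  constant \<open>C\<close>. For \<open>\<alpha> = p - 2 q\<close> the raised exponent is exactly \<open>p - 2 k\<close>.\<close>

theorem ball_weight_marginal:
  assumes le: "CARD('k::{finite,linorder}) \<le> CARD('q::{finite,linorder})"
  shows "\<exists>C. \<forall>F\<in>borel_measurable borel.
     (\<integral>\<^sup>+w. F ((corner :: ('k, 'q) rect)\<^sup>\<dagger> ** w ** corner) * ball_weight \<alpha> w \<partial>lborel) =
     C * (\<integral>\<^sup>+v. F v * ball_weight (\<alpha> + 2 * (real CARD('q) - real CARD('k))) v \<partial>lborel)"
proof -
  define J where "J = (corner :: ('k, 'q) rect)"
  define K where "K = {a::'q. index_pos a < CARD('k)}"
  define m where "m = card (- K)"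
  define \<iota> where "\<iota> v = J ** v ** J\<^sup>\<dagger>" for v
  define \<pi> where "\<pi> w = J\<^sup>\<dagger> ** w ** J" for w
  define G where "G w = ball_weight (\<alpha> + m) (coord_proj (- K) ** w ** coord_proj K) * ball_weight \<alpha> (w ** coord_proj (- K))" for w
  have JJ: "J\<^sup>\<dagger> ** J = mat 1" and JP: "J ** J\<^sup>\<dagger> = coord_proj K"
    using corner_adjoint_mult[OF le] corner_mult_adjoint[where 'k = 'k and 'q = 'q] by (auto simp: J_def K_def)
  have m: "real m = real CARD('q) - real CARD('k)"
    using card_outside_corner[OF le] le by (simp add: m_def K_def)
  have Gm: "G \<in> borel_measurable borel"
    unfolding G_def by measurable
  have lin: "linear \<iota>" "linear \<pi>"
    unfolding \<iota>_def \<pi>_def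
    by (intro linear_compose[OF linear_matrix_mult_left linear_matrix_mult_right, unfolded o_def])+
  have [measurable]: "\<iota> \<in> borel_measurable borel" "\<pi> \<in> borel_measurable borel"
    using lin borel_measurable_linear by auto
  have \<iota>\<pi>: "\<iota> (\<pi> w) = coord_proj K ** w ** coord_proj K" for w
    by (simp only: \<iota>_def \<pi>_def matrix_mul_assoc JP) (simp only: JP flip: matrix_mul_assoc)
  have \<pi>\<iota>: "\<pi> (\<iota> v) = v" for v
  proof -
    have "\<pi> (\<iota> v) = (J\<^sup>\<dagger> ** J) ** v ** (J\<^sup>\<dagger> ** J)"
      by (simp only: \<iota>_def \<pi>_def matrix_mul_assoc)
    then show ?thesis by (simp add: JJ)
  qed
  have \<pi>P: "\<pi> (coord_proj K ** w ** coord_proj K) = \<pi> w" for w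
    by (metis \<iota>\<pi> \<pi>\<iota>)
  have adj: "\<iota> v \<bullet> w = v \<bullet> \<pi> w" for v w
    unfolding \<iota>_def \<pi>_def by (subst inner_matrix_mult_right, subst inner_matrix_mult_left) (simp add: matrix_mul_assoc)
  define C where "C = (\<integral>\<^sup>+w. unit_bump (\<pi> w) * G (w - \<iota> (\<pi> w)) \<partial>lborel)"
  have "(\<integral>\<^sup>+w. F (\<pi> w) * ball_weight \<alpha> w \<partial>lborel) = C * (\<integral>\<^sup>+v. F v * ball_weight (\<alpha> + 2 * real m) v \<partial>lborel)"
    if [measurable]: "F \<in> borel_measurable borel" for F
  proof -
    have Fm: "(\<lambda>v. F v * ball_weight (\<alpha> + 2 * real m) v) \<in> borel_measurable borel"
      by measurable
    have "(\<integral>\<^sup>+w. F (\<pi> w) * ball_weight \<alpha> w \<partial>lborel)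
        = (\<integral>\<^sup>+w. F (\<pi> (coord_proj K ** w ** coord_proj K)) * ball_weight \<alpha> w \<partial>lborel)"
      by (simp add: \<pi>P)
    also have "\<dots> = (\<integral>\<^sup>+w. F (\<pi> (coord_proj K ** w ** coord_proj K))
             * ball_weight (\<alpha> + 2 * m) (coord_proj K ** w ** coord_proj K)
             * ball_weight (\<alpha> + m) (coord_proj (- K) ** w ** coord_proj K)
             * ball_weight \<alpha> (w ** coord_proj (- K)) \<partial>lborel)"
      unfolding m_def by (rule nn_integral_split_block) measurable
    also have "\<dots> = (\<integral>\<^sup>+w. (F (\<pi> w) * ball_weight (\<alpha> + 2 * real m) (\<pi> w)) * G (w - \<iota> (\<pi> w)) \<partial>lborel)"
    proof (rule nn_integral_cong)
      fix w
      have "ball_weight (\<alpha> + 2 * real m) (coord_proj K ** w ** coord_proj K) = ball_weight (\<alpha> + 2 * real m) (\<pi> w)"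
        using ball_weight_corner[OF le, of "\<alpha> + 2 * real m" "\<pi> w"] by (simp add: \<iota>_def flip: \<iota>\<pi> J_def)
      moreover have "coord_proj (- K) ** (w - \<iota> (\<pi> w)) ** coord_proj K = coord_proj (- K) ** w ** coord_proj K"
        "(w - \<iota> (\<pi> w)) ** coord_proj (- K) = w ** coord_proj (- K)"
        by (simp_all add: \<iota>\<pi> matrix_diff_ldistrib matrix_diff_rdistrib flip: matrix_mul_assoc)
      ultimately show "F (\<pi> (coord_proj K ** w ** coord_proj K))
             * ball_weight (\<alpha> + real (2 * m)) (coord_proj K ** w ** coord_proj K)
             * ball_weight (\<alpha> + m) (coord_proj (- K) ** w ** coord_proj K)
             * ball_weight \<alpha> (w ** coord_proj (- K))
           = (F (\<pi> w) * ball_weight (\<alpha> + 2 * real m) (\<pi> w)) * G (w - \<iota> (\<pi> w))"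
        by (simp add: \<pi>P G_def mult.assoc)
    qed
    also have "\<dots> = C * (\<integral>\<^sup>+v. F v * ball_weight (\<alpha> + 2 * real m) v \<partial>lborel)"
      unfolding C_def by (rule nn_integral_separate[OF lin adj \<pi>\<iota> Fm Gm])
    finally show ?thesis .
  qed
  then show ?thesis
    by (intro exI[of _ C] ballI) (simp add: \<pi>_def J_def m)
qed

section \<open>The law of the random contraction\<close>

text \<open>The law of the variable \<open>w\<close> in the convolution formula: \<open>heis_conv p x y\<close> is its image under
  \<open>heis_point x y\<close>.\<close>

definition heis_law :: "real \<Rightarrow> ('n::finite) cmatrix measure" where
  "heis_law p = density (restrict_space lborel heis_ball)
     (\<lambda>w. ennreal (heis_kappa TYPE('n) p * heis_weight p w))"

lemma space_heis_law [simp]: "space (heis_law p) = heis_ball"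
  by (simp add: heis_law_def space_restrict_space)

lemma sets_heis_law: "sets (heis_law p) = sets (restrict_space borel heis_ball)"
  by (simp add: heis_law_def cong: sets_restrict_space_cong)

lemma sets_heis_law_iff:
  fixes S :: "('n::finite) cmatrix set"
  shows "S \<in> sets (heis_law p) \<longleftrightarrow> S \<in> sets borel \<and> S \<subseteq> heis_ball"
proof -
  have "(heis_ball :: 'n cmatrix set) \<in> sets borel"
    by (rule borel_open[OF open_heis_ball])
  then show ?thesis
    by (subst sets_heis_law, subst sets_restrict_space_iff) auto
qed

lemma heis_weight_ball_weight:
  "w \<in> heis_ball \<Longrightarrow> ennreal (heis_weight p w) = ball_weight (p - 2 * real CARD('n)) w"
  for w :: "('n::finite) cmatrix"
  by (simp add: heis_weight_def ball_weight_def defect_det_def)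

lemma emeasure_heis_law:
  fixes S :: "('n::finite) cmatrix set"
  assumes p: "2 * real CARD('n) - 1 < p" and S: "S \<in> sets (heis_law p)"
  shows "emeasure (heis_law p) S =
    (\<integral>\<^sup>+w. indicator S w * ball_weight (p - 2 * real CARD('n)) w \<partial>lborel) /
    (\<integral>\<^sup>+w. ball_weight (p - 2 * real CARD('n)) (w :: 'n cmatrix) \<partial>lborel)"
proof -
  define \<alpha> where "\<alpha> = p - 2 * real CARD('n)"
  define I where "I = (\<integral>\<^sup>+w. ball_weight \<alpha> (w :: 'n cmatrix) \<partial>lborel)"
  have I: "0 < I" "I < \<infinity>"
    unfolding I_def by (rule nn_integral_ball_weight_pos, rule nn_integral_ball_weight_finite) (use p in \<open>simp add: \<alpha>_def\<close>)
  have ball [measurable]: "heis_ball \<in> sets (borel :: 'n cmatrix measure)"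
    by (rule borel_open[OF open_heis_ball])
  have Sb [measurable]: "S \<in> sets borel" and sub: "S \<subseteq> heis_ball"
    using S by (auto simp: sets_heis_law_iff)
  have [measurable]: "heis_weight p \<in> borel_measurable (borel :: 'n cmatrix measure)"
  proof -
    have [measurable]: "defect_det \<in> borel_measurable (borel :: 'n cmatrix measure)"
      by (intro borel_measurable_continuous_onI continuous_on_defect_det)
    show ?thesis
      unfolding heis_weight_def defect_det_def[symmetric] by measurable
  qed
  have wm: "heis_weight p \<in> borel_measurable (restrict_space lborel (heis_ball :: 'n cmatrix set))"
    by (intro measurable_restrict_space1) simp
  have restrict: "(\<integral>\<^sup>+w. ennreal (c * heis_weight p w) * f w \<partial>restrict_space lborel heis_ball)
      = ennreal c * (\<integral>\<^sup>+w. f w * ball_weight \<alpha> w \<partial>lborel)"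
    if "0 \<le> c" and [measurable]: "f \<in> borel_measurable borel" for c and f :: "'n cmatrix \<Rightarrow> ennreal"
  proof -
    have "(\<integral>\<^sup>+w. ennreal (c * heis_weight p w) * f w \<partial>restrict_space lborel heis_ball)
        = (\<integral>\<^sup>+w. ennreal (c * heis_weight p w) * f w * indicator heis_ball w \<partial>lborel)"
      by (rule nn_integral_restrict_space) simp
    also have "\<dots> = (\<integral>\<^sup>+w. ennreal c * (f w * ball_weight \<alpha> w) \<partial>lborel)"
    proof (rule nn_integral_cong)
      fix w :: "'n cmatrix"
      show "ennreal (c * heis_weight p w) * f w * indicator heis_ball w = ennreal c * (f w * ball_weight \<alpha> w)"
      proof (cases "w \<in> heis_ball")
        case True
        then show ?thesis
          using that(1) heis_weight_ball_weight[OF True, of p] by (simp add: ennreal_mult' \<alpha>_def mult_ac)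
      qed (simp add: ball_weight_def)
    qed
    also have "\<dots> = ennreal c * (\<integral>\<^sup>+w. f w * ball_weight \<alpha> w \<partial>lborel)"
      by (rule nn_integral_cmult) measurable
    finally show ?thesis .
  qed
  have "integral\<^sup>L (restrict_space lborel (heis_ball :: 'n cmatrix set)) (heis_weight p) = enn2real I"
    using restrict[of 1 "\<lambda>_. 1"]
    by (subst integral_eq_nn_integral[OF wm]) (simp_all add: heis_weight_def I_def)
  then have \<kappa>: "heis_kappa TYPE('n) p = inverse (enn2real I)"
    by (simp add: heis_kappa_def)
  have "emeasure (heis_law p) S = (\<integral>\<^sup>+w. ennreal (heis_kappa TYPE('n) p * heis_weight p w) * indicator S w \<partial>restrict_space lborel heis_ball)"
    unfolding heis_law_def using S wm
    by (intro emeasure_density) (simp_all add: heis_law_def)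
  also have "\<dots> = ennreal (inverse (enn2real I)) * (\<integral>\<^sup>+w. indicator S w * ball_weight \<alpha> w \<partial>lborel)"
    unfolding \<kappa> by (rule restrict) simp_all
  also have "ennreal (inverse (enn2real I)) = inverse I"
    using I by (subst inverse_ennreal[symmetric]) (simp_all add: enn2real_positive_iff less_top)
  finally show ?thesis
    by (simp add: divide_ennreal_def mult.commute I_def \<alpha>_def)
qed

lemma compress_measurable [measurable]:
  fixes V :: "complex^('k::finite)^('q::finite)"
  shows "(\<lambda>w. V\<^sup>\<dagger> ** w ** V) \<in> borel_measurable borel"
  by (intro borel_measurable_linear linear_compose[OF linear_matrix_mult_left linear_matrix_mult_right, unfolded o_def])

text \<open>Unitary invariance moves the subspace to the first \<open>k\<close> coordinates, where \<open>ball_weight_marginal\<close>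
  gives proportionality. The factor is the ratio of the two total masses, which are finite and positive
  because \<open>p > 2 q - 1 \<ge> 2 k - 1\<close>, so it cancels in the normalised laws.\<close>

theorem heis_law_compress:
  fixes u :: "('q::{finite,linorder}) cmatrix" and S :: "('k::{finite,linorder}) cmatrix set"
  assumes le: "CARD('k) \<le> CARD('q)" and p: "2 * real CARD('q) - 1 < p" and u: "unitary u"
    and S: "S \<in> sets (heis_law p)"
  defines "V \<equiv> u ** (corner :: ('k, 'q) rect)"
  shows "{w \<in> heis_ball. V\<^sup>\<dagger> ** w ** V \<in> S} \<in> sets (heis_law p)"
    and "emeasure (heis_law p) {w \<in> heis_ball. V\<^sup>\<dagger> ** w ** V \<in> S} = emeasure (heis_law p) S"
proof -
  define J where "J = (corner :: ('k, 'q) rect)"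
  define \<alpha> where "\<alpha> = p - 2 * real CARD('q)"
  define \<beta> where "\<beta> = p - 2 * real CARD('k)"
  have Sb [measurable]: "S \<in> sets borel" and sub: "S \<subseteq> heis_ball"
    using S by (auto simp: sets_heis_law_iff)
  have [measurable]: "heis_ball \<in> sets (borel :: 'q cmatrix measure)"
    by (rule borel_open[OF open_heis_ball])
  define S' where "S' = {w \<in> heis_ball. V\<^sup>\<dagger> ** w ** V \<in> S}"
  have "S' = heis_ball \<inter> ((\<lambda>w. V\<^sup>\<dagger> ** w ** V) -` S \<inter> space borel)"
    by (auto simp: S'_def)
  also have "\<dots> \<in> sets borel"
    by (intro sets.Int measurable_sets[OF compress_measurable]) simp_all
  finally have S'b: "S' \<in> sets borel" .
  then show S': "S' \<in> sets (heis_law p)"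
    by (auto simp: sets_heis_law_iff S'_def)
  obtain C where C: "(\<integral>\<^sup>+w. F (J\<^sup>\<dagger> ** w ** J) * ball_weight \<alpha> w \<partial>lborel) = C * (\<integral>\<^sup>+v. F v * ball_weight \<beta> v \<partial>lborel)"
    if "F \<in> borel_measurable borel" for F :: "'k cmatrix \<Rightarrow> ennreal"
  proof -
    have "\<alpha> + 2 * (real CARD('q) - real CARD('k)) = \<beta>" by (simp add: \<alpha>_def \<beta>_def)
    with ball_weight_marginal[OF le, of \<alpha>] that show thesis by (auto simp: J_def)
  qed
  define Iq where "Iq = (\<integral>\<^sup>+w. ball_weight \<alpha> (w :: 'q cmatrix) \<partial>lborel)"
  define Ik where "Ik = (\<integral>\<^sup>+v. ball_weight \<beta> (v :: 'k cmatrix) \<partial>lborel)"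
  have Iq: "0 < Iq" "Iq < \<infinity>"
    unfolding Iq_def by (rule nn_integral_ball_weight_pos, rule nn_integral_ball_weight_finite) (use p in \<open>simp add: \<alpha>_def\<close>)
  have pk: "2 * real CARD('k) - 1 < p" using le p by simp
  have Ik: "0 < Ik" "Ik < \<infinity>"
    unfolding Ik_def by (rule nn_integral_ball_weight_pos, rule nn_integral_ball_weight_finite) (use pk in \<open>simp add: \<beta>_def\<close>)
  have Iqk: "Iq = C * Ik"
    using C[of "\<lambda>_. 1"] by (simp add: Iq_def Ik_def)
  have "(\<integral>\<^sup>+w. indicator S' w * ball_weight \<alpha> w \<partial>lborel) = (\<integral>\<^sup>+w. indicator S (V\<^sup>\<dagger> ** w ** V) * ball_weight \<alpha> w \<partial>lborel)"
    by (rule nn_integral_cong) (auto simp: S'_def ball_weight_def indicator_def)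
  also have "\<dots> = (\<integral>\<^sup>+w. indicator S (V\<^sup>\<dagger> ** (u ** w ** u\<^sup>\<dagger>) ** V) * ball_weight \<alpha> (u ** w ** u\<^sup>\<dagger>) \<partial>lborel)"
  proof -
    have "jacobian (\<lambda>w. u ** w ** u\<^sup>\<dagger>) 1"
      using u by (intro jacobian_isometry linear_compose[OF linear_matrix_mult_left linear_matrix_mult_right, unfolded o_def])
        (simp add: norm_unitary_mult_left norm_unitary_mult_right unitary_conj_transpose)
    from jacobianD[OF this, of "\<lambda>w. indicator S (V\<^sup>\<dagger> ** w ** V) * ball_weight \<alpha> w"] show ?thesis
      by simp
  qed
  also have "\<dots> = (\<integral>\<^sup>+w. indicator S (J\<^sup>\<dagger> ** w ** J) * ball_weight \<alpha> w \<partial>lborel)"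
  proof -
    have "V\<^sup>\<dagger> ** (u ** w ** u\<^sup>\<dagger>) ** V = J\<^sup>\<dagger> ** w ** J" for w
      using u by (simp add: V_def J_def conj_transpose_mult flip: matrix_mul_assoc)
    moreover have "ball_weight \<alpha> (u ** w ** u\<^sup>\<dagger>) = ball_weight \<alpha> w" for w
      using ball_weight_unitary_conj[OF unitary_conj_transpose[OF u], of \<alpha> w] by simp
    ultimately show ?thesis by simp
  qed
  also have "\<dots> = C * (\<integral>\<^sup>+v. indicator S v * ball_weight \<beta> v \<partial>lborel)"
    by (rule C) simp
  finally have int: "(\<integral>\<^sup>+w. indicator S' w * ball_weight \<alpha> w \<partial>lborel) = C * (\<integral>\<^sup>+v. indicator S v * ball_weight \<beta> v \<partial>lborel)" .
  have C0: "C \<noteq> 0" "C \<noteq> \<infinity>"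
    using Iq Ik Iqk by (auto simp: ennreal_mult_eq_top_iff)
  have "emeasure (heis_law p) S' = (C * (\<integral>\<^sup>+v. indicator S v * ball_weight \<beta> v \<partial>lborel)) / (C * Ik)"
    using emeasure_heis_law[OF p S'] by (simp add: int Iqk flip: \<alpha>_def Iq_def)
  also have "\<dots> = (\<integral>\<^sup>+v. indicator S v * ball_weight \<beta> v \<partial>lborel) / Ik"
    using C0 by (subst (1 2) mult.commute) (rule divide_mult_eq)
  also have "\<dots> = emeasure (heis_law p) S"
    using emeasure_heis_law[OF pk S] by (simp add: \<beta>_def Ik_def)
  finally show "emeasure (heis_law p) S' = emeasure (heis_law p) S" .
qed

section \<open>The embedding of the Heisenberg hypergroup\<close>

text \<open>Completing the square: the quadratic form at \<open>x\<close> is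
  \<open>\<bar>r x + w s x\<bar>\<^sup>2 + \<bar>s x\<bar>\<^sup>2 - \<bar>w s x\<bar>\<^sup>2\<close>.\<close>

lemma heis_argument_psd:
  fixes r s w :: "('n::finite) cmatrix"
  assumes r: "r \<in> psd_matrices" and s: "s \<in> psd_matrices" and w: "w \<in> heis_ball"
  shows "r ** r + s ** s + r ** w ** s + (r ** w ** s)\<^sup>\<dagger> \<in> psd_matrices"
  unfolding psd_matrices_iff
proof (intro conjI allI)
  have rh: "r\<^sup>\<dagger> = r" and sh: "s\<^sup>\<dagger> = s"
    using r s by (simp_all add: psd_matrices_iff)
  show "(r ** r + s ** s + r ** w ** s + (r ** w ** s)\<^sup>\<dagger>)\<^sup>\<dagger> = r ** r + s ** s + r ** w ** s + (r ** w ** s)\<^sup>\<dagger>"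
  proof -
    have "(r ** r)\<^sup>\<dagger> = r ** r" "(s ** s)\<^sup>\<dagger> = s ** s"
      by (simp_all add: conj_transpose_mult rh sh)
    then show ?thesis by (simp add: add_ac)
  qed
  fix x :: "complex^'n"
  define a where "a = r *v x"
  define b where "b = s *v x"
  have "x \<bullet> ((r ** w ** s)\<^sup>\<dagger> *v x) = x \<bullet> ((r ** w ** s) *v x)"
    using inner_matrix_vector_adjoint[of x "(r ** w ** s)\<^sup>\<dagger>" x] by (simp add: inner_commute)
  moreover have "x \<bullet> ((r ** w ** s) *v x) = a \<bullet> (w *v b)"
    by (simp add: a_def b_def inner_matrix_vector_adjoint[of x r] rh flip: matrix_vector_mul_assoc)
  moreover have "x \<bullet> ((r ** r) *v x) = a \<bullet> a" "x \<bullet> ((s ** s) *v x) = b \<bullet> b"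
    by (simp_all add: a_def b_def inner_matrix_vector_adjoint[of x r] inner_matrix_vector_adjoint[of x s] rh sh
        flip: matrix_vector_mul_assoc)
  ultimately have "x \<bullet> ((r ** r + s ** s + r ** w ** s + (r ** w ** s)\<^sup>\<dagger>) *v x)
      = a \<bullet> a + b \<bullet> b + 2 * (a \<bullet> (w *v b))"
    by (simp add: matrix_vector_mult_add_rdistrib inner_add_right)
  also have "\<dots> = (norm (a + w *v b))\<^sup>2 + ((norm b)\<^sup>2 - (norm (w *v b))\<^sup>2)"
    by (simp add: power2_norm_eq_inner inner_add_left inner_add_right inner_commute)
  also have "\<dots> \<ge> 0"
  proof -
    have "norm (w *v b) \<le> norm b"
      using w by (cases "b = 0") (simp_all add: heis_ball_iff less_imp_le)
    then have "(norm (w *v b))\<^sup>2 \<le> (norm b)\<^sup>2" by (intro power_mono) simp_all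
    then show ?thesis by simp
  qed
  finally show "0 \<le> x \<bullet> ((r ** r + s ** s + r ** w ** s + (r ** w ** s)\<^sup>\<dagger>) *v x)" .
qed

lemma heis_point_mem:
  assumes "x \<in> psd_matrices \<times> UNIV" "y \<in> psd_matrices \<times> UNIV" "w \<in> heis_ball"
  shows "heis_point x y w \<in> psd_matrices \<times> UNIV"
  using assms heis_argument_psd psd_sqrt_psd by (auto simp: heis_point_def)

lemma heis_point_measurable:
  fixes x y :: "('n::finite) cmatrix \<times> real"
  assumes x: "x \<in> psd_matrices \<times> UNIV" and y: "y \<in> psd_matrices \<times> UNIV"
  shows "heis_point x y \<in> measurable (heis_law p) (restrict_space borel (psd_matrices \<times> UNIV))"
proof (rule measurable_restrict_space2)
  show "heis_point x y \<in> space (heis_law p) \<rightarrow> psd_matrices \<times> UNIV"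
    using heis_point_mem[OF x y] by (simp add: Pi_iff)
  obtain r a s b where xy: "x = (r, a)" "y = (s, b)" "r \<in> psd_matrices" "s \<in> psd_matrices"
    using x y by auto
  have "continuous_on heis_ball (heis_point x y)"
    unfolding xy heis_point_def split_conv trace_def
    by (intro continuous_intros continuous_on_compose2[OF continuous_on_psd_sqrt])
      (auto intro!: heis_argument_psd xy)
  then have "heis_point x y \<in> borel_measurable (restrict_space borel heis_ball)"
    by (rule borel_measurable_continuous_on_restrict)
  then show "heis_point x y \<in> measurable (heis_law p) borel"
    by (simp add: sets_heis_law cong: measurable_cong_sets)
qed

lemma emeasure_heis_conv:
  assumes "x \<in> psd_matrices \<times> UNIV" "y \<in> psd_matrices \<times> UNIV"
    and "A \<in> sets (restrict_space borel (psd_matrices \<times> UNIV))"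
  shows "emeasure (heis_conv p x y) A = emeasure (heis_law p) {w \<in> heis_ball. heis_point x y w \<in> A}"
proof -
  have "emeasure (heis_conv p x y) A = emeasure (heis_law p) (heis_point x y -` A \<inter> space (heis_law p))"
    unfolding heis_conv_def heis_law_def[symmetric]
    by (rule emeasure_distr[OF heis_point_measurable[OF assms(1,2)] assms(3)])
  also have "heis_point x y -` A \<inter> space (heis_law p) = {w \<in> heis_ball. heis_point x y w \<in> A}"
    by auto
  finally show ?thesis .
qed

lemma psd_matrices_embed_iff:
  fixes V :: "complex^('k::finite)^('q::finite)"
  assumes V: "V\<^sup>\<dagger> ** V = mat 1"
  shows "V ** r ** V\<^sup>\<dagger> \<in> psd_matrices \<longleftrightarrow> r \<in> psd_matrices"
proof
  assume "V ** r ** V\<^sup>\<dagger> \<in> psd_matrices"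
  then have "V\<^sup>\<dagger> ** (V ** r ** V\<^sup>\<dagger>) ** (V\<^sup>\<dagger>)\<^sup>\<dagger> \<in> psd_matrices"
    by (rule psd_matrices_conj)
  also have "V\<^sup>\<dagger> ** (V ** r ** V\<^sup>\<dagger>) ** (V\<^sup>\<dagger>)\<^sup>\<dagger> = (V\<^sup>\<dagger> ** V) ** r ** (V\<^sup>\<dagger> ** V)"
    by (simp only: matrix_mul_assoc conj_transpose_conj_transpose)
  finally show "r \<in> psd_matrices" by (simp add: V)
qed (rule psd_matrices_conj)

text \<open>Products collapse by \<open>V\<^sup>\<dagger> V = I\<close>, square roots are unique, and traces are cyclic; the contraction \<open>w\<close>
  enters through its compression only.\<close>

lemma heis_point_isometry:
  fixes V :: "complex^('k::finite)^('q::finite)"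
  assumes V: "V\<^sup>\<dagger> ** V = mat 1"
    and r: "r \<in> psd_matrices" and s: "s \<in> psd_matrices" and w: "w \<in> heis_ball"
  shows "heis_point (V ** r ** V\<^sup>\<dagger>, a) (V ** s ** V\<^sup>\<dagger>, b) w =
    (\<lambda>(t, c). (V ** t ** V\<^sup>\<dagger>, c)) (heis_point (r, a) (s, b) (V\<^sup>\<dagger> ** w ** V))"
proof -
  define v where "v = V\<^sup>\<dagger> ** w ** V"
  have VV: "V\<^sup>\<dagger> ** (V ** B) = B" for B :: "complex^'q^'k"
    by (simp add: matrix_mul_assoc V)
  have VV': "V\<^sup>\<dagger> ** (V ** B) = B" for B :: "complex^'k^'k"
    by (simp add: matrix_mul_assoc V)
  define D where "D = r ** r + s ** s + r ** v ** s + (r ** v ** s)\<^sup>\<dagger>"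
  have D: "D \<in> psd_matrices"
    unfolding D_def v_def by (intro heis_argument_psd r s heis_ball_compress V w)
  have rws: "(V ** r ** V\<^sup>\<dagger>) ** w ** (V ** s ** V\<^sup>\<dagger>) = V ** (r ** v ** s) ** V\<^sup>\<dagger>"
    by (simp add: v_def matrix_mul_assoc)
  have arg: "(V ** r ** V\<^sup>\<dagger>) ** (V ** r ** V\<^sup>\<dagger>) + (V ** s ** V\<^sup>\<dagger>) ** (V ** s ** V\<^sup>\<dagger>)
      + V ** (r ** v ** s) ** V\<^sup>\<dagger> + (V ** (r ** v ** s) ** V\<^sup>\<dagger>)\<^sup>\<dagger> = V ** D ** V\<^sup>\<dagger>"
  proof -
    have "(V ** t ** V\<^sup>\<dagger>) ** (V ** t ** V\<^sup>\<dagger>) = V ** (t ** t) ** V\<^sup>\<dagger>" for t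
      by (simp add: VV flip: matrix_mul_assoc)
    moreover have "(V ** t ** V\<^sup>\<dagger>)\<^sup>\<dagger> = V ** t\<^sup>\<dagger> ** V\<^sup>\<dagger>" for t
      by (simp add: conj_transpose_mult matrix_mul_assoc)
    ultimately show ?thesis
      unfolding D_def by (simp only: matrix_add_ldistrib matrix_add_rdistrib)
  qed
  have "psd_sqrt (V ** D ** V\<^sup>\<dagger>) = V ** psd_sqrt D ** V\<^sup>\<dagger>"
  proof (rule psd_sqrt_eqI)
    show "V ** psd_sqrt D ** V\<^sup>\<dagger> \<in> psd_matrices"
      by (rule psd_matrices_conj[OF psd_sqrt_psd[OF D]])
    have "(V ** psd_sqrt D ** V\<^sup>\<dagger>) ** (V ** psd_sqrt D ** V\<^sup>\<dagger>) = V ** (psd_sqrt D ** psd_sqrt D) ** V\<^sup>\<dagger>"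
      by (simp add: VV flip: matrix_mul_assoc)
    then show "(V ** psd_sqrt D ** V\<^sup>\<dagger>) ** (V ** psd_sqrt D ** V\<^sup>\<dagger>) = V ** D ** V\<^sup>\<dagger>"
      by (simp only: psd_sqrt_square[OF D])
  qed
  moreover have "trace (V ** (r ** v ** s) ** V\<^sup>\<dagger>) = trace (r ** v ** s)"
  proof -
    have "trace (V ** (r ** v ** s) ** V\<^sup>\<dagger>) = trace (V\<^sup>\<dagger> ** (V ** (r ** v ** s)))"
      by (rule trace_mul_sym)
    then show ?thesis by (simp only: VV')
  qed
  ultimately show ?thesis
    unfolding heis_point_def split_conv rws arg v_def[symmetric] D_def[symmetric] by simp
qed

theorem proposition2p10:
  fixes p :: real
    and u :: "('q::{finite,linorder}) cmatrix"
  assumes "p > 2 * real CARD('q) - 1"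
    and "CARD('k::{finite,linorder}) \<le> CARD('q)"
    and "unitary u"
  shows "subhypergroup (heisenberg p) (heis_sub TYPE('k) u) \<and>
         hypergroup_iso (heisenberg p :: ('k cmatrix \<times> real) hypergroup)
           (restrict_hypergroup (heisenberg p) (heis_sub TYPE('k) u))
           (heis_embed u)"
proof -
  define V where "V = u ** (corner :: ('k, 'q) rect)"
  define \<phi> where "\<phi> = (\<lambda>(r :: 'k cmatrix, a :: real). (V ** r ** V\<^sup>\<dagger>, a))"
  define \<psi> where "\<psi> = (\<lambda>(A :: 'q cmatrix, a :: real). (V\<^sup>\<dagger> ** A ** V, a))"
  define Hk where "Hk = (psd_matrices \<times> UNIV :: ('k cmatrix \<times> real) set)"
  define Hq where "Hq = (psd_matrices \<times> UNIV :: ('q cmatrix \<times> real) set)"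
  define X where "X = heis_sub TYPE('k) u"
  have V: "V\<^sup>\<dagger> ** V = mat 1"
  proof -
    have "V\<^sup>\<dagger> ** V = (corner :: ('k, 'q) rect)\<^sup>\<dagger> ** corner"
      using assms(3) by (simp add: V_def conj_transpose_mult flip: matrix_mul_assoc)
    then show ?thesis by (simp only: corner_adjoint_mult[OF assms(2)])
  qed
  have pad: "u ** pad_zero r ** u\<^sup>\<dagger> = V ** r ** V\<^sup>\<dagger>" for r :: "'k cmatrix"
    by (simp add: pad_zero_eq V_def conj_transpose_mult matrix_mul_assoc)
  have embed: "heis_embed u = \<phi>"
    by (simp add: heis_embed_def \<phi>_def pad)
  have X_eq: "X = \<phi> ` Hk"
    unfolding X_def heis_sub_def pad by (auto simp: \<phi>_def Hk_def image_iff)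
  have \<psi>\<phi>: "\<psi> (\<phi> z) = z" for z
  proof -
    have "V\<^sup>\<dagger> ** (V ** r ** V\<^sup>\<dagger>) ** V = (V\<^sup>\<dagger> ** V) ** r ** (V\<^sup>\<dagger> ** V)" for r
      by (simp only: matrix_mul_assoc)
    then show ?thesis by (cases z) (simp add: \<phi>_def \<psi>_def V)
  qed
  have \<phi>_Hq: "\<phi> z \<in> Hq \<longleftrightarrow> z \<in> Hk" for z
    using psd_matrices_embed_iff[OF V] by (cases z) (simp add: \<phi>_def Hq_def Hk_def)
  have cont: "continuous_on S \<phi>" "continuous_on S' \<psi>" for S S'
    unfolding \<phi>_def \<psi>_def case_prod_beta by (intro continuous_intros)+
  have X_sub: "X \<subseteq> Hq" using \<phi>_Hq by (auto simp: X_eq)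
  \<comment> \<open>The image is cut out of the large cone by the closed condition \<open>V V\<^sup>\<dagger> A V V\<^sup>\<dagger> = A\<close>.\<close>
  define T where "T = {z. \<phi> (\<psi> z) = z}"
  have X_closed: "X = Hq \<inter> T"
  proof (intro equalityI subsetI)
    fix z assume "z \<in> X"
    then show "z \<in> Hq \<inter> T" using X_sub by (auto simp: X_eq T_def \<psi>\<phi>)
  next
    fix z assume "z \<in> Hq \<inter> T"
    then have "z = \<phi> (\<psi> z)" "\<psi> z \<in> Hk" using \<phi>_Hq[of "\<psi> z"] by (auto simp: T_def)
    then show "z \<in> X" unfolding X_eq by (rule image_eqI)
  qed
  have "closed T"
    unfolding T_def
    by (intro closed_Collect_eq continuous_on_compose2[OF cont(1) cont(2)] continuous_on_id) auto
  have point: "heis_point (\<phi> x) (\<phi> y) w = \<phi> (heis_point x y (V\<^sup>\<dagger> ** w ** V))"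
    if "x \<in> Hk" "y \<in> Hk" "w \<in> heis_ball" for x y w
    using that heis_point_isometry[OF V, of "fst x" "fst y" w "snd x" "snd y"]
    by (cases x; cases y) (simp add: \<phi>_def Hk_def)
  have point_X: "heis_point x y w \<in> X" if xy: "x \<in> X" "y \<in> X" and w: "w \<in> heis_ball" for x y w
  proof -
    obtain x' y' where "x' \<in> Hk" "y' \<in> Hk" "x = \<phi> x'" "y = \<phi> y'" using xy by (auto simp: X_eq)
    then show ?thesis
      using point[of x' y' w] heis_point_mem[of x' y'] heis_ball_compress[OF V w] w by (auto simp: X_eq Hk_def)
  qed
  have "subhypergroup (heisenberg p) X"
    unfolding subhypergroup_def
  proof (intro conjI ballI)
    show "closedin (top_of_set (hg_space (heisenberg p))) X"
      using \<open>closed T\<close> by (auto simp: heisenberg_def closedin_closed X_closed Hq_def)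
    fix x y assume x: "x \<in> X" and y: "y \<in> X"
    show "hg_inv (heisenberg p) x \<in> X"
      using x by (auto simp: heisenberg_def X_eq \<phi>_def Hk_def image_iff)
    show "measure_supp (hg_conv (heisenberg p) x y) \<subseteq> X"
    proof
      fix z assume z: "z \<in> measure_supp (hg_conv (heisenberg p) x y)"
      have sp: "space (heis_conv p x y) = Hq"
        by (simp add: heis_conv_def Hq_def space_restrict_space)
      have zH: "z \<in> Hq" using z by (simp add: measure_supp_def heisenberg_def sp)
      show "z \<in> X"
      proof (rule ccontr)
        assume "z \<notin> X"
        then have "open (- T)" "z \<in> - T" using zH \<open>closed T\<close> X_closed by auto
        then have pos: "0 < emeasure (heis_conv p x y) (- T \<inter> Hq)"
          using z unfolding measure_supp_def by (simp add: heisenberg_def sp)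
        have "- T \<inter> Hq \<in> sets (restrict_space borel Hq)"
          using \<open>open (- T)\<close> by (auto simp: sets_restrict_space intro!: image_eqI[of _ _ "- T"])
        then have "emeasure (heis_conv p x y) (- T \<inter> Hq) = emeasure (heis_law p) {w \<in> heis_ball. heis_point x y w \<in> - T \<inter> Hq}"
          using x y X_sub by (intro emeasure_heis_conv) (auto simp: Hq_def)
        also have "{w \<in> heis_ball. heis_point x y w \<in> - T \<inter> Hq} = {}"
          using point_X[OF x y] X_closed by auto
        finally show False using pos by simp
      qed
    qed
  qed
  moreover have "hypergroup_iso (heisenberg p) (restrict_hypergroup (heisenberg p) X) \<phi>"
    unfolding hypergroup_iso_def
  proof (intro conjI ballI)
    show "homeomorphic_map (top_of_set (hg_space (heisenberg p :: ('k cmatrix \<times> real) hypergroup)))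
        (top_of_set (hg_space (restrict_hypergroup (heisenberg p) X))) \<phi>"
      unfolding homeomorphic_map_maps homeomorphic_maps_def
      using cont \<psi>\<phi>
      by (intro exI[of _ \<psi>])
        (auto simp: heisenberg_def restrict_hypergroup_def X_eq continuous_map_subtopology_eu Hk_def[symmetric])
    show "\<phi> (hg_inv (heisenberg p) x) = hg_inv (restrict_hypergroup (heisenberg p) X) (\<phi> x)" for x
      by (cases x) (simp add: heisenberg_def restrict_hypergroup_def \<phi>_def)
    fix x y :: "'k cmatrix \<times> real"
    assume "x \<in> hg_space (heisenberg p)" "y \<in> hg_space (heisenberg p)"
    then have x: "x \<in> Hk" and y: "y \<in> Hk" by (simp_all add: heisenberg_def Hk_def)
    then have x': "\<phi> x \<in> Hq" and y': "\<phi> y \<in> Hq" by (simp_all add: \<phi>_Hq)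
    have sets_conv: "sets (heis_conv p (\<phi> x) (\<phi> y)) = sets (restrict_space borel Hq)"
      by (simp add: heis_conv_def Hq_def)
    have "distr (heis_conv p x y) (restrict_space borel X) \<phi> = restrict_space (heis_conv p (\<phi> x) (\<phi> y)) X"
    proof (rule measure_eqI)
      show "sets (distr (heis_conv p x y) (restrict_space borel X) \<phi>) = sets (restrict_space (heis_conv p (\<phi> x) (\<phi> y)) X)"
        using X_sub by (simp add: sets_restrict_space_cong[OF sets_conv] sets_restrict_restrict_space Int_absorb1)
      fix A assume "A \<in> sets (distr (heis_conv p x y) (restrict_space borel X) \<phi>)"
      then have A: "A \<in> sets (restrict_space borel X)" by simp
      then obtain B where B: "B \<in> sets borel" "A = X \<inter> B" by (auto simp: sets_restrict_space)
      have AX: "A \<subseteq> X" and AH: "A \<in> sets (restrict_space borel Hq)"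
      proof -
        have "T \<inter> B \<in> sets borel" using B(1) borel_closed[OF \<open>closed T\<close>] by (rule sets.Int[rotated])
        then show "A \<in> sets (restrict_space borel Hq)"
          unfolding sets_restrict_space B X_closed by (auto intro!: image_eqI[of _ _ "T \<inter> B"])
      qed (use B in auto)
      have m\<phi>: "\<phi> \<in> measurable (heis_conv p x y) (restrict_space borel X)"
      proof (rule measurable_restrict_space2)
        show "\<phi> \<in> space (heis_conv p x y) \<rightarrow> X"
          by (auto simp: heis_conv_def space_restrict_space X_eq Hk_def)
        have "\<phi> \<in> borel_measurable (restrict_space borel Hk)"
          by (intro borel_measurable_continuous_on_restrict cont)
        then show "\<phi> \<in> measurable (heis_conv p x y) borel"
          by (simp add: heis_conv_def Hk_def)
      qed
      define S where "S = {v \<in> heis_ball. \<phi> (heis_point x y v) \<in> A}"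
      have pre: "\<phi> -` A \<inter> space (heis_conv p x y) \<in> sets (restrict_space borel (psd_matrices \<times> UNIV))"
        using measurable_sets[OF m\<phi> A] by (simp add: heis_conv_def)
      have xH: "x \<in> psd_matrices \<times> UNIV" "y \<in> psd_matrices \<times> UNIV"
        using x y by (simp_all add: Hk_def)
      have S_eq: "{v \<in> heis_ball. heis_point x y v \<in> \<phi> -` A \<inter> space (heis_conv p x y)} = S"
        using heis_point_mem[OF xH] by (auto simp: S_def heis_conv_def space_restrict_space)
      have S: "S \<in> sets (heis_law p)"
        using measurable_sets[OF heis_point_measurable[OF xH] pre, of p]
        by (simp add: S_eq[symmetric] vimage_def Int_def conj_commute)
      \<comment> \<open>Both convolutions become events of the random contractions; the large event is the small one
        for the compression.\<close>
      have "emeasure (distr (heis_conv p x y) (restrict_space borel X) \<phi>) A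
          = emeasure (heis_conv p x y) (\<phi> -` A \<inter> space (heis_conv p x y))"
        by (rule emeasure_distr[OF m\<phi> A])
      also have "\<dots> = emeasure (heis_law p) S"
        unfolding emeasure_heis_conv[OF xH pre] S_eq ..
      also have "\<dots> = emeasure (heis_law p) {w \<in> heis_ball. V\<^sup>\<dagger> ** w ** V \<in> S}"
        unfolding V_def using assms S by (intro heis_law_compress(2)[symmetric]) simp_all
      also have "{w \<in> heis_ball. V\<^sup>\<dagger> ** w ** V \<in> S} = {w \<in> heis_ball. heis_point (\<phi> x) (\<phi> y) w \<in> A}"
        using heis_ball_compress[OF V] point[OF x y] by (auto simp: S_def)
      also have "emeasure (heis_law p) \<dots> = emeasure (heis_conv p (\<phi> x) (\<phi> y)) A"
        using x' y' AH by (intro emeasure_heis_conv[symmetric]) (simp_all add: Hq_def)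
      also have "\<dots> = emeasure (restrict_space (heis_conv p (\<phi> x) (\<phi> y)) X) A"
      proof (rule emeasure_restrict_space[symmetric])
        show "X \<inter> space (heis_conv p (\<phi> x) (\<phi> y)) \<in> sets (heis_conv p (\<phi> x) (\<phi> y))"
          unfolding sets_conv sets_restrict_space
          using \<open>closed T\<close> X_sub
          by (auto simp: heis_conv_def space_restrict_space X_closed Hq_def intro!: image_eqI[of _ _ T])
      qed (rule AX)
      finally show "emeasure (distr (heis_conv p x y) (restrict_space borel X) \<phi>) A
          = emeasure (restrict_space (heis_conv p (\<phi> x) (\<phi> y)) X) A" .
    qed
    then show "distr (hg_conv (heisenberg p) x y)
         (restrict_space borel (hg_space (restrict_hypergroup (heisenberg p) X))) \<phi> =
        hg_conv (restrict_hypergroup (heisenberg p) X) (\<phi> x) (\<phi> y)"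
      by (simp add: heisenberg_def restrict_hypergroup_def)
  qed
  ultimately show ?thesis
    by (simp add: X_def embed)
qed

end
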